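(* Let $-3<\gamma\le 1$, let the collision kernel be $q(\theta,v-u)=|v-u|^{\gamma}h(\theta)$ with $h\ge 0$ and $\int_0^{\pi/2}h(\theta)\,d\theta<+\infty$, let $\beta>8+2\max\{0,\gamma\}$ and let $w(v)=(1+|v|^2)^{\beta/2}$. Let the initial datum $F_0=F_0(x,v)\ge 0$ on $\mathbb{R}^3\times\mathbb{R}^3$ satisfy $\|wF_0\|_{L^\infty_{x,v}}<+\infty$ and, for every fixed $(x,t)\in\mathbb{R}^3\times(0,+\infty)$ and every bounded measurable set $K\subset\mathbb{R}^3$, $$\int_{K}\big|F_0(x+\delta-v(t+\sigma),v)-F_0(x-vt,v)\big|\,dv\to 0\quad\text{as }(\sigma,\delta)\to(0,0),\ \sigma\in\mathbb{R},\ \delta\in\mathbb{R}^3 .$$ Let $F(t,x,v)$ be a solution of the Boltzmann equation $F_t+v\cdot\nabla_xF=Q(F,F)$ with initial datum $F_0$ that belongs to the space $\mathbf{X}$ (defined in the context). Then the macroscopic components of $F$, namely the density $\int_{\mathbb{R}^3}F(t,x,v)\,dv$, the momentum $\int_{\mathbb{R}^3}vF(t,x,v)\,dv$ and the total energy $\int_{\mathbb{R}^3}|v|^2F(t,x,v)\,dv$, are continuous functions of $(x,t)$ in $\mathbb{R}^3\times(0,+\infty)$.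
   Context: Collision operator: $Q(F_1,F_2)=Q_+(F_1,F_2)-Q_-(F_1,F_2)$, where $$Q_+(F_1,F_2)(v)=\int_{\mathbb{R}^3}\int_{\mathbb{S}^2}q(\theta,v-u)F_1(u')F_2(v')\,du\,d\omega,\qquad Q_-(F_1,F_2)(v)=\int_{\mathbb{R}^3}\int_{\mathbb{S}^2}q(\theta,v-u)F_1(u)F_2(v)\,du\,d\omega,$$ with $u'=u+[(v-u)\cdot\omega]\omega$, $v'=v-[(v-u)\cdot\omega]\omega$, and $\theta\in[0,\pi/2]$ given by $\cos\theta=|(v-u)\cdot\omega|/|v-u|$. $Q$ acts on the velocity variable only, with $(t,x)$ as parameters. The global Maxwellian is $\mu(v)=(2\pi)^{-3/2}e^{-|v|^2/2}$. Space $\mathbf{X}$: $F\in\mathbf{X}$ means that $F(t,x,v)\ge 0$ for a.e. $(t,x,v)\in(0,+\infty)\times\mathbb{R}^3\times\mathbb{R}^3$ and that, for some $b>2$, one of the following two cases holds for every $T>0$: (near Maxwellian) $w(F-\mu)\in L^{b/(b-1)}(0,T;L^2_{x,v})$ and $wF\in L^b(0,T;L^\infty_{x,v})$; or (near vacuum) $wF\in L^{b/(b-1)}(0,T;L^2_{x,v})$ and $wF\in L^b(0,T;L^\infty_{x,v})$. Here $L^p_{x,v}=L^p(\mathbb{R}^3_x\times\mathbb{R}^3_v)$ and $w=w(v)$. Solution: $F$ is a solution with initial datum $F_0$ in the Duhamel form: for $(t,x,v)\in(0,+\infty)\times\mathbb{R}^3\times\mathbb{R}^3$, $$F(t,x,v)=F_0(x-vt,v)e^{-\int_0^tg(\tau;t,x,v)\,d\tau}+\int_0^te^{-\int_s^tg(\tau;t,x,v)\,d\tau}Q_+(F,F)(s,x-v(t-s),v)\,ds,$$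 where $g(\tau;t,x,v)=\int_{\mathbb{R}^3}\int_{\mathbb{S}^2}q(\theta,v-u)F(\tau,x-v(t-\tau),u)\,d\omega\,du$. $F_0$ is a measurable function defined at every point of $\mathbb{R}^3\times\mathbb{R}^3$ (it is evaluated along the sets $\{(x-vt,v):v\in\mathbb{R}^3\}$), and $\|wF_0\|_{L^\infty_{x,v}}$ is accordingly the supremum of $w(v)|F_0(x,v)|$ over all $(x,v)$. *)

theory Defs
  imports "HOL-Analysis.Analysis" "HOL-Probability.Essential_Supremum"
begin

type_synonym R3 = "real^3"

text \<open>
  Surface measure on the unit sphere of \<open>\<real>\<^sup>3\<close>, as a Borel measure on the ambient space: the measure
  of \<open>A\<close> is three times the volume of the cone \<open>{x. 0 < \<bar>x\<bar> < 1 \<and> x / \<bar>x\<bar> \<in> A}\<close>, that is, the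
  measure \<open>d\<omega>\<close> of the polar decomposition \<open>dx = r\<^sup>2 dr d\<omega>\<close>. The two lemmas fix its normalization
  and its support.
\<close>
definition sphere_measure :: "R3 measure" where
  "sphere_measure =
     distr (density lborel (\<lambda>x. 3 * indicator (ball 0 1) x)) borel (\<lambda>x. x /\<^sub>R norm x)"

lemma emeasure_sphere_measure_UNIV: "emeasure sphere_measure UNIV = ennreal (4 * pi)"
proof -
  have [measurable]: "(\<lambda>x::R3. 3 * indicator (ball 0 1) x :: ennreal) \<in> borel_measurable borel"
    by (intro borel_measurable_times_ennreal borel_measurable_indicator) auto
  have "emeasure sphere_measure UNIV
      = emeasure (density lborel (\<lambda>x::R3. 3 * indicator (ball 0 1) x)) UNIV"
    unfolding sphere_measure_def by (subst emeasure_distr) auto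
  also have "\<dots> = (\<integral>\<^sup>+x. 3 * indicator (ball 0 1) (x::R3) \<partial>lborel)"
    by (subst emeasure_density) auto
  also have "\<dots> = 3 * emeasure lborel (ball (0::R3) 1)"
    by (subst nn_integral_cmult) (auto intro!: borel_measurable_indicator)
  also have "\<dots> = ennreal 3 * ennreal (4 / 3 * pi)"
    by (subst emeasure_ball) (auto simp: unit_ball_vol_3)
  also have "\<dots> = ennreal (4 * pi)"
    by (subst ennreal_mult[symmetric]) auto
  finally show ?thesis .
qed

lemma AE_sphere_measure: "AE \<omega> in sphere_measure. norm \<omega> = 1"
proof -
  have "AE x in lborel. norm ((x::R3) /\<^sub>R norm x) = 1"
    using AE_lborel_singleton[of "0::R3"] by (rule eventually_mono) auto
  moreover have "(\<lambda>x::R3. 3 * indicator (ball 0 1) x :: ennreal) \<in> borel_measurable lborel"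
    by (intro borel_measurable_times_ennreal borel_measurable_indicator) auto
  ultimately have "AE x in density lborel (\<lambda>x::R3. 3 * indicator (ball 0 1) x).
      norm (x /\<^sub>R norm x) = 1"
    by (subst AE_density) auto
  then show ?thesis
    unfolding sphere_measure_def by (subst AE_distr_iff) auto
qed

text \<open>
  The Lebesgue integral with values in \<open>[-\<infinity>, \<infinity>]\<close>. The Bochner integral returns \<open>0\<close> for
  non-integrable functions, which would turn \<open>e\<^bsup>-\<infinity>\<^esup>\<close> into \<open>1\<close> in the Duhamel formula. The value
  is meaningless when the integrals of both the positive and the negative part are infinite.
\<close>
definition ereal_integral :: "'a measure \<Rightarrow> ('a \<Rightarrow> ereal) \<Rightarrow> ereal" where
  "ereal_integral M f =
     enn2ereal (\<integral>\<^sup>+x. e2ennreal (f x) \<partial>M) - enn2ereal (\<integral>\<^sup>+x. e2ennreal (- f x) \<partial>M)"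

definition exp_ereal :: "ereal \<Rightarrow> ereal" where
  "exp_ereal a = (if a = \<infinity> then \<infinity> else if a = -\<infinity> then 0 else ereal (exp (real_of_ereal a)))"

text \<open>
  The angle between \<open>z\<close> and the line spanned by the unit vector \<open>\<omega>\<close>. For \<open>z = 0\<close>, a null set
  of the collision integrals, the value is irrelevant.
\<close>
definition collision_angle :: "R3 \<Rightarrow> R3 \<Rightarrow> real" where
  "collision_angle z \<omega> = arccos (\<bar>z \<bullet> \<omega>\<bar> / norm z)"

definition post_u :: "R3 \<Rightarrow> R3 \<Rightarrow> R3 \<Rightarrow> R3" where
  "post_u v u \<omega> = u + ((v - u) \<bullet> \<omega>) *\<^sub>R \<omega>"

definition post_v :: "R3 \<Rightarrow> R3 \<Rightarrow> R3 \<Rightarrow> R3" where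
  "post_v v u \<omega> = v - ((v - u) \<bullet> \<omega>) *\<^sub>R \<omega>"

definition Q_plus :: "(real \<Rightarrow> R3 \<Rightarrow> real) \<Rightarrow> (R3 \<Rightarrow> real) \<Rightarrow> (R3 \<Rightarrow> real) \<Rightarrow> R3 \<Rightarrow> ereal" where
  "Q_plus q F1 F2 v =
     ereal_integral lebesgue (\<lambda>u. ereal_integral sphere_measure (\<lambda>\<omega>.
       ereal (q (collision_angle (v - u) \<omega>) (v - u) * F1 (post_u v u \<omega>) * F2 (post_v v u \<omega>))))"

text \<open>The function \<open>g(\<tau>; t, x, v)\<close> of the Duhamel formula.\<close>
definition collision_freq ::
  "(real \<Rightarrow> R3 \<Rightarrow> real) \<Rightarrow> (real \<Rightarrow> R3 \<Rightarrow> R3 \<Rightarrow> real) \<Rightarrow> real \<Rightarrow> real \<Rightarrow> R3 \<Rightarrow> R3 \<Rightarrow> ereal" where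
  "collision_freq q F \<tau> t x v =
     ereal_integral lebesgue (\<lambda>u. ereal_integral sphere_measure (\<lambda>\<omega>.
       ereal (q (collision_angle (v - u) \<omega>) (v - u) * F \<tau> (x - (t - \<tau>) *\<^sub>R v) u)))"

definition duhamel_solution ::
  "(real \<Rightarrow> R3 \<Rightarrow> real) \<Rightarrow> (R3 \<Rightarrow> R3 \<Rightarrow> real) \<Rightarrow> (real \<Rightarrow> R3 \<Rightarrow> R3 \<Rightarrow> real) \<Rightarrow> bool" where
  "duhamel_solution q F\<^sub>0 F \<longleftrightarrow>
     (\<forall>t>0. \<forall>x v. ereal (F t x v) =
        ereal (F\<^sub>0 (x - t *\<^sub>R v) v)
          * exp_ereal (- ereal_integral (lebesgue_on {0..t}) (\<lambda>\<tau>. collision_freq q F \<tau> t x v))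
        + ereal_integral (lebesgue_on {0..t}) (\<lambda>s.
            exp_ereal (- ereal_integral (lebesgue_on {s..t}) (\<lambda>\<tau>. collision_freq q F \<tau> t x v))
            * Q_plus q (F s (x - (t - s) *\<^sub>R v)) (F s (x - (t - s) *\<^sub>R v)) v))"

definition maxwellian :: "R3 \<Rightarrow> real" where
  "maxwellian v = (2 * pi) powr (-3/2) * exp (- (norm v)\<^sup>2 / 2)"

definition ennreal_powr :: "ennreal \<Rightarrow> real \<Rightarrow> ennreal" where
  "ennreal_powr a p = (if a = \<infinity> then \<infinity> else ennreal (enn2real a powr p))"

definition L2_norm_xv :: "(R3 \<Rightarrow> R3 \<Rightarrow> real) \<Rightarrow> ennreal" where
  "L2_norm_xv G = ennreal_powr (\<integral>\<^sup>+(x, v). ennreal (\<bar>G x v\<bar>\<^sup>2) \<partial>lebesgue) (1/2)"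

definition Linf_norm_xv :: "(R3 \<Rightarrow> R3 \<Rightarrow> real) \<Rightarrow> ennreal" where
  "Linf_norm_xv G = esssup lebesgue (\<lambda>(x, v). ennreal \<bar>G x v\<bar>)"

text \<open>Membership in \<open>L\<^sup>p(0, T; Y)\<close>, where \<open>N\<close> is the norm of \<open>Y\<close> and \<open>0 < p < \<infinity>\<close>.\<close>
definition in_Lp_time ::
  "((R3 \<Rightarrow> R3 \<Rightarrow> real) \<Rightarrow> ennreal) \<Rightarrow> real \<Rightarrow> real \<Rightarrow> (real \<Rightarrow> R3 \<Rightarrow> R3 \<Rightarrow> real) \<Rightarrow> bool" where
  "in_Lp_time N p T G \<longleftrightarrow>
     set_borel_measurable lebesgue ({0<..<T} \<times> UNIV) (\<lambda>(t, x, v). G t x v) \<and>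
     (\<integral>\<^sup>+t\<in>{0<..<T}. ennreal_powr (N (G t)) p \<partial>lebesgue) < \<infinity>"

definition space_X :: "(R3 \<Rightarrow> real) \<Rightarrow> (real \<Rightarrow> R3 \<Rightarrow> R3 \<Rightarrow> real) set" where
  "space_X w = {F.
     (AE (t, x, v) in lebesgue. t > 0 \<longrightarrow> F t x v \<ge> 0) \<and>
     (\<exists>b>2.
        (\<forall>T>0. in_Lp_time L2_norm_xv (b / (b - 1)) T (\<lambda>t x v. w v * (F t x v - maxwellian v)) \<and>
               in_Lp_time Linf_norm_xv b T (\<lambda>t x v. w v * F t x v)) \<or>
        (\<forall>T>0. in_Lp_time L2_norm_xv (b / (b - 1)) T (\<lambda>t x v. w v * F t x v) \<and>
               in_Lp_time Linf_norm_xv b T (\<lambda>t x v. w v * F t x v)))}"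

text \<open>
  The continuity hypothesis on the initial datum. The first conjunct says that the integrals
  whose limit is taken exist; it is not automatic, as \<open>{(x - t *\<^sub>R v, v) | v. True}\<close> is a null set.
\<close>
definition transport_L1_continuous :: "(R3 \<Rightarrow> R3 \<Rightarrow> real) \<Rightarrow> bool" where
  "transport_L1_continuous F\<^sub>0 \<longleftrightarrow>
     (\<forall>x. \<forall>t>0. \<forall>K. bounded K \<and> K \<in> sets lebesgue \<longrightarrow>
        (\<forall>\<^sub>F (\<sigma>, \<delta>) in at (0, 0).
           set_integrable lebesgue K (\<lambda>v. F\<^sub>0 (x + \<delta> - (t + \<sigma>) *\<^sub>R v) v - F\<^sub>0 (x - t *\<^sub>R v) v)) \<and>
        ((\<lambda>(\<sigma>, \<delta>). LINT v:K|lebesgue. \<bar>F\<^sub>0 (x + \<delta> - (t + \<sigma>) *\<^sub>R v) v - F\<^sub>0 (x - t *\<^sub>R v) v\<bar>)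
           \<longlongrightarrow> 0) (at (0, 0)))"

end

theory Submission
  imports Defs
begin

text \<open>
  Fix a point \<open>(t, x)\<close>. In the Duhamel formula all integrals are taken along the characteristics
  \<open>x - (t - \<tau>) v\<close>, and for every fixed \<open>\<tau> < t\<close> these points sweep out the whole space when \<open>v\<close> varies.
  Hence a property of \<open>F\<close> that holds for almost every \<open>(\<tau>, y, u)\<close> is available at
  \<open>(\<tau>, x - (t - \<tau>) v, u)\<close> for almost every \<open>(v, \<tau>, u)\<close>, although \<open>(t, x)\<close> is a single point. In
  particular \<open>F\<close> may be replaced there by a Borel function \<open>f\<close> with \<open>0 \<le> f \<tau> y u \<le> W \<tau> / w u\<close>, where
  \<open>W \<tau>\<close> is the essential supremum of \<open>w F\<close> at time \<open>\<tau>\<close>, a function in \<open>L\<^sup>b\<close> with \<open>b > 2\<close>; in short, both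
  \<open>W\<close> and \<open>W\<^sup>2\<close> are locally integrable (\<open>space_X_representative\<close>, \<open>duhamel_AE\<close>).

  Domination. By conservation of energy the product \<open>1 / (w(u') w(v'))\<close> is at most
  \<open>(1 + |u|\<^sup>2 + |v|\<^sup>2)\<close> to the power \<open>-\<beta>/2\<close>, and integrating this against \<open>|v - u|\<close> to the power \<open>\<gamma>\<close> leaves,
  for \<open>\<beta> > 8 + 2 max 0 \<gamma>\<close>, a power of \<open>v\<close> that decays faster than \<open>|v|\<close> to the power \<open>-5\<close>
  (\<open>gain_bound\<close>). So \<open>F(t, x, v)\<close>, multiplied by \<open>1\<close>, \<open>v\<close> or \<open>|v|\<^sup>2\<close>, has an integrable majorant in \<open>v\<close> that
  is uniform for bounded \<open>t\<close>, and it remains to show that whenever \<open>(t\<^sub>n, x\<^sub>n)\<close> tends to \<open>(t, x)\<close>, a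
  subsequence of \<open>F(t\<^sub>n, x\<^sub>n, v)\<close> converges for almost every \<open>v\<close> (\<open>moments_continuous\<close>).

  Convergence. For the free transport of the initial datum this is the hypothesis on \<open>F\<^sub>0\<close>
  (\<open>transport_AE_subseq\<close>). For the collision terms, continuity of affine changes of variables in
  \<open>L\<^sup>1\<close> gives, along a subsequence, \<open>f(\<tau>, x\<^sub>n - (t\<^sub>n - \<tau>) v, u) \<rightarrow> f(\<tau>, x - (t - \<tau>) v, u)\<close> for almost
  every \<open>(v, \<tau>, u)\<close> (\<open>slice_subseq\<close>). For such a pair \<open>(v, \<tau>)\<close> the densities in \<open>u\<close> converge almost
  everywhere, and the collision frequency and the gain term are continuous under dominated
  almost everywhere convergence (\<open>freq_tendsto\<close>, \<open>gain_tendsto\<close>). For the gain term this needs that the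
  post-collisional velocities \<open>u'\<close> and \<open>v'\<close> avoid a given null set for almost every \<open>(u, \<omega>)\<close>
  (\<open>AE_post_notin\<close>). Two more applications of dominated convergence, in time, finish the proof
  (\<open>absorption_source_subseq\<close>).
\<close>

section \<open>Null sets and changes of variables\<close>

lemma measurable_fst_borel [measurable]:
  "fst \<in> (borel :: ('a::second_countable_topology \<times> 'b::second_countable_topology) measure) \<rightarrow>\<^sub>M borel"
  by (intro borel_measurable_continuous_onI continuous_intros)

lemma measurable_snd_borel [measurable]:
  "snd \<in> (borel :: ('a::second_countable_topology \<times> 'b::second_countable_topology) measure) \<rightarrow>\<^sub>M borel"
  by (intro borel_measurable_continuous_onI continuous_intros)

lemma differentiable_fst [derivative_intros]:
  "f differentiable (at x within s) \<Longrightarrow> (\<lambda>x. fst (f x)) differentiable (at x within s)"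
  unfolding differentiable_def by (blast intro: has_derivative_fst)

lemma differentiable_snd [derivative_intros]:
  "f differentiable (at x within s) \<Longrightarrow> (\<lambda>x. snd (f x)) differentiable (at x within s)"
  unfolding differentiable_def by (blast intro: has_derivative_snd)

lemma AE_lborel_iff_negligible:
  fixes P :: "'a::euclidean_space \<Rightarrow> bool"
  shows "(AE x in lborel. P x) \<longleftrightarrow> negligible {x. \<not> P x}"
proof -
  have "(AE x in lborel. P x) \<longleftrightarrow> (AE x in lebesgue. P x)" by (simp add: AE_completion_iff)
  also have "\<dots> \<longleftrightarrow> negligible {x. \<not> P x}"
    by (simp add: eventually_ae_filter_negligible) (metis (mono_tags, lifting) Collect_subset Compl_subset_Compl_iff double_complement negligible_subset subset_refl uminus_set_def mem_Collect_eq subsetI)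
  finally show ?thesis .
qed

text \<open>
  A differentiable map into a space of at least the same dimension maps null sets to null sets.
  If \<open>g\<close> is a left inverse of \<open>f\<close>, the preimage of a null set under \<open>f\<close> is contained in its image
  under \<open>g\<close>, so that no Jacobian of \<open>f\<close> has to be computed. The predicate \<open>Q\<close> restricts the claim to
  the points where the left inverse is regular.
\<close>
lemma AE_lborel_preimage:
  fixes f :: "'a::euclidean_space \<Rightarrow> 'b::euclidean_space" and g :: "'b \<Rightarrow> 'a"
  assumes P: "AE z in lborel. P z" and dim: "DIM('b) \<le> DIM('a)"
    and g: "\<And>y. y \<in> S \<Longrightarrow> g differentiable (at y)"
    and inv: "\<And>x. Q x \<Longrightarrow> f x \<in> S \<and> g (f x) = x"
  shows "AE x in lborel. Q x \<longrightarrow> P (f x)"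
proof -
  have "negligible ({z. \<not> P z} \<inter> S)"
    using P by (simp add: AE_lborel_iff_negligible negligible_Int)
  moreover have "g differentiable_on ({z. \<not> P z} \<inter> S)"
    using g by (auto simp: differentiable_on_def intro: differentiable_at_withinI)
  ultimately have "negligible (g ` ({z. \<not> P z} \<inter> S))"
    using negligible_differentiable_image_negligible dim by blast
  moreover have "{x. \<not> (Q x \<longrightarrow> P (f x))} \<subseteq> g ` ({z. \<not> P z} \<inter> S)"
    using inv by (force simp: image_iff)
  ultimately show ?thesis
    using negligible_subset by (auto simp: AE_lborel_iff_negligible)
qed

lemma AE_lborel_pair:
  fixes P :: "'a::euclidean_space \<times> 'b::euclidean_space \<Rightarrow> bool"
  assumes "AE z in lborel. P z"
  shows "AE x in lborel. AE y in lborel. P (x, y)"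
proof -
  have "AE z in (lborel :: 'a measure) \<Otimes>\<^sub>M (lborel :: 'b measure). P z"
    unfolding lborel_prod by (rule assms)
  then show ?thesis by (rule pair_sigma_finite.AE_pair[rotated]) standard
qed

lemma AE_lborel_pairI:
  fixes P :: "'a::euclidean_space \<Rightarrow> 'b::euclidean_space \<Rightarrow> bool"
  assumes "AE x in lborel. AE y in lborel. P x y" and "{z. P (fst z) (snd z)} \<in> sets borel"
  shows "AE z in lborel. P (fst z) (snd z)"
proof -
  have "AE z in (lborel :: 'a measure) \<Otimes>\<^sub>M (lborel :: 'b measure). P (fst z) (snd z)"
  proof (rule pair_sigma_finite.AE_pair_measure)
    have "{z \<in> space (lborel \<Otimes>\<^sub>M lborel). P (fst z) (snd z)} = {z. P (fst z) (snd z)}"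
      by (simp add: space_pair_measure)
    then show "{z \<in> space (lborel \<Otimes>\<^sub>M lborel). P (fst z) (snd z)} \<in> sets (lborel \<Otimes>\<^sub>M lborel)"
      unfolding lborel_prod using assms(2) by simp
  qed (use assms(1) in \<open>auto intro: lborel_pair.pair_sigma_finite_axioms pair_sigma_finite.intro sigma_finite_lborel\<close>)
  then show ?thesis unfolding lborel_prod .
qed

lemma AE_lborel_swap:
  fixes P :: "'a::euclidean_space \<Rightarrow> 'b::euclidean_space \<Rightarrow> bool"
  assumes "AE z in lborel. P (fst z) (snd z)"
  shows "AE y in lborel. AE x in lborel. P x y"
proof -
  have "AE w::'b \<times> 'a in lborel. True \<longrightarrow> (\<lambda>z. P (fst z) (snd z)) (snd w, fst w)"
    by (rule AE_lborel_preimage[where S = UNIV and g = "\<lambda>z. (snd z, fst z)"])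
       (use assms in \<open>auto intro!: derivative_intros\<close>)
  then have "AE w::'b \<times> 'a in lborel. P (snd w) (fst w)" by simp
  then show ?thesis using AE_lborel_pair by fastforce
qed

lemma AE_sphere_measureI:
  assumes "AE x in lborel. P (x /\<^sub>R norm x)" and [measurable]: "{\<omega>. P \<omega>} \<in> sets borel"
  shows "AE \<omega> in sphere_measure. P \<omega>"
proof -
  have "(\<lambda>x::R3. 3 * indicator (ball 0 1) x :: ennreal) \<in> borel_measurable lborel"
    by (intro borel_measurable_times_ennreal borel_measurable_indicator) auto
  then have "AE x in density lborel (\<lambda>x::R3. 3 * indicator (ball 0 1) x). P (x /\<^sub>R norm x)"
    using assms(1) by (subst AE_density) auto
  then show ?thesis
    unfolding sphere_measure_def by (subst AE_distr_iff) auto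
qed

lemma AE_hyperplane:
  fixes a :: "'a::euclidean_space"
  assumes "a \<noteq> 0"
  shows "AE x in lborel. a \<bullet> x \<noteq> b"
  using negligible_hyperplane[of a b] assms by (simp add: AE_lborel_iff_negligible)

text \<open>
  Put \<open>z = u - v\<close>. Then \<open>u' - v\<close> is the projection of \<open>z\<close> onto the plane orthogonal to \<open>\<omega>\<close> and
  \<open>v' - v\<close> its projection onto the line spanned by \<open>\<omega>\<close>. For a single \<open>\<omega>\<close> the values lie in a plane or on
  a line, so both variables have to be used. With \<open>\<omega> = x / |x|\<close> for \<open>x\<close> in the whole space, the
  projections become rational functions of \<open>(x, u)\<close>, and each of them is one component of a map of
  the six-dimensional space that has a rational left inverse.
\<close>
lemma AE_post_notin:
  fixes N :: "R3 set"
  assumes N: "AE x in lborel. x \<notin> N" and [measurable]: "N \<in> sets borel"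
  shows "AE u in lborel. AE \<omega> in sphere_measure. post_u v u \<omega> \<notin> N \<and> post_v v u \<omega> \<notin> N"
proof -
  define e :: R3 where "e = axis 1 1"
  define e' :: R3 where "e' = axis 2 1"
  have e: "e \<bullet> e = 1" "e' \<bullet> e' = 1" "e \<bullet> e' = 0" "e' \<bullet> e = 0" "e \<noteq> 0" "e' \<noteq> 0"
    by (auto simp: e_def e'_def inner_axis_axis axis_eq_0_iff)
  define s where "s x u = ((u - v) \<bullet> x) / (x \<bullet> x)" for x u :: R3
  define U where "U x u = u - s x u *\<^sub>R x" for x u :: R3
  define V where "V x u = v + s x u *\<^sub>R x" for x u :: R3
  have N2: "AE z :: R3 \<times> R3 in lborel. fst z \<notin> N"
  proof (rule AE_lborel_pairI)
    show "AE x in lborel. AE y :: R3 in lborel. x \<notin> N" using N by eventually_elim simp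
  qed measurable
  \<comment> \<open>The second component has \<open>e\<close>-component \<open>s x u\<close>. The \<open>e\<close>-component of \<open>x\<close> that it replaces is recovered from \<open>x \<bullet> a = 0\<close> with \<open>a = U x u - v\<close>, and then \<open>u - v = a + s x\<close>.\<close>
  let ?f = "\<lambda>(x, u). (U x u, x + (s x u - x \<bullet> e) *\<^sub>R e)"
  let ?g = "\<lambda>c. let a = fst c - v; y = snd c; x = y - ((y \<bullet> a) / (a \<bullet> e)) *\<^sub>R e
                   in (x, v + a + (y \<bullet> e) *\<^sub>R x)"
  have "AE z :: R3 \<times> R3 in lborel. (fst z \<noteq> 0 \<and> (U (fst z) (snd z) - v) \<bullet> e \<noteq> 0) \<longrightarrow>
      fst (?f z) \<notin> N"
  proof (rule AE_lborel_preimage[OF N2, where S = "{c. (fst c - v) \<bullet> e \<noteq> 0}"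
      and g = ?g])
    fix c :: "R3 \<times> R3" assume "c \<in> {c. (fst c - v) \<bullet> e \<noteq> 0}"
    then show "?g differentiable (at c)"
      unfolding Let_def by (intro derivative_intros differentiable_divide differentiable_inner) auto
  next
    fix z :: "R3 \<times> R3" assume z: "fst z \<noteq> 0 \<and> (U (fst z) (snd z) - v) \<bullet> e \<noteq> 0"
    obtain x u where [simp]: "z = (x, u)" by (cases z)
    have "x \<bullet> (U x u - v) = 0"
      using z by (simp add: U_def s_def inner_simps field_simps inner_commute)
    then have "(x + (s x u - x \<bullet> e) *\<^sub>R e) \<bullet> (U x u - v) = (s x u - x \<bullet> e) * ((U x u - v) \<bullet> e)"
      by (simp add: inner_add_left inner_commute[of e])
    then show "?f z \<in> {c. (fst c - v) \<bullet> e \<noteq> 0} \<and> ?g (?f z) = z"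
      using z e by (simp add: Let_def inner_add_left) (simp add: U_def)
  qed auto
  moreover have "AE z :: R3 \<times> R3 in lborel. (fst z \<noteq> 0 \<and> (U (fst z) (snd z) - v) \<bullet> e \<noteq> 0)"
  proof (rule AE_lborel_pairI)
    have "AE x in lborel. e' \<bullet> x \<noteq> 0" using e by (intro AE_hyperplane)
    then show "AE x in lborel. AE u in lborel. x \<noteq> 0 \<and> (U x u - v) \<bullet> e \<noteq> 0"
    proof (rule eventually_mono)
      fix x :: R3 assume x: "e' \<bullet> x \<noteq> 0"
      then have x0: "x \<noteq> 0" by auto
      define d where "d = e - ((x \<bullet> e) / (x \<bullet> x)) *\<^sub>R x"
      have "(U x u - v) \<bullet> e = d \<bullet> u - d \<bullet> v" for u
        by (simp add: U_def s_def d_def inner_simps inner_commute field_simps diff_divide_distrib)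
      moreover have "d \<noteq> 0"
      proof
        assume d: "d = 0"
        then have "d \<bullet> e' = 0" by simp
        then have "x \<bullet> e = 0" using x x0 e by (simp add: d_def inner_simps inner_commute)
        then show False using d e by (simp add: d_def)
      qed
      ultimately show "AE u in lborel. x \<noteq> 0 \<and> (U x u - v) \<bullet> e \<noteq> 0"
        using AE_hyperplane[of d "d \<bullet> v"] x0 by (auto elim!: eventually_mono)
    qed
    show "{z. fst z \<noteq> 0 \<and> (U (fst z) (snd z) - v) \<bullet> e \<noteq> 0} \<in> sets borel"
      unfolding U_def s_def by measurable
  qed
  ultimately have Ua: "AE z :: R3 \<times> R3 in lborel. U (fst z) (snd z) \<notin> N"
    by eventually_elim (auto simp: case_prod_unfold)
  \<comment> \<open>Here \<open>b = V x u - v = s x\<close>. The second component has \<open>e\<close>-component \<open>1 / s x u\<close>, which yields \<open>x\<close> from \<open>b\<close>; the \<open>e\<close>-component of \<open>z = u - v\<close> is recovered from \<open>z \<bullet> b = b \<bullet> b\<close>.\<close>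
  let ?f = "\<lambda>(x, u). (V x u, (u - v) + (1 / s x u - (u - v) \<bullet> e) *\<^sub>R e)"
  let ?g = "\<lambda>c. let b = fst c - v; y = snd c
                   in ((y \<bullet> e) *\<^sub>R b, v + y + ((b \<bullet> b - y \<bullet> b) / (b \<bullet> e)) *\<^sub>R e)"
  have "AE z :: R3 \<times> R3 in lborel. (fst z \<noteq> 0 \<and> s (fst z) (snd z) \<noteq> 0 \<and> (V (fst z) (snd z) - v) \<bullet> e \<noteq> 0) \<longrightarrow>
      fst (?f z) \<notin> N"
  proof (rule AE_lborel_preimage[OF N2, where S = "{c. (fst c - v) \<bullet> e \<noteq> 0}"
      and g = ?g])
    fix c :: "R3 \<times> R3" assume "c \<in> {c. (fst c - v) \<bullet> e \<noteq> 0}"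
    then show "?g differentiable (at c)"
      unfolding Let_def by (intro derivative_intros differentiable_divide differentiable_inner) auto
  next
    fix z :: "R3 \<times> R3" assume z: "fst z \<noteq> 0 \<and> s (fst z) (snd z) \<noteq> 0 \<and> (V (fst z) (snd z) - v) \<bullet> e \<noteq> 0"
    obtain x u where [simp]: "z = (x, u)" by (cases z)
    have b: "V x u - v = s x u *\<^sub>R x" by (simp add: V_def)
    have "(u - v) \<bullet> x = s x u * (x \<bullet> x)" using z by (simp add: s_def)
    then have *: "(u - v) \<bullet> (V x u - v) = (V x u - v) \<bullet> (V x u - v)" by (simp add: b)
    define \<kappa> where "\<kappa> = 1 / s x u - (u - v) \<bullet> e"
    define y where "y = (u - v) + \<kappa> *\<^sub>R e"
    have ye: "y \<bullet> e = 1 / s x u" by (simp add: y_def \<kappa>_def inner_add_left e)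
    have "(V x u - v) \<bullet> (V x u - v) - y \<bullet> (V x u - v) = - \<kappa> * ((V x u - v) \<bullet> e)"
      by (simp add: y_def inner_add_left * inner_commute[of e])
    then have "((V x u - v) \<bullet> (V x u - v) - y \<bullet> (V x u - v)) / ((V x u - v) \<bullet> e) = - \<kappa>"
      using z by simp
    moreover have "(y \<bullet> e) *\<^sub>R (V x u - v) = x" unfolding ye b using z by simp
    moreover have "v + y + (- \<kappa>) *\<^sub>R e = u" by (simp add: y_def)
    ultimately have "?g (V x u, y) = z" by (simp add: Let_def del: scaleR_minus_left)
    then show "?f z \<in> {c. (fst c - v) \<bullet> e \<noteq> 0} \<and> ?g (?f z) = z"
      using z by (simp only: y_def \<kappa>_def) auto
  qed auto
  moreover have "AE z :: R3 \<times> R3 in lborel. (fst z \<noteq> 0 \<and> s (fst z) (snd z) \<noteq> 0 \<and> (V (fst z) (snd z) - v) \<bullet> e \<noteq> 0)"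
  proof (rule AE_lborel_pairI)
    have "AE x in lborel. e \<bullet> x \<noteq> 0" using e by (intro AE_hyperplane)
    then show "AE x in lborel. AE u in lborel. x \<noteq> 0 \<and> s x u \<noteq> 0 \<and> (V x u - v) \<bullet> e \<noteq> 0"
    proof (rule eventually_mono)
      fix x :: R3 assume x: "e \<bullet> x \<noteq> 0"
      then have x0: "x \<noteq> 0" by auto
      show "AE u in lborel. x \<noteq> 0 \<and> s x u \<noteq> 0 \<and> (V x u - v) \<bullet> e \<noteq> 0"
        using AE_hyperplane[OF x0, of "x \<bullet> v"]
        by eventually_elim (use x x0 in \<open>auto simp: V_def s_def inner_simps inner_commute\<close>)
    qed
    show "{z. fst z \<noteq> 0 \<and> s (fst z) (snd z) \<noteq> 0 \<and> (V (fst z) (snd z) - v) \<bullet> e \<noteq> 0} \<in> sets borel"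
      unfolding V_def s_def by measurable
  qed
  ultimately have "AE z :: R3 \<times> R3 in lborel. V (fst z) (snd z) \<notin> N"
    by eventually_elim (auto simp: case_prod_unfold)
  with Ua have "AE z :: R3 \<times> R3 in lborel. U (fst z) (snd z) \<notin> N \<and> V (fst z) (snd z) \<notin> N"
    by eventually_elim auto
  then have "AE u in lborel. AE x in lborel. U x u \<notin> N \<and> V x u \<notin> N" by (rule AE_lborel_swap)
  then show ?thesis
  proof (rule eventually_mono, intro AE_sphere_measureI)
    fix u assume "AE x in lborel. U x u \<notin> N \<and> V x u \<notin> N"
    moreover have "post_u v u (x /\<^sub>R norm x) = U x u \<and> post_v v u (x /\<^sub>R norm x) = V x u" for x
      by (simp add: post_u_def post_v_def U_def V_def s_def inner_diff_left dot_square_norm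
          power2_eq_square divide_inverse algebra_simps scaleR_left_diff_distrib)
    ultimately show "AE x in lborel. post_u v u (x /\<^sub>R norm x) \<notin> N \<and> post_v v u (x /\<^sub>R norm x) \<notin> N"
      by simp
    show "{\<omega>. post_u v u \<omega> \<notin> N \<and> post_v v u \<omega> \<notin> N} \<in> sets borel"
      unfolding post_u_def post_v_def by measurable
  qed
qed

section \<open>The law of the collision angle\<close>

lemma nn_integral_lborel_affine:
  fixes \<phi> :: "'a::euclidean_space \<Rightarrow> ennreal"
  assumes [measurable]: "\<phi> \<in> borel_measurable borel" and c: "c \<noteq> 0"
  shows "(\<integral>\<^sup>+x. \<phi> x \<partial>lborel) = ennreal (\<bar>c\<bar> ^ DIM('a)) * (\<integral>\<^sup>+x. \<phi> (t + c *\<^sub>R x) \<partial>lborel)"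
proof -
  have "(\<integral>\<^sup>+x. \<phi> x \<partial>lborel)
      = (\<integral>\<^sup>+x. \<phi> x \<partial>density (distr lborel borel (\<lambda>x. t + c *\<^sub>R x)) (\<lambda>_. \<bar>c\<bar> ^ DIM('a)))"
    using lborel_affine[OF c, of t] by simp
  also have "\<dots> = ennreal (\<bar>c\<bar> ^ DIM('a)) * (\<integral>\<^sup>+x. \<phi> (t + c *\<^sub>R x) \<partial>lborel)"
    by (simp add: nn_integral_density nn_integral_distr nn_integral_cmult)
  finally show ?thesis .
qed

lemma nn_integral_lborel_translate:
  fixes \<phi> :: "'a::euclidean_space \<Rightarrow> ennreal"
  assumes "\<phi> \<in> borel_measurable borel"
  shows "(\<integral>\<^sup>+x. \<phi> (x + t) \<partial>lborel) = (\<integral>\<^sup>+x. \<phi> x \<partial>lborel)"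
  using nn_integral_lborel_affine[OF assms, of 1 t] by (simp add: add.commute)

text \<open>
  Averaging over the translations by \<open>r e\<close>, \<open>0 \<le> r \<le> 1\<close>, turns estimates along the direction \<open>e\<close> into
  one-dimensional integrals, without a choice of coordinates adapted to \<open>e\<close>.
\<close>
lemma nn_integral_lborel_slide:
  fixes \<phi> :: "'a::euclidean_space \<Rightarrow> ennreal"
  assumes [measurable]: "\<phi> \<in> borel_measurable borel"
  shows "(\<integral>\<^sup>+x. \<phi> x \<partial>lborel) = (\<integral>\<^sup>+x. (\<integral>\<^sup>+r. \<phi> (x + r *\<^sub>R e) * indicator {0..1} r \<partial>lborel) \<partial>lborel)"
proof -
  have "(\<integral>\<^sup>+x. (\<integral>\<^sup>+r. \<phi> (x + r *\<^sub>R e) * indicator {0..1} r \<partial>lborel) \<partial>lborel)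
      = (\<integral>\<^sup>+r. (\<integral>\<^sup>+x. \<phi> (x + r *\<^sub>R e) * indicator {0..1} r \<partial>lborel) \<partial>lborel)"
    by (intro lborel_pair.Fubini') measurable
  also have "\<dots> = (\<integral>\<^sup>+r. (\<integral>\<^sup>+x. \<phi> x \<partial>lborel) * indicator {0..1::real} r \<partial>lborel)"
    by (simp add: nn_integral_multc nn_integral_lborel_translate)
  also have "\<dots> = (\<integral>\<^sup>+x. \<phi> x \<partial>lborel)"
    by (simp add: nn_integral_cmult)
  finally show ?thesis by simp
qed

lemma emeasure_ball_finite: "emeasure lborel (ball (c::'a::euclidean_space) r) < \<infinity>"
  by (rule emeasure_bounded_finite) simp

lemma emeasure_slab_le:
  fixes f :: "'a::euclidean_space"
  assumes f: "norm f = 1" and s: "s \<ge> 0"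
  shows "emeasure lborel {x. norm x < R \<and> \<bar>x \<bullet> f\<bar> < s} \<le> ennreal (2 * s) * emeasure lborel (ball (0::'a) (R + 1))"
proof -
  have ff: "f \<bullet> f = 1" using f by (simp add: norm_eq_1)
  have [measurable]: "{x. norm x < R \<and> \<bar>x \<bullet> f\<bar> < s} \<in> sets borel" by measurable
  have "emeasure lborel {x. norm x < R \<and> \<bar>x \<bullet> f\<bar> < s}
     = (\<integral>\<^sup>+x. indicator {x. norm x < R \<and> \<bar>x \<bullet> f\<bar> < s} x \<partial>lborel)"
    by simp
  also have "\<dots> = (\<integral>\<^sup>+x. (\<integral>\<^sup>+r. indicator {x. norm x < R \<and> \<bar>x \<bullet> f\<bar> < s} (x + r *\<^sub>R f) * indicator {0..1} r \<partial>lborel) \<partial>lborel)"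
    by (rule nn_integral_lborel_slide) measurable
  also have "\<dots> \<le> (\<integral>\<^sup>+x. ennreal (2 * s) * indicator (ball (0::'a) (R + 1)) x \<partial>lborel)"
  proof (rule nn_integral_mono)
    fix x :: 'a
    show "(\<integral>\<^sup>+r. indicator {x. norm x < R \<and> \<bar>x \<bullet> f\<bar> < s} (x + r *\<^sub>R f) * indicator {0..1} r \<partial>lborel)
       \<le> ennreal (2 * s) * indicator (ball 0 (R + 1)) x"
    proof (cases "norm x < R + 1")
      case True
      have "(\<integral>\<^sup>+r. indicator {x. norm x < R \<and> \<bar>x \<bullet> f\<bar> < s} (x + r *\<^sub>R f) * indicator {0..1} r \<partial>lborel)
         \<le> (\<integral>\<^sup>+r. indicator {- s - x \<bullet> f .. s - x \<bullet> f} r \<partial>lborel)"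
        by (intro nn_integral_mono) (auto simp: indicator_def inner_add_left ff abs_less_iff)
      also have "\<dots> = ennreal (2 * s)" using s by simp
      finally show ?thesis using True by simp
    next
      case False
      have "norm (x + r *\<^sub>R f) \<ge> R" if "r \<in> {0..1}" for r
        using norm_triangle_ineq4[of "x + r *\<^sub>R f" "r *\<^sub>R f"] False that f by simp
      then have "indicator {x. norm x < R \<and> \<bar>x \<bullet> f\<bar> < s} (x + r *\<^sub>R f) * indicator {0..1} r = (0::ennreal)" for r
        by (force simp: indicator_def not_less)
      then show ?thesis by (simp only: nn_integral_const) simp
    qed
  qed
  also have "\<dots> = ennreal (2 * s) * emeasure lborel (ball (0::'a) (R + 1))"
    by (simp add: nn_integral_cmult_indicator)
  finally show ?thesis .
qed

text \<open>
  Outside \<open>[-1, 1]\<close> the definite description that defines \<open>arccos\<close> has no witness, so that all values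
  there coincide.
\<close>
lemma borel_measurable_arccos [measurable]: "arccos \<in> borel_measurable borel"
proof -
  have "arccos = (\<lambda>y. if y \<in> {-1..1} then arccos y else (THE x::real. False))"
  proof
    fix y :: real
    have "\<not> (\<exists>x. 0 \<le> x \<and> x \<le> pi \<and> cos x = y)" if "y \<notin> {-1..1}"
      using that cos_ge_minus_one cos_le_one by force
    then have "y \<notin> {-1..1} \<Longrightarrow> (\<lambda>x. 0 \<le> x \<and> x \<le> pi \<and> cos x = y) = (\<lambda>x. False)" by blast
    then show "arccos y = (if y \<in> {-1..1} then arccos y else (THE x::real. False))"
      by (auto simp: arccos_def)
  qed
  moreover have "(\<lambda>y. if y \<in> {-1..1} then arccos y else (THE x::real. False)) \<in> borel_measurable borel"
    by (intro borel_measurable_continuous_on_if continuous_on_arccos') auto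
  ultimately show ?thesis by simp
qed

text \<open>
  On a line at distance \<open>p\<close> from an axis, the angle \<open>\<theta>\<close> with the axis is related to the position on
  the line by \<open>s = - p cot \<theta>\<close>, for \<open>s \<le> 0\<close>. The Jacobian is \<open>p / sin\<^sup>2 \<theta>\<close>, and inside the unit ball
  \<open>p\<^sup>2 + s\<^sup>2 = p\<^sup>2 / sin\<^sup>2 \<theta> < 1\<close>, so it is at most \<open>1 / sin \<theta>\<close>.
\<close>
lemma nn_integral_arccos_line_le:
  fixes H :: "real \<Rightarrow> ennreal"
  assumes [measurable]: "H \<in> borel_measurable borel" and p: "0 < p"
  shows "(\<integral>\<^sup>+s. H (arccos (\<bar>s\<bar> / sqrt (p\<^sup>2 + s\<^sup>2))) * indicator {s. p\<^sup>2 + s\<^sup>2 < 1} s \<partial>lborel)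
     \<le> 2 * (\<integral>\<^sup>+\<theta>. H \<theta> * ennreal (1 / sin \<theta>) * indicator {\<theta>. p < sin \<theta>} \<theta> * indicator {0..pi/2} \<theta> \<partial>lborel)"
proof (cases "p < 1")
  case False
  then have "\<not> p\<^sup>2 + s\<^sup>2 < 1" for s :: real
    by (smt (verit) one_le_power zero_le_power2)
  then show ?thesis by simp
next
  case True
  \<comment> \<open>The angle at which the line meets the unit sphere.\<close>
  define \<delta> where "\<delta> = arcsin p"
  have sd: "sin \<delta> = p" using p True by (simp add: \<delta>_def)
  have d: "0 < \<delta>" "\<delta> < pi / 2"
    using p True arcsin_less_mono[of 0 p] arcsin_less_mono[of p 1] by (auto simp: \<delta>_def)
  define I where "I = (\<integral>\<^sup>+\<theta>. H \<theta> * ennreal (1 / sin \<theta>) * indicator {\<theta>. p < sin \<theta>} \<theta> * indicator {0..pi/2} \<theta> \<partial>lborel)"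
  define F where "F s = H (arccos (\<bar>s\<bar> / sqrt (p\<^sup>2 + s\<^sup>2))) * indicator {s. p\<^sup>2 + s\<^sup>2 < 1} s" for s
  have Fm[measurable]: "F \<in> borel_measurable borel" unfolding F_def by measurable
  have half: "(\<integral>\<^sup>+s. F s * indicator {..0} s \<partial>lborel) \<le> I"
  proof -
    define g where "g \<theta> = - p * cot \<theta>" for \<theta> :: real
    have sinpos: "sin \<theta> > 0" if "\<theta> \<in> {\<delta>..pi/2}" for \<theta>
      using that d by (intro sin_gt_zero) auto
    have g0: "g (pi/2) = 0" by (simp add: g_def cot_def)
    have g1: "g \<delta> = - sqrt (1 - p\<^sup>2)"
      using p True d sd cos_arcsin[of p] by (simp add: g_def cot_def \<delta>_def)
    have "(\<integral>\<^sup>+s. F s * indicator {..0} s \<partial>lborel) \<le> (\<integral>\<^sup>+s. F s * indicator {g \<delta>..g (pi/2)} s \<partial>lborel)"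
    proof (intro nn_integral_mono)
      fix s :: real
      have "s \<ge> - sqrt (1 - p\<^sup>2)" if "p\<^sup>2 + s\<^sup>2 < 1"
        using that by (smt (verit, best) real_less_rsqrt real_le_rsqrt power2_minus)
      then show "F s * indicator {..0} s \<le> F s * indicator {g \<delta>..g (pi/2)} s"
        by (auto simp: F_def g0 g1 indicator_def)
    qed
    also have "\<dots> = (\<integral>\<^sup>+\<theta>. F (g \<theta>) * ennreal (p * inverse ((sin \<theta>)\<^sup>2)) * indicator {\<delta>..pi/2} \<theta> \<partial>lborel)"
    proof (rule nn_integral_substitution_aux[OF Fm])
      show "(g has_real_derivative p * inverse ((sin \<theta>)\<^sup>2)) (at \<theta>)" if "\<theta> \<in> {\<delta>..pi/2}" for \<theta>
        unfolding g_def using sinpos[OF that] DERIV_cmult[OF DERIV_cot, of \<theta> "- p"] by simp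
      show "continuous_on {\<delta>..pi/2} (\<lambda>\<theta>. p * inverse ((sin \<theta>)\<^sup>2))"
        using sinpos by (intro continuous_intros) force
    qed (use p d sinpos in auto)
    also have "\<dots> \<le> I"
      unfolding I_def
    proof (rule nn_integral_mono)
      fix \<theta> :: real
      show "F (g \<theta>) * ennreal (p * inverse ((sin \<theta>)\<^sup>2)) * indicator {\<delta>..pi/2} \<theta>
         \<le> H \<theta> * ennreal (1 / sin \<theta>) * indicator {\<theta>. p < sin \<theta>} \<theta> * indicator {0..pi/2} \<theta>"
      proof (cases "\<theta> \<in> {\<delta>..pi/2}")
        case \<theta>: True
        have s: "sin \<theta> > 0" using sinpos \<theta> by auto
        have c: "cos \<theta> \<ge> 0" using \<theta> d by (intro cos_ge_zero) auto
        have eq: "p\<^sup>2 + (g \<theta>)\<^sup>2 = (p / sin \<theta>)\<^sup>2"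
        proof -
          have "(g \<theta>)\<^sup>2 = p\<^sup>2 * (1 - (sin \<theta>)\<^sup>2) / (sin \<theta>)\<^sup>2"
            by (simp add: g_def cot_def power_mult_distrib power_divide cos_squared_eq)
          then show ?thesis using s by (simp add: field_simps)
        qed
        have "\<bar>g \<theta>\<bar> / sqrt (p\<^sup>2 + (g \<theta>)\<^sup>2) = cos \<theta>"
          unfolding eq using s c p by (simp add: g_def cot_def abs_mult real_sqrt_unique)
        then have arc: "arccos (\<bar>g \<theta>\<bar> / sqrt (p\<^sup>2 + (g \<theta>)\<^sup>2)) = \<theta>"
          using \<theta> d by (simp add: arccos_cos)
        show ?thesis
        proof (cases "p < sin \<theta>")
          case True
          have "p * inverse ((sin \<theta>)\<^sup>2) \<le> 1 / sin \<theta>"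
            using True s by (simp add: field_simps power2_eq_square)
          then have "ennreal (p * inverse ((sin \<theta>)\<^sup>2)) \<le> ennreal (1 / sin \<theta>)" by (rule ennreal_leI)
          then have "H \<theta> * ennreal (p * inverse ((sin \<theta>)\<^sup>2)) \<le> H \<theta> * ennreal (1 / sin \<theta>)"
            by (rule mult_left_mono) simp
          moreover have "F (g \<theta>) \<le> H \<theta>" by (simp add: F_def arc indicator_def)
          ultimately have "F (g \<theta>) * ennreal (p * inverse ((sin \<theta>)\<^sup>2)) \<le> H \<theta> * ennreal (1 / sin \<theta>)"
            by (meson mult_right_mono order_trans zero_le)
          then show ?thesis using True \<theta> d by simp
        next
          case False
          then have "p / sin \<theta> \<ge> 1" using s by simp
          then have "F (g \<theta>) = 0" by (simp add: F_def eq not_less one_le_power)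
          then show ?thesis by simp
        qed
      qed simp
    qed
    finally show ?thesis .
  qed
  have "(\<integral>\<^sup>+s. F s \<partial>lborel) \<le> (\<integral>\<^sup>+s. F s * indicator {..0} s + F (- s) * indicator {..0} (s) \<partial>lborel)"
  proof -
    have "(\<integral>\<^sup>+s. F s \<partial>lborel) \<le> (\<integral>\<^sup>+s. F s * indicator {..0} s + F s * indicator {0..} s \<partial>lborel)"
      by (intro nn_integral_mono) (auto simp: indicator_def)
    also have "\<dots> = (\<integral>\<^sup>+s. F s * indicator {..0} s \<partial>lborel) + (\<integral>\<^sup>+s. F s * indicator {0..} s \<partial>lborel)"
      by (rule nn_integral_add) auto
    also have "(\<integral>\<^sup>+s. F s * indicator {0..} s \<partial>lborel) = (\<integral>\<^sup>+s. F (- s) * indicator {..0} s \<partial>lborel)"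
      by (subst nn_integral_lborel_affine[where c = "-1" and t = 0]) (auto simp: indicator_def intro!: nn_integral_cong)
    finally show ?thesis by (subst nn_integral_add) auto
  qed
  also have "\<dots> = 2 * (\<integral>\<^sup>+s. F s * indicator {..0} s \<partial>lborel)"
    by (subst nn_integral_cmult[symmetric]) (auto simp: F_def mult_2 intro!: nn_integral_cong split: split_indicator)
  also have "\<dots> \<le> 2 * I" using half by (intro mult_left_mono) auto
  finally show ?thesis by (simp add: F_def I_def)
qed

text \<open>
  The angle between \<open>e\<close> and a random point of the unit ball has a bounded density. After sliding
  along \<open>e\<close>, the line estimate applies at distance \<open>P x\<close> from the axis and produces \<open>1 / sin \<theta>\<close>. The
  remaining variable \<open>x\<close> is restricted to the tube \<open>P x < sin \<theta>\<close>, which lies in a slab of width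
  \<open>2 sin \<theta>\<close> orthogonal to a unit vector \<open>f\<close> with \<open>f \<bullet> e = 0\<close>. The two factors cancel.
\<close>
lemma nn_integral_angle_ball_le:
  fixes H :: "real \<Rightarrow> ennreal" and e :: R3
  assumes [measurable]: "H \<in> borel_measurable borel" and e: "norm e = 1"
  shows "(\<integral>\<^sup>+x. H (arccos (\<bar>e \<bullet> x\<bar> / norm x)) * indicator (ball 0 1) x \<partial>lborel)
     \<le> 4 * emeasure lborel (ball (0::R3) 3) * (\<integral>\<^sup>+\<theta>. H \<theta> * indicator {0..pi/2} \<theta> \<partial>lborel)"
proof -
  have ee: "e \<bullet> e = 1" using e by (simp add: norm_eq_1)
  obtain f0 :: R3 where "f0 \<noteq> 0" "orthogonal e f0" using orthogonal_to_vector_exists[of e] by auto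
  define f where "f = f0 /\<^sub>R norm f0"
  have f: "norm f = 1" "e \<bullet> f = 0" "f \<noteq> 0"
    using \<open>f0 \<noteq> 0\<close> \<open>orthogonal e f0\<close> by (auto simp: f_def orthogonal_def)
  have [measurable]: "ball (0::R3) r \<in> sets borel" for r by simp
  \<comment> \<open>The distance of \<open>x\<close> from the axis spanned by \<open>e\<close>.\<close>
  define P where "P x = norm (x - (x \<bullet> e) *\<^sub>R e)" for x
  have [measurable]: "P \<in> borel_measurable borel" unfolding P_def by measurable
  have Pf: "\<bar>x \<bullet> f\<bar> \<le> P x" for x
    using Cauchy_Schwarz_ineq2[of "x - (x \<bullet> e) *\<^sub>R e" f] f by (simp add: P_def inner_diff_left)
  have pyth: "(norm (x + r *\<^sub>R e))\<^sup>2 = (P x)\<^sup>2 + (x \<bullet> e + r)\<^sup>2" for x r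
  proof -
    define y where "y = x - (x \<bullet> e) *\<^sub>R e"
    have "y \<bullet> e = 0" by (simp add: y_def inner_diff_left ee)
    then have "(norm (y + (x \<bullet> e + r) *\<^sub>R e))\<^sup>2 = (norm y)\<^sup>2 + (x \<bullet> e + r)\<^sup>2"
      using e by (subst norm_add_Pythagorean) (auto simp: orthogonal_def power_mult_distrib)
    moreover have "x + r *\<^sub>R e = y + (x \<bullet> e + r) *\<^sub>R e" by (simp add: y_def scaleR_add_left)
    ultimately show ?thesis by (simp only: P_def y_def[symmetric])
  qed
  have nrm: "norm (x + r *\<^sub>R e) = sqrt ((P x)\<^sup>2 + (x \<bullet> e + r)\<^sup>2)" for x r
    using pyth[of x r] by (metis norm_ge_zero real_sqrt_unique)
  define L where "L \<theta> p = H \<theta> * ennreal (1 / sin \<theta>) * indicator {\<theta>. p < sin \<theta>} \<theta> * indicator {0..pi/2} \<theta>" for \<theta> p :: real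
  have [measurable]: "(\<lambda>z. L (f z) (g z)) \<in> borel_measurable M"
    if [measurable]: "f \<in> borel_measurable M" "g \<in> borel_measurable M" for f g and M :: "'z measure"
    unfolding L_def by measurable
  let ?S = "\<lambda>x. \<integral>\<^sup>+r. H (arccos (\<bar>e \<bullet> (x + r *\<^sub>R e)\<bar> / norm (x + r *\<^sub>R e))) * indicator (ball 0 1) (x + r *\<^sub>R e) * indicator {0..1} r \<partial>lborel"
  let ?R = "\<lambda>x. 2 * ((\<integral>\<^sup>+\<theta>. L \<theta> (P x) \<partial>lborel) * indicator (ball 0 2) x)"
  have "(\<integral>\<^sup>+x. H (arccos (\<bar>e \<bullet> x\<bar> / norm x)) * indicator (ball 0 1) x \<partial>lborel)
     = (\<integral>\<^sup>+x. ?S x \<partial>lborel)"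
    by (rule nn_integral_lborel_slide) measurable
  also have "\<dots> \<le> (\<integral>\<^sup>+x. ?R x \<partial>lborel)"
  proof (rule nn_integral_mono_AE)
    have "AE x in lborel. f \<bullet> x \<noteq> 0" using f by (intro AE_hyperplane) auto
    then show "AE x in lborel. ?S x
      \<le> ?R x"
    proof (rule eventually_mono)
      fix x assume "f \<bullet> x \<noteq> 0"
      then have Px: "P x > 0" using Pf[of x] by (simp add: inner_commute)
      show "?S x
      \<le> ?R x"
      proof (cases "norm x < 2")
        case True
        have "?S x
          \<le> (\<integral>\<^sup>+r. H (arccos (\<bar>r + x \<bullet> e\<bar> / sqrt ((P x)\<^sup>2 + (r + x \<bullet> e)\<^sup>2))) * indicator {s. (P x)\<^sup>2 + s\<^sup>2 < 1} (r + x \<bullet> e) \<partial>lborel)"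
        proof (rule nn_integral_mono)
          fix r :: real
          have "e \<bullet> (x + r *\<^sub>R e) = r + x \<bullet> e" by (simp add: inner_add_right ee inner_commute[of e x])
          moreover have "norm (x + r *\<^sub>R e) = sqrt ((P x)\<^sup>2 + (r + x \<bullet> e)\<^sup>2)"
            by (simp add: nrm add.commute)
          ultimately show "H (arccos (\<bar>e \<bullet> (x + r *\<^sub>R e)\<bar> / norm (x + r *\<^sub>R e))) * indicator (ball 0 1) (x + r *\<^sub>R e) * indicator {0..1} r
            \<le> H (arccos (\<bar>r + x \<bullet> e\<bar> / sqrt ((P x)\<^sup>2 + (r + x \<bullet> e)\<^sup>2))) * indicator {s. (P x)\<^sup>2 + s\<^sup>2 < 1} (r + x \<bullet> e)"
            by (simp add: indicator_def)
        qed
        also have "\<dots> = (\<integral>\<^sup>+s. H (arccos (\<bar>s\<bar> / sqrt ((P x)\<^sup>2 + s\<^sup>2))) * indicator {s. (P x)\<^sup>2 + s\<^sup>2 < 1} s \<partial>lborel)"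
          by (rule nn_integral_lborel_translate) measurable
        also have "\<dots> \<le> 2 * (\<integral>\<^sup>+\<theta>. L \<theta> (P x) \<partial>lborel)"
          unfolding L_def by (rule nn_integral_arccos_line_le) (use Px in auto)
        finally show ?thesis using True by simp
      next
        case False
        have "norm (x + r *\<^sub>R e) \<ge> 1" if "r \<in> {0..1}" for r
          using norm_triangle_ineq4[of "x + r *\<^sub>R e" "r *\<^sub>R e"] False that e by simp
        then have "indicator (ball 0 1) (x + r *\<^sub>R e) * indicator {0..1} r = (0::ennreal)" for r
          by (force simp: indicator_def not_less)
        then show ?thesis by (simp only: mult.assoc mult_zero_right nn_integral_const) simp
      qed
    qed
  qed
  also have "\<dots> = 2 * (\<integral>\<^sup>+x. (\<integral>\<^sup>+\<theta>. L \<theta> (P x) * indicator (ball 0 2) x \<partial>lborel) \<partial>lborel)"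
    by (subst nn_integral_cmult) (auto simp: nn_integral_multc)
  also have "(\<integral>\<^sup>+x. (\<integral>\<^sup>+\<theta>. L \<theta> (P x) * indicator (ball 0 2) x \<partial>lborel) \<partial>lborel)
      = (\<integral>\<^sup>+\<theta>. (\<integral>\<^sup>+x. L \<theta> (P x) * indicator (ball 0 2) x \<partial>lborel) \<partial>lborel)"
    by (intro lborel_pair.Fubini') measurable
  also have "\<dots> \<le> (\<integral>\<^sup>+\<theta>. 2 * emeasure lborel (ball (0::R3) 3) * (H \<theta> * indicator {0..pi/2} \<theta>) \<partial>lborel)"
  proof (rule nn_integral_mono)
    fix \<theta> :: real
    show "(\<integral>\<^sup>+x. L \<theta> (P x) * indicator (ball 0 2) x \<partial>lborel) \<le> 2 * emeasure lborel (ball (0::R3) 3) * (H \<theta> * indicator {0..pi/2} \<theta>)"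
    proof (cases "\<theta> \<in> {0..pi/2} \<and> sin \<theta> > 0")
      case False
      then have "L \<theta> (P x) = 0" for x
        by (auto simp: L_def indicator_def P_def) (smt (verit) norm_ge_zero)
      then show ?thesis by simp
    next
      case True
      have "(\<integral>\<^sup>+x. L \<theta> (P x) * indicator (ball 0 2) x \<partial>lborel)
        = (\<integral>\<^sup>+x. H \<theta> * ennreal (1 / sin \<theta>) * indicator {x. norm x < 2 \<and> P x < sin \<theta>} x \<partial>lborel)"
        using True by (intro nn_integral_cong) (auto simp: L_def indicator_def)
      also have "\<dots> = H \<theta> * ennreal (1 / sin \<theta>) * emeasure lborel {x. norm x < 2 \<and> P x < sin \<theta>}"
        by (subst nn_integral_cmult_indicator) auto
      also have "\<dots> \<le> H \<theta> * ennreal (1 / sin \<theta>) * emeasure lborel {x. norm x < 2 \<and> \<bar>x \<bullet> f\<bar> < sin \<theta>}"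
        using Pf by (intro mult_left_mono emeasure_mono) (auto intro: order.strict_trans1)
      also have "\<dots> \<le> H \<theta> * ennreal (1 / sin \<theta>) * (ennreal (2 * sin \<theta>) * emeasure lborel (ball (0::R3) (2 + 1)))"
        using True f by (intro mult_left_mono emeasure_slab_le) auto
      also have "\<dots> = (ennreal (1 / sin \<theta>) * ennreal (2 * sin \<theta>)) * emeasure lborel (ball (0::R3) 3) * H \<theta>"
        by (simp add: ac_simps)
      also have "ennreal (1 / sin \<theta>) * ennreal (2 * sin \<theta>) = 2"
        using True by (simp flip: ennreal_mult')
      finally show ?thesis using True by (simp add: mult.assoc)
    qed
  qed
  also have "\<dots> = 2 * emeasure lborel (ball (0::R3) 3) * (\<integral>\<^sup>+\<theta>. H \<theta> * indicator {0..pi/2} \<theta> \<partial>lborel)"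
    by (rule nn_integral_cmult) auto
  finally show ?thesis by (simp add: mult.assoc[symmetric] mult_left_mono)
qed

lemma sets_sphere_measure [measurable_cong, simp]: "sets sphere_measure = sets borel"
  by (simp add: sphere_measure_def)

lemma space_sphere_measure [simp]: "space sphere_measure = UNIV"
  by (simp add: sphere_measure_def)

interpretation sphere: finite_measure sphere_measure
  by standard (simp add: emeasure_sphere_measure_UNIV)

lemma nn_integral_sphere_measure:
  assumes [measurable]: "\<phi> \<in> borel_measurable borel"
  shows "(\<integral>\<^sup>+\<omega>. \<phi> \<omega> \<partial>sphere_measure) = 3 * (\<integral>\<^sup>+x. \<phi> (x /\<^sub>R norm x) * indicator (ball 0 1) x \<partial>lborel)"
proof -
  have [measurable]: "ball (0::R3) r \<in> sets borel" for r by simp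
  have "(\<integral>\<^sup>+\<omega>. \<phi> \<omega> \<partial>sphere_measure) = (\<integral>\<^sup>+x. 3 * indicator (ball 0 1) x * \<phi> (x /\<^sub>R norm x) \<partial>lborel)"
    unfolding sphere_measure_def
    by (simp add: nn_integral_distr nn_integral_density)
  also have "\<dots> = (\<integral>\<^sup>+x. 3 * (\<phi> (x /\<^sub>R norm x) * indicator (ball 0 1) x) \<partial>lborel)"
    by (simp add: ac_simps)
  also have "\<dots> = 3 * (\<integral>\<^sup>+x. \<phi> (x /\<^sub>R norm x) * indicator (ball 0 1) x \<partial>lborel)"
    by (rule nn_integral_cmult) measurable
  finally show ?thesis .
qed

lemma borel_measurable_collision_angle [measurable]:
  assumes [measurable]: "f \<in> borel_measurable M" "g \<in> borel_measurable M"
  shows "(\<lambda>x. collision_angle (f x) (g x)) \<in> borel_measurable M"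
  unfolding collision_angle_def by measurable

text \<open>
  This bound is used twice: with the angular factor of the kernel, whose average over the sphere is
  therefore finite, and with the indicator of a null set, which shows that the angular factor
  matters only almost everywhere.
\<close>
lemma nn_integral_collision_angle_le:
  assumes [measurable]: "H \<in> borel_measurable borel" and z: "z \<noteq> 0"
  shows "(\<integral>\<^sup>+\<omega>. H (collision_angle z \<omega>) \<partial>sphere_measure)
    \<le> 12 * emeasure lborel (ball (0::R3) 3) * (\<integral>\<^sup>+\<theta>. H \<theta> * indicator {0..pi/2} \<theta> \<partial>lborel)"
proof -
  define e where "e = z /\<^sub>R norm z"
  have e: "norm e = 1" using z by (simp add: e_def)
  have *: "collision_angle z (x /\<^sub>R norm x) = arccos (\<bar>e \<bullet> x\<bar> / norm x)" for x
    using z by (cases "x = 0") (auto simp: collision_angle_def e_def abs_mult field_simps)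
  have "(\<integral>\<^sup>+\<omega>. H (collision_angle z \<omega>) \<partial>sphere_measure)
      = 3 * (\<integral>\<^sup>+x. H (arccos (\<bar>e \<bullet> x\<bar> / norm x)) * indicator (ball 0 1) x \<partial>lborel)"
    by (subst nn_integral_sphere_measure) (simp_all only: *, measurable)
  also have "\<dots> \<le> 3 * (4 * emeasure lborel (ball (0::R3) 3) * (\<integral>\<^sup>+\<theta>. H \<theta> * indicator {0..pi/2} \<theta> \<partial>lborel))"
    by (intro mult_left_mono nn_integral_angle_ball_le e) auto
  also have "\<dots> = 12 * emeasure lborel (ball (0::R3) 3) * (\<integral>\<^sup>+\<theta>. H \<theta> * indicator {0..pi/2} \<theta> \<partial>lborel)"
    by (simp add: mult.assoc[symmetric])
  finally show ?thesis .
qed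

section \<open>Integrals of velocity weights\<close>

text \<open>
  The Japanese bracket of \<open>v\<close>; the weight \<open>w\<close> of the theorem is its power with exponent \<open>\<beta>\<close>.
\<close>
definition japanese :: "R3 \<Rightarrow> real" where
  "japanese v = sqrt (1 + (norm v)\<^sup>2)"

lemma japanese_ge_1: "1 \<le> japanese v"
  by (simp add: japanese_def)

lemma japanese_pos [simp]: "0 < japanese v"
  using japanese_ge_1[of v] by linarith

lemma japanese_ne_0 [simp]: "japanese v \<noteq> 0"
  using japanese_pos[of v] by linarith

lemma norm_le_japanese: "norm v \<le> japanese v"
  unfolding japanese_def by (rule real_le_rsqrt) simp

lemma japanese_powr_eq: "japanese v powr a = (1 + (norm v)\<^sup>2) powr (a / 2)"
proof -
  have "0 \<le> 1 + (norm v)\<^sup>2" by simp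
  then show ?thesis by (simp add: japanese_def powr_half_sqrt[symmetric] powr_powr)
qed

lemma japanese_power2: "(japanese v)\<^sup>2 = 1 + (norm v)\<^sup>2"
  by (simp add: japanese_def)

lemma borel_measurable_japanese [measurable]: "japanese \<in> borel_measurable borel"
  unfolding japanese_def by measurable

lemma emeasure_ball_R3: "0 \<le> r \<Longrightarrow> emeasure lborel (ball (0::R3) r) = ennreal (4 / 3 * pi * r ^ 3)"
  by (subst emeasure_ball) (auto simp: unit_ball_vol_3)

lemma nn_integral_dyadic_balls_finite:
  fixes f :: "R3 \<Rightarrow> ennreal" and c r :: "nat \<Rightarrow> real"
  assumes f: "\<And>x. x \<noteq> 0 \<Longrightarrow> f x \<noteq> 0 \<Longrightarrow> \<exists>k. f x \<le> ennreal (c k) \<and> norm x < r k"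
    and c: "\<And>k. 0 \<le> c k" and r: "\<And>k. 0 \<le> r k"
    and sum: "summable (\<lambda>k. c k * r k ^ 3)"
  shows "(\<integral>\<^sup>+x. f x \<partial>lborel) < \<infinity>"
proof -
  have [measurable]: "ball (0::R3) r \<in> sets borel" for r by simp
  have "(\<integral>\<^sup>+x. f x \<partial>lborel) \<le> (\<integral>\<^sup>+x. (\<Sum>k. ennreal (c k) * indicator (ball (0::R3) (r k)) x) \<partial>lborel)"
  proof (rule nn_integral_mono_AE)
    have "AE x in lborel. x \<noteq> (0::R3)" by (rule AE_lborel_singleton)
    then show "AE x in lborel. f x \<le> (\<Sum>k. ennreal (c k) * indicator (ball (0::R3) (r k)) x)"
    proof (rule eventually_mono)
      fix x :: R3 assume x: "x \<noteq> 0"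
      show "f x \<le> (\<Sum>k. ennreal (c k) * indicator (ball (0::R3) (r k)) x)"
      proof (cases "f x = 0")
        case False
        obtain k where k: "f x \<le> ennreal (c k)" "norm x < r k" using f[OF x False] by auto
        define g where "g i = ennreal (c i) * indicator (ball (0::R3) (r i)) x" for i
        have "f x \<le> g k" using k by (simp add: g_def)
        also have "\<dots> = sum g {k}" by simp
        also have "\<dots> \<le> suminf g" by (rule sum_le_suminf) auto
        finally show ?thesis unfolding g_def[abs_def] .
      qed simp
    qed
  qed
  also have "\<dots> = (\<Sum>k. (\<integral>\<^sup>+x. ennreal (c k) * indicator (ball (0::R3) (r k)) x \<partial>lborel))"
    by (rule nn_integral_suminf) measurable
  also have "\<dots> = (\<Sum>k. ennreal (4 / 3 * pi * (c k * r k ^ 3)))"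
    using c r by (simp add: nn_integral_cmult_indicator emeasure_ball_R3 ennreal_mult[symmetric] ac_simps)
  also have "\<dots> = ennreal (\<Sum>k. 4 / 3 * pi * (c k * r k ^ 3))"
    using c r sum by (intro suminf_ennreal_eq summable_sums summable_mult) auto
  finally show ?thesis by (simp add: order.strict_trans1)
qed

lemma nn_integral_japanese_powr_finite:
  assumes a: "a > 3"
  shows "(\<integral>\<^sup>+v. ennreal (japanese v powr - a) \<partial>lborel) < \<infinity>"
proof (rule nn_integral_dyadic_balls_finite[where c = "\<lambda>k. (2 ^ k) powr - a" and r = "\<lambda>k. 2 ^ (k + 1)"])
  fix x :: R3
  obtain n where n: "norm x < 2 ^ n" using real_arch_pow[of 2 "norm x"] by auto
  \<comment> \<open>The dyadic shell \<open>2 ^ k \<le> |x| < 2 ^ (k + 1)\<close>, where the case \<open>k = 0\<close> includes the unit ball.\<close>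
  define k where "k = (LEAST k. norm x < 2 ^ (k + 1))"
  have "norm x < 2 ^ (n + 1)" using n by (smt (verit) power_increasing_iff le_add1 one_less_numeral_iff semiring_norm(76))
  then have k1: "norm x < 2 ^ (k + 1)" unfolding k_def by (rule LeastI)
  have "japanese x \<ge> 2 ^ k"
  proof (cases k)
    case 0
    then show ?thesis using japanese_ge_1 by simp
  next
    case (Suc m)
    then have "\<not> norm x < 2 ^ (m + 1)" using not_less_Least[of m "\<lambda>k. norm x < 2 ^ (k + 1)"] by (simp add: k_def)
    then show ?thesis using norm_le_japanese[of x] Suc by simp
  qed
  then have "japanese x powr - a \<le> (2 ^ k) powr - a"
    using a by (intro powr_mono2') auto
  with k1 show "\<exists>k. ennreal (japanese x powr - a) \<le> ennreal ((2 ^ k) powr - a) \<and> norm x < 2 ^ (k + 1)"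
    by (auto intro: ennreal_leI)
next
  have "(2::real) powr (3 - a) < 2 powr 0" using a by (intro powr_less_mono) auto
  then have "summable (\<lambda>k. 8 * (2 powr (3 - a)) ^ k)" by (intro summable_mult summable_geometric) simp
  moreover have "(2 ^ k) powr - a * (2 ^ (k + 1)) ^ 3 = 8 * (2 powr (3 - a)) ^ k" for k :: nat
  proof -
    have "((2::real) ^ k) powr - a = (2 powr - a) ^ k"
      by (simp add: powr_realpow[symmetric] powr_powr mult.commute)
    moreover have "(2 powr (3 - a)) = 8 * (2::real) powr - a"
      using powr_add[of 2 3 "- a"] by simp
    ultimately show ?thesis by (simp add: power_mult_distrib power_mult[symmetric] mult.commute[of k 3]) (simp add: power_mult)
  qed
  ultimately show "summable (\<lambda>k. (2 ^ k) powr - a * (2 ^ (k + 1)) ^ 3)" by (simp only:)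
qed auto

lemma nn_integral_norm_powr_ball_finite:
  assumes g: "-3 < \<gamma>" "\<gamma> \<le> 0"
  shows "(\<integral>\<^sup>+z. ennreal (norm z powr \<gamma>) * indicator (ball 0 1) z \<partial>(lborel :: R3 measure)) < \<infinity>"
proof (rule nn_integral_dyadic_balls_finite[where c = "\<lambda>k. ((1/2) ^ (k + 1)) powr \<gamma>" and r = "\<lambda>k. (1/2) ^ k"])
  fix z :: R3 assume z: "z \<noteq> 0" and "ennreal (norm z powr \<gamma>) * indicator (ball 0 1) z \<noteq> 0"
  then have z1: "norm z < 1" by (auto simp: indicator_def split: if_splits)
  obtain n where n: "(1/2) ^ n < norm z" using real_arch_pow_inv[of "norm z" "1/2"] z by auto
  \<comment> \<open>The dyadic shell \<open>(1/2) ^ (k + 1) \<le> |z| < (1/2) ^ k\<close>.\<close>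
  define k where "k = (LEAST k. (1/2) ^ (k + 1) \<le> norm z)"
  have "(1/2) ^ (n + 1) \<le> norm z" by (rule order_trans[OF _ less_imp_le[OF n]]) simp
  then have k1: "(1/2) ^ (k + 1) \<le> norm z" unfolding k_def by (rule LeastI)
  have "norm z < (1/2) ^ k"
  proof (cases k)
    case 0
    then show ?thesis using z1 by simp
  next
    case (Suc m)
    then have "\<not> (1/2) ^ (m + 1) \<le> norm z" using not_less_Least[of m "\<lambda>k. (1/2) ^ (k + 1) \<le> norm z"] by (simp add: k_def)
    then show ?thesis using Suc by simp
  qed
  moreover have "norm z powr \<gamma> \<le> ((1/2) ^ (k + 1)) powr \<gamma>"
    using g k1 by (intro powr_mono2') auto
  ultimately show "\<exists>k. ennreal (norm z powr \<gamma>) * indicator (ball 0 1) z \<le> ennreal (((1/2) ^ (k + 1)) powr \<gamma>) \<and> norm z < (1/2) ^ k"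
    using z1 by (auto intro!: ennreal_leI exI[of _ k])
next
  define c where "c = (1/2::real) powr \<gamma>"
  have "(1/2::real) powr \<gamma> < (1/2) powr (- 3)" using g by (intro powr_less_mono') auto
  also have "(1/2::real) powr (- 3) = 8" by (simp add: powr_minus_divide powr_divide)
  finally have c: "0 \<le> c" "c < 8" by (simp_all add: c_def)
  then have "summable (\<lambda>k. c * (c / 8) ^ k)" by (intro summable_mult summable_geometric) simp
  moreover have "((1/2) ^ (k + 1)) powr \<gamma> * ((1/2) ^ k) ^ 3 = c * (c / 8) ^ k" for k :: nat
  proof -
    have "((1/2::real) ^ (k + 1)) powr \<gamma> = ((1/2) powr real (k + 1)) powr \<gamma>"
      by (subst powr_realpow) auto
    also have "\<dots> = ((1/2) powr \<gamma>) powr real (k + 1)" by (simp only: powr_powr mult.commute)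
    also have "\<dots> = c ^ (k + 1)" unfolding c_def by (subst powr_realpow) auto
    finally have 1: "((1/2::real) ^ (k + 1)) powr \<gamma> = c ^ (k + 1)" .
    have "((1/2::real) ^ k) ^ 3 = (1/8) ^ k"
      by (subst power_mult[symmetric], subst mult.commute, subst power_mult) (simp add: power3_eq_cube)
    then show ?thesis unfolding 1 by (simp add: power_divide)
  qed
  ultimately show "summable (\<lambda>k. ((1/2) ^ (k + 1)) powr \<gamma> * ((1/2) ^ k) ^ 3)" by (simp only:)
qed auto

text \<open>
  For \<open>|v - u| < 1\<close> only the singularity of the kernel matters, and \<open>\<gamma> > -3\<close> makes it integrable. For
  \<open>|v - u| \<ge> 1\<close> the kernel is at most twice the product of the powers of the brackets of \<open>u\<close> and \<open>v\<close>
  with exponent \<open>max 0 \<gamma>\<close>.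
\<close>
lemma nn_integral_kernel_japanese_le:
  assumes g: "-3 < \<gamma>" "\<gamma> \<le> 1" and a: "a > 3 + max 0 \<gamma>"
  obtains C where "C < \<infinity>" 
    "\<And>v. (\<integral>\<^sup>+u. ennreal (norm (v - u) powr \<gamma> * japanese u powr - a) \<partial>lborel)
       \<le> C * ennreal (japanese v powr max 0 \<gamma>)"
proof -
  define I1 where "I1 = (\<integral>\<^sup>+u. ennreal (japanese u powr - (a - max 0 \<gamma>)) \<partial>lborel)"
  define I2 where "I2 = (\<integral>\<^sup>+z. ennreal (norm z powr min 0 \<gamma>) * indicator (ball 0 1) z \<partial>(lborel :: R3 measure))"
  have [measurable]: "ball (0::R3) r \<in> sets borel" for r by simp
  have fin: "I1 < \<infinity>" "I2 < \<infinity>"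
    using g a nn_integral_japanese_powr_finite[of "a - max 0 \<gamma>"] nn_integral_norm_powr_ball_finite[of "min 0 \<gamma>"]
    by (auto simp: I1_def I2_def)
  have pw: "ennreal (norm (v - u) powr \<gamma> * japanese u powr - a)
     \<le> ennreal (norm (u - v) powr min 0 \<gamma>) * indicator (ball 0 1) (u - v)
       + ennreal (2 * japanese v powr max 0 \<gamma>) * ennreal (japanese u powr - (a - max 0 \<gamma>))" for u v
  proof (cases "norm (v - u) < 1")
    case True
    have "japanese u powr - a \<le> japanese u powr 0"
      using a g japanese_ge_1[of u] by (intro powr_mono) auto
    then have j: "japanese u powr - a \<le> 1" by (smt (verit) japanese_pos powr_zero_eq_one)
    have n: "norm (v - u) powr \<gamma> \<le> norm (v - u) powr min 0 \<gamma>"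
      using True powr_mono'[of "min 0 \<gamma>" \<gamma> "norm (v - u)"] by simp
    have "norm (v - u) powr \<gamma> * japanese u powr - a \<le> norm (v - u) powr min 0 \<gamma> * 1"
      using j n by (intro mult_mono) auto
    then have "ennreal (norm (v - u) powr \<gamma> * japanese u powr - a)
       \<le> ennreal (norm (u - v) powr min 0 \<gamma>) * indicator (ball 0 1) (u - v)"
      using True by (simp add: norm_minus_commute ennreal_leI)
    then show ?thesis by (rule order_trans) simp
  next
    case False
    have "norm (v - u) powr \<gamma> \<le> 2 * (japanese v powr max 0 \<gamma> * japanese u powr max 0 \<gamma>)"
    proof (cases "\<gamma> \<ge> 0")
      case True
      have "norm (v - u) \<le> japanese v + japanese u"
        using norm_triangle_ineq4[of v u] norm_le_japanese[of u] norm_le_japanese[of v] by linarith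
      also have "\<dots> \<le> 2 * (japanese v * japanese u)"
      proof -
        have "0 \<le> (japanese v - 1) * (japanese u - 1)" "1 * 1 \<le> japanese v * japanese u"
          using japanese_ge_1[of u] japanese_ge_1[of v] by (simp, intro mult_mono) auto
        then show ?thesis by (simp add: algebra_simps)
      qed
      finally have "norm (v - u) powr \<gamma> \<le> (2 * (japanese v * japanese u)) powr \<gamma>"
        using True by (intro powr_mono2) auto
      also have "\<dots> = 2 powr \<gamma> * (japanese v powr \<gamma> * japanese u powr \<gamma>)"
        by (simp add: powr_mult less_imp_le)
      also have "\<dots> \<le> 2 powr 1 * (japanese v powr \<gamma> * japanese u powr \<gamma>)"
        using g by (intro mult_right_mono powr_mono) auto
      finally show ?thesis using True by (simp add: max_def)
    next
      case neg: False
      then have "norm (v - u) powr \<gamma> \<le> 1 powr \<gamma>" using False by (intro powr_mono2') auto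
      then show ?thesis using neg by (simp add: max_def)
    qed
    then have "norm (v - u) powr \<gamma> * japanese u powr - a
      \<le> 2 * (japanese v powr max 0 \<gamma> * japanese u powr max 0 \<gamma>) * japanese u powr - a"
      by (intro mult_right_mono) auto
    also have "\<dots> = (2 * japanese v powr max 0 \<gamma>) * japanese u powr - (a - max 0 \<gamma>)"
      by (simp add: powr_add[symmetric])
    finally have "ennreal (norm (v - u) powr \<gamma> * japanese u powr - a)
       \<le> ennreal (2 * japanese v powr max 0 \<gamma>) * ennreal (japanese u powr - (a - max 0 \<gamma>))"
      by (simp add: ennreal_leI flip: ennreal_mult)
    then show ?thesis by (rule order_trans) simp
  qed
  have "(\<integral>\<^sup>+u. ennreal (norm (v - u) powr \<gamma> * japanese u powr - a) \<partial>lborel)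
      \<le> (I2 + 2 * I1) * ennreal (japanese v powr max 0 \<gamma>)" for v
  proof -
    have "(\<integral>\<^sup>+u. ennreal (norm (v - u) powr \<gamma> * japanese u powr - a) \<partial>lborel)
      \<le> (\<integral>\<^sup>+u. ennreal (norm (u - v) powr min 0 \<gamma>) * indicator (ball 0 1) (u - v)
       + ennreal (2 * japanese v powr max 0 \<gamma>) * ennreal (japanese u powr - (a - max 0 \<gamma>)) \<partial>lborel)"
      by (intro nn_integral_mono pw)
    also have "\<dots> = (\<integral>\<^sup>+u. ennreal (norm (u - v) powr min 0 \<gamma>) * indicator (ball 0 1) (u - v) \<partial>lborel)
       + ennreal (2 * japanese v powr max 0 \<gamma>) * I1"
      unfolding I1_def by (subst nn_integral_add) (auto simp: nn_integral_cmult)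
    also have "(\<integral>\<^sup>+u. ennreal (norm (u - v) powr min 0 \<gamma>) * indicator (ball 0 1) (u - v) \<partial>lborel) = I2"
      unfolding I2_def
      using nn_integral_lborel_translate[of "\<lambda>z::R3. ennreal (norm z powr min 0 \<gamma>) * indicator (ball 0 1) z" "- v"]
      by simp
    also have "I2 \<le> I2 * ennreal (japanese v powr max 0 \<gamma>)"
      using mult_left_mono[of 1 "ennreal (japanese v powr max 0 \<gamma>)" I2] japanese_ge_1[of v] 
      by (simp add: ge_one_powr_ge_zero)
    finally show ?thesis
      by (simp add: ennreal_mult distrib_right mult.assoc mult.commute[of I1])
  qed
  then show ?thesis using that[of "I2 + 2 * I1"] fin by (simp add: ennreal_mult_less_top)
qed

section \<open>Collision integrals of dominated densities\<close>

lemma post_energy: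
  assumes "norm \<omega> = 1"
  shows "(norm (post_u v u \<omega>))\<^sup>2 + (norm (post_v v u \<omega>))\<^sup>2 = (norm u)\<^sup>2 + (norm v)\<^sup>2"
proof -
  define k where "k = (v - u) \<bullet> \<omega>"
  have w: "\<omega> \<bullet> \<omega> = 1" using assms by (simp add: norm_eq_1)
  have "(norm (u + k *\<^sub>R \<omega>))\<^sup>2 = (norm u)\<^sup>2 + 2 * k * (u \<bullet> \<omega>) + k\<^sup>2"
    unfolding power2_norm_eq_inner by (simp add: inner_simps w power2_eq_square inner_commute[of \<omega> u] distrib_left)
  moreover have "(norm (v - k *\<^sub>R \<omega>))\<^sup>2 = (norm v)\<^sup>2 - 2 * k * (v \<bullet> \<omega>) + k\<^sup>2"
    unfolding power2_norm_eq_inner by (simp add: inner_simps w power2_eq_square inner_commute[of \<omega> v] right_diff_distrib)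
  ultimately have "(norm (u + k *\<^sub>R \<omega>))\<^sup>2 + (norm (v - k *\<^sub>R \<omega>))\<^sup>2
      = (norm u)\<^sup>2 + (norm v)\<^sup>2 + 2 * k * (k - (v - u) \<bullet> \<omega>)"
    by (simp add: inner_diff_left algebra_simps power2_eq_square)
  then show ?thesis by (simp add: post_u_def post_v_def k_def)
qed

text \<open>
  With \<open>a = |u'|\<^sup>2\<close> and \<open>b = |v'|\<^sup>2\<close>, conservation of energy gives
  \<open>(1 + a) (1 + b) \<ge> 1 + a + b = 1 + |u|\<^sup>2 + |v|\<^sup>2\<close>.
\<close>
lemma japanese_post_ge:
  assumes "norm \<omega> = 1"
  shows "japanese u \<le> japanese (post_u v u \<omega>) * japanese (post_v v u \<omega>)"
    and "japanese v \<le> japanese (post_u v u \<omega>) * japanese (post_v v u \<omega>)"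
proof -
  let ?a = "(norm (post_u v u \<omega>))\<^sup>2" and ?b = "(norm (post_v v u \<omega>))\<^sup>2"
  have "0 \<le> ?a * ?b" by (intro mult_nonneg_nonneg zero_le_power2)
  then have "1 + (norm u)\<^sup>2 \<le> (1 + ?a) * (1 + ?b)" "1 + (norm v)\<^sup>2 \<le> (1 + ?a) * (1 + ?b)"
    using post_energy[OF assms, of v u] zero_le_power2[of "norm u"] zero_le_power2[of "norm v"]
    by (simp_all add: distrib_left distrib_right del: zero_le_power2 zero_le_mult_iff, linarith+)
  from this[THEN real_sqrt_le_mono] show "japanese u \<le> japanese (post_u v u \<omega>) * japanese (post_v v u \<omega>)"
    and "japanese v \<le> japanese (post_u v u \<omega>) * japanese (post_v v u \<omega>)"
    unfolding japanese_def real_sqrt_mult[symmetric] by blast+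
qed

text \<open>
  Here \<open>h\<close> is a nonnegative Borel function on the whole line that will agree with the given angular
  factor almost everywhere on \<open>[0, \<pi>/2]\<close>.
\<close>
locale collision_kernel =
  fixes \<gamma> \<beta> :: real and h :: "real \<Rightarrow> real"
  assumes gamma: "-3 < \<gamma>" "\<gamma> \<le> 1" and beta: "8 + 2 * max 0 \<gamma> < \<beta>"
    and h_measurable [measurable]: "h \<in> borel_measurable borel" and h_nonneg: "\<And>\<theta>. 0 \<le> h \<theta>"
    and h_integral: "(\<integral>\<^sup>+\<theta>. ennreal (h \<theta>) * indicator {0..pi/2} \<theta> \<partial>lborel) < \<infinity>"
begin

definition kernel :: "R3 \<Rightarrow> R3 \<Rightarrow> R3 \<Rightarrow> real" where
  "kernel v u \<omega> = norm (v - u) powr \<gamma> * h (collision_angle (v - u) \<omega>)"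

definition freq :: "(R3 \<Rightarrow> real) \<Rightarrow> R3 \<Rightarrow> ennreal" where
  "freq f v = (\<integral>\<^sup>+u. (\<integral>\<^sup>+\<omega>. ennreal (kernel v u \<omega> * f u) \<partial>sphere_measure) \<partial>lborel)"

definition gain :: "(R3 \<Rightarrow> real) \<Rightarrow> R3 \<Rightarrow> ennreal" where
  "gain f v = (\<integral>\<^sup>+u. (\<integral>\<^sup>+\<omega>. ennreal (kernel v u \<omega> * f (post_u v u \<omega>) * f (post_v v u \<omega>)) \<partial>sphere_measure) \<partial>lborel)"

text \<open>
  The exponent \<open>\<beta>\<close> is distributed over \<open>u\<close> and \<open>v\<close>. The share \<open>decay_u\<close> exceeds \<open>3 + max 0 \<gamma>\<close>, as
  integrability in \<open>u\<close> requires; this integration costs the power \<open>max 0 \<gamma>\<close> of the bracket of \<open>v\<close>, and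
  what is left of the share \<open>decay_v\<close> is \<open>decay\<close>. The excess of \<open>\<beta>\<close> over \<open>8 + 2 max 0 \<gamma>\<close> is halved between
  the two shares, which puts \<open>decay\<close> above \<open>5\<close>: exactly what the second moment needs in three dimensions.
\<close>
definition decay :: real where
  "decay = 5 + (\<beta> - 8 - 2 * max 0 \<gamma>) / 2"

definition decay_u :: real where
  "decay_u = decay - 2 + max 0 \<gamma>"

definition decay_v :: real where
  "decay_v = decay + max 0 \<gamma>"

lemma decay_gt_5: "5 < decay"
  using beta by (simp add: decay_def)

lemma decay_split: "decay_u + decay_v = \<beta>"
  by (simp add: decay_def decay_u_def decay_v_def)

lemma decay_pos: "3 + max 0 \<gamma> < decay_u" "0 < decay_u" "0 < decay_v" "decay \<le> \<beta>"
  using decay_gt_5 decay_split by (auto simp: decay_u_def decay_v_def)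

lemma kernel_nonneg: "0 \<le> kernel v u \<omega>"
  by (simp add: kernel_def h_nonneg)

lemma kernel_measurable [measurable]:
  assumes [measurable]: "a \<in> borel_measurable M" "b \<in> borel_measurable M" "c \<in> borel_measurable M"
  shows "(\<lambda>x. kernel (a x) (b x) (c x)) \<in> borel_measurable M"
  unfolding kernel_def by measurable

lemma kernel_average:
  obtains C where "C < \<infinity>" "\<And>v u. (\<integral>\<^sup>+\<omega>. ennreal (kernel v u \<omega>) \<partial>sphere_measure) \<le> C * ennreal (norm (v - u) powr \<gamma>)"
proof -
  define C where "C = 12 * emeasure lborel (ball (0::R3) 3) * (\<integral>\<^sup>+\<theta>. ennreal (h \<theta>) * indicator {0..pi/2} \<theta> \<partial>lborel)"
  have "C < \<infinity>"
    using h_integral emeasure_ball_finite[of "0::R3" 3] by (simp add: C_def ennreal_mult_less_top)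
  moreover have "(\<integral>\<^sup>+\<omega>. ennreal (kernel v u \<omega>) \<partial>sphere_measure) \<le> C * ennreal (norm (v - u) powr \<gamma>)" for v u
  proof (cases "v = u")
    case False
    have "(\<integral>\<^sup>+\<omega>. ennreal (kernel v u \<omega>) \<partial>sphere_measure)
       = (\<integral>\<^sup>+\<omega>. ennreal (norm (v - u) powr \<gamma>) * ennreal (h (collision_angle (v - u) \<omega>)) \<partial>sphere_measure)"
      by (simp add: kernel_def ennreal_mult h_nonneg)
    also have "\<dots> = ennreal (norm (v - u) powr \<gamma>) * (\<integral>\<^sup>+\<omega>. ennreal (h (collision_angle (v - u) \<omega>)) \<partial>sphere_measure)"
      by (rule nn_integral_cmult) measurable
    also have "\<dots> \<le> ennreal (norm (v - u) powr \<gamma>) * C"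
      unfolding C_def using False by (intro mult_left_mono nn_integral_collision_angle_le) auto
    finally show ?thesis by (simp add: mult.commute)
  qed (simp add: kernel_def)
  ultimately show ?thesis using that by blast
qed

text \<open>
  The angular integral of the kernel is at most a constant times \<open>|v - u|\<close> to the power \<open>\<gamma>\<close>. Both the
  collision frequency and, after the use of conservation of energy, the gain term are reduced to this
  estimate.
\<close>
lemma freq_le_kernel_average:
  obtains C where "C < \<infinity>"
    "\<And>g v. g \<in> borel_measurable borel \<Longrightarrow> (\<And>u. 0 \<le> g u) \<Longrightarrow>
      freq g v \<le> C * (\<integral>\<^sup>+u. ennreal (norm (v - u) powr \<gamma> * g u) \<partial>lborel)"
proof -
  obtain C where C: "C < \<infinity>" "\<And>v u. (\<integral>\<^sup>+\<omega>. ennreal (kernel v u \<omega>) \<partial>sphere_measure) \<le> C * ennreal (norm (v - u) powr \<gamma>)"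
    using kernel_average by blast
  have "freq g v \<le> C * (\<integral>\<^sup>+u. ennreal (norm (v - u) powr \<gamma> * g u) \<partial>lborel)"
    if [measurable]: "g \<in> borel_measurable borel" and g: "\<And>u. 0 \<le> g u" for g v
  proof -
    have "freq g v = (\<integral>\<^sup>+u. (\<integral>\<^sup>+\<omega>. ennreal (kernel v u \<omega>) \<partial>sphere_measure) * ennreal (g u) \<partial>lborel)"
      by (simp add: freq_def ennreal_mult kernel_nonneg g nn_integral_multc)
    also have "\<dots> \<le> (\<integral>\<^sup>+u. C * ennreal (norm (v - u) powr \<gamma>) * ennreal (g u) \<partial>lborel)"
      by (intro nn_integral_mono mult_right_mono C) auto
    also have "\<dots> = C * (\<integral>\<^sup>+u. ennreal (norm (v - u) powr \<gamma> * g u) \<partial>lborel)"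
      by (subst nn_integral_cmult[symmetric]) (simp_all add: ennreal_mult g mult.assoc)
    finally show ?thesis .
  qed
  then show ?thesis using that C(1) by blast
qed

lemma freq_bound:
  obtains C where "C < \<infinity>" "\<And>v. freq (\<lambda>u. japanese u powr - \<beta>) v \<le> C * ennreal (japanese v)"
proof -
  obtain C1 where C1: "C1 < \<infinity>" "\<And>g v. g \<in> borel_measurable borel \<Longrightarrow> (\<And>u. 0 \<le> g u) \<Longrightarrow>
      freq g v \<le> C1 * (\<integral>\<^sup>+u. ennreal (norm (v - u) powr \<gamma> * g u) \<partial>lborel)"
    using freq_le_kernel_average by blast
  obtain C2 where C2: "C2 < \<infinity>" "\<And>v. (\<integral>\<^sup>+u. ennreal (norm (v - u) powr \<gamma> * japanese u powr - \<beta>) \<partial>lborel)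
       \<le> C2 * ennreal (japanese v powr max 0 \<gamma>)"
  proof (rule nn_integral_kernel_japanese_le[of \<gamma> \<beta>])
    show "3 + max 0 \<gamma> < \<beta>" using beta by linarith
  qed (use gamma in blast)+
  have "freq (\<lambda>u. japanese u powr - \<beta>) v \<le> C1 * C2 * ennreal (japanese v)" for v
  proof -
    have "freq (\<lambda>u. japanese u powr - \<beta>) v \<le> C1 * (\<integral>\<^sup>+u. ennreal (norm (v - u) powr \<gamma> * japanese u powr - \<beta>) \<partial>lborel)"
      by (rule C1(2)) auto
    also have "\<dots> \<le> C1 * (C2 * ennreal (japanese v powr max 0 \<gamma>))"
      by (intro mult_left_mono C2) auto
    also have "\<dots> \<le> C1 * (C2 * ennreal (japanese v powr 1))"
      using gamma japanese_ge_1 by (intro mult_left_mono ennreal_leI powr_mono) auto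
    finally show ?thesis by (simp add: mult.assoc less_imp_le)
  qed
  then show ?thesis using that[of "C1 * C2"] C1(1) C2(1) by (simp add: ennreal_mult_less_top)
qed

text \<open>
  Both brackets are dominated by the product of the post-collisional ones, so each share of \<open>\<beta>\<close> can
  be handed to the variable that needs it.
\<close>
lemma japanese_post_decay:
  assumes "norm \<omega> = 1"
  shows "japanese (post_u v u \<omega>) powr - \<beta> * japanese (post_v v u \<omega>) powr - \<beta>
    \<le> japanese u powr - decay_u * japanese v powr - decay_v"
proof -
  let ?S = "japanese (post_u v u \<omega>) * japanese (post_v v u \<omega>)"
  have "japanese (post_u v u \<omega>) powr - \<beta> * japanese (post_v v u \<omega>) powr - \<beta> = ?S powr - \<beta>"
    by (simp add: powr_mult less_imp_le)
  also have "\<dots> = ?S powr - decay_u * ?S powr - decay_v"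
  proof -
    have "- \<beta> = - decay_u + - decay_v" using decay_split by simp
    then show ?thesis by (simp only: powr_add)
  qed
  also have "\<dots> \<le> japanese u powr - decay_u * japanese v powr - decay_v"
    using japanese_post_ge[OF assms] decay_pos
    by (intro mult_mono powr_mono2') auto
  finally show ?thesis .
qed

lemma gain_bound:
  obtains C where "C < \<infinity>"
    "\<And>v. freq (\<lambda>u. japanese u powr - decay_u * japanese v powr - decay_v) v \<le> C * ennreal (japanese v powr - decay)"
proof -
  obtain C1 where C1: "C1 < \<infinity>" "\<And>g v. g \<in> borel_measurable borel \<Longrightarrow> (\<And>u. 0 \<le> g u) \<Longrightarrow>
      freq g v \<le> C1 * (\<integral>\<^sup>+u. ennreal (norm (v - u) powr \<gamma> * g u) \<partial>lborel)"
    using freq_le_kernel_average by blast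
  obtain C2 where C2: "C2 < \<infinity>" "\<And>v. (\<integral>\<^sup>+u. ennreal (norm (v - u) powr \<gamma> * japanese u powr - decay_u) \<partial>lborel)
       \<le> C2 * ennreal (japanese v powr max 0 \<gamma>)"
  proof (rule nn_integral_kernel_japanese_le[of \<gamma> decay_u])
    show "3 + max 0 \<gamma> < decay_u" using decay_pos by simp
  qed (use gamma in blast)+
  have "freq (\<lambda>u. japanese u powr - decay_u * japanese v powr - decay_v) v \<le> C1 * C2 * ennreal (japanese v powr - decay)" for v
  proof -
    have "freq (\<lambda>u. japanese u powr - decay_u * japanese v powr - decay_v) v
      \<le> C1 * (\<integral>\<^sup>+u. ennreal (norm (v - u) powr \<gamma> * (japanese u powr - decay_u * japanese v powr - decay_v)) \<partial>lborel)"
      by (rule C1(2)) auto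
    also have "\<dots> = (C1 * ennreal (japanese v powr - decay_v)) * (\<integral>\<^sup>+u. ennreal (norm (v - u) powr \<gamma> * japanese u powr - decay_u) \<partial>lborel)"
      by (simp add: nn_integral_cmult[symmetric] ennreal_mult ac_simps)
    also have "\<dots> \<le> (C1 * ennreal (japanese v powr - decay_v)) * (C2 * ennreal (japanese v powr max 0 \<gamma>))"
      by (intro mult_left_mono C2) auto
    also have "\<dots> = C1 * C2 * ennreal (japanese v powr - decay_v * japanese v powr max 0 \<gamma>)"
      by (simp add: ennreal_mult ac_simps)
    also have "japanese v powr - decay_v * japanese v powr max 0 \<gamma> = japanese v powr - decay"
      by (simp add: powr_add[symmetric] decay_v_def)
    finally show ?thesis .
  qed
  then show ?thesis using that[of "C1 * C2"] C1(1) C2(1) by (simp add: ennreal_mult_less_top)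
qed

lemma freq_le_const_mult:
  assumes f: "\<And>u. 0 \<le> f u" "\<And>u. f u \<le> A * japanese u powr - \<beta>" and A: "0 \<le> A"
  shows "freq f v \<le> ennreal A * freq (\<lambda>u. japanese u powr - \<beta>) v"
proof -
  have "freq f v \<le> (\<integral>\<^sup>+u. (\<integral>\<^sup>+\<omega>. ennreal A * ennreal (kernel v u \<omega> * japanese u powr - \<beta>) \<partial>sphere_measure) \<partial>lborel)"
    unfolding freq_def
  proof (intro nn_integral_mono)
    fix u \<omega>
    have "kernel v u \<omega> * f u \<le> kernel v u \<omega> * (A * japanese u powr - \<beta>)"
      using f kernel_nonneg by (intro mult_left_mono) auto
    then show "ennreal (kernel v u \<omega> * f u) \<le> ennreal A * ennreal (kernel v u \<omega> * japanese u powr - \<beta>)"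
      using A by (simp add: ennreal_mult[symmetric] kernel_nonneg ennreal_leI ac_simps)
  qed
  then show ?thesis by (simp add: freq_def nn_integral_cmult)
qed

lemma product_post_le:
  assumes f: "\<And>u. 0 \<le> f u" "\<And>u. f u \<le> A * japanese u powr - \<beta>" and A: "0 \<le> A" and w: "norm \<omega> = 1"
  shows "kernel v u \<omega> * f (post_u v u \<omega>) * f (post_v v u \<omega>)
    \<le> A\<^sup>2 * (kernel v u \<omega> * (japanese u powr - decay_u * japanese v powr - decay_v))"
proof -
  have "f (post_u v u \<omega>) * f (post_v v u \<omega>) \<le> (A * japanese (post_u v u \<omega>) powr - \<beta>) * (A * japanese (post_v v u \<omega>) powr - \<beta>)"
    using f A by (intro mult_mono) auto
  also have "\<dots> = A\<^sup>2 * (japanese (post_u v u \<omega>) powr - \<beta> * japanese (post_v v u \<omega>) powr - \<beta>)"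
    by (simp add: power2_eq_square)
  also have "\<dots> \<le> A\<^sup>2 * (japanese u powr - decay_u * japanese v powr - decay_v)"
    by (intro mult_left_mono japanese_post_decay w) auto
  finally have "kernel v u \<omega> * (f (post_u v u \<omega>) * f (post_v v u \<omega>)) \<le> kernel v u \<omega> * (A\<^sup>2 * (japanese u powr - decay_u * japanese v powr - decay_v))"
    by (intro mult_left_mono kernel_nonneg)
  then show ?thesis by (simp add: ac_simps)
qed

lemma gain_le_const_mult:
  assumes f: "\<And>u. 0 \<le> f u" "\<And>u. f u \<le> A * japanese u powr - \<beta>" and A: "0 \<le> A"
  shows "gain f v \<le> ennreal (A\<^sup>2) * freq (\<lambda>u. japanese u powr - decay_u * japanese v powr - decay_v) v"
proof -
  have "gain f v \<le> (\<integral>\<^sup>+u. (\<integral>\<^sup>+\<omega>. ennreal (A\<^sup>2) * ennreal (kernel v u \<omega> * (japanese u powr - decay_u * japanese v powr - decay_v)) \<partial>sphere_measure) \<partial>lborel)"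
    unfolding gain_def
  proof (rule nn_integral_mono, rule nn_integral_mono_AE)
    fix u
    show "AE \<omega> in sphere_measure. ennreal (kernel v u \<omega> * f (post_u v u \<omega>) * f (post_v v u \<omega>))
      \<le> ennreal (A\<^sup>2) * ennreal (kernel v u \<omega> * (japanese u powr - decay_u * japanese v powr - decay_v))"
      using AE_sphere_measure
    proof (rule eventually_mono)
      fix \<omega> :: R3 assume "norm \<omega> = 1"
      from product_post_le[OF f A this, of v u]
      show "ennreal (kernel v u \<omega> * f (post_u v u \<omega>) * f (post_v v u \<omega>))
      \<le> ennreal (A\<^sup>2) * ennreal (kernel v u \<omega> * (japanese u powr - decay_u * japanese v powr - decay_v))"
        by (simp add: ennreal_mult[symmetric] kernel_nonneg ennreal_leI)
    qed
  qed
  then show ?thesis by (simp add: freq_def nn_integral_cmult)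
qed

text \<open>
  Joint measurability in the velocity and in an arbitrary parameter of the density; the parameter
  will be the position along a characteristic.
\<close>
lemma freq_measurable [measurable]:
  assumes f: "case_prod f \<in> borel_measurable (M \<Otimes>\<^sub>M borel)" and [measurable]: "V \<in> borel_measurable M"
  shows "(\<lambda>p. freq (f p) (V p)) \<in> borel_measurable M"
proof -
  have [measurable]: "(\<lambda>z. f (a z) (b z)) \<in> borel_measurable N"
    if "a \<in> measurable N M" "b \<in> borel_measurable N" for a b and N :: "'z measure"
    using measurable_compose[OF measurable_Pair[OF that] f] by simp
  show ?thesis unfolding freq_def by measurable
qed

lemma gain_measurable [measurable]:
  assumes f: "case_prod f \<in> borel_measurable (M \<Otimes>\<^sub>M borel)" and [measurable]: "V \<in> borel_measurable M"
  shows "(\<lambda>p. gain (f p) (V p)) \<in> borel_measurable M"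
proof -
  have [measurable]: "(\<lambda>z. f (a z) (b z)) \<in> borel_measurable N"
    if "a \<in> measurable N M" "b \<in> borel_measurable N" for a b and N :: "'z measure"
    using measurable_compose[OF measurable_Pair[OF that] f] by simp
  show ?thesis unfolding gain_def post_u_def post_v_def by measurable
qed

text \<open>
  The angular integration only involves the kernel, so a single dominated convergence in \<open>u\<close> suffices.
\<close>
lemma freq_tendsto:
  assumes [measurable]: "\<And>n. f n \<in> borel_measurable borel" "f' \<in> borel_measurable borel"
    and bound: "\<And>n u. f n u \<le> A * japanese u powr - \<beta>" and A: "0 \<le> A"
    and lim: "AE u in lborel. (\<lambda>n. f n u) \<longlonglongrightarrow> f' u"
  shows "(\<lambda>n. freq (f n) v) \<longlonglongrightarrow> freq f' v"
proof -
  define K where "K u = (\<integral>\<^sup>+\<omega>. ennreal (kernel v u \<omega>) \<partial>sphere_measure)" for u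
  have K_eq: "(\<integral>\<^sup>+\<omega>. ennreal (kernel v u \<omega> * c) \<partial>sphere_measure) = K u * ennreal c" for u c
    by (cases "c \<ge> 0")
       (auto simp: K_def ennreal_mult kernel_nonneg nn_integral_multc ennreal_neg mult_nonneg_nonpos)
  have [measurable]: "K \<in> borel_measurable borel" unfolding K_def by measurable
  obtain C1 where C1: "C1 < \<infinity>" "\<And>v u. (\<integral>\<^sup>+\<omega>. ennreal (kernel v u \<omega>) \<partial>sphere_measure) \<le> C1 * ennreal (norm (v - u) powr \<gamma>)"
    using kernel_average by blast
  have K_fin: "K u < \<infinity>" for u
    using C1(2)[of v u] C1(1) by (auto simp: K_def intro: order.strict_trans1 simp: ennreal_mult_less_top)
  obtain C where C: "C < \<infinity>" "\<And>v. freq (\<lambda>u. japanese u powr - \<beta>) v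
     \<le> C * ennreal (japanese v)"
    using freq_bound by blast
  have "(\<lambda>n. \<integral>\<^sup>+u. K u * ennreal (f n u) \<partial>lborel) \<longlonglongrightarrow> (\<integral>\<^sup>+u. K u * ennreal (f' u) \<partial>lborel)"
  proof (rule nn_integral_dominated_convergence[where w = "\<lambda>u. ennreal A * (K u * ennreal (japanese u powr - \<beta>))"])
    show "AE u in lborel. K u * ennreal (f n u) \<le> ennreal A * (K u * ennreal (japanese u powr - \<beta>))" for n
    proof (intro AE_I2)
      fix u
      have "K u * ennreal (f n u) \<le> K u * ennreal (A * japanese u powr - \<beta>)"
        by (intro mult_left_mono ennreal_leI bound) auto
      then show "K u * ennreal (f n u) \<le> ennreal A * (K u * ennreal (japanese u powr - \<beta>))"
        using A by (simp add: ennreal_mult ac_simps)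
    qed
    have "(\<integral>\<^sup>+u. ennreal A * (K u * ennreal (japanese u powr - \<beta>)) \<partial>lborel) \<le> ennreal A * (C * ennreal (japanese v))"
      using C(2)[of v] unfolding freq_def K_eq by (subst nn_integral_cmult) (auto intro: mult_left_mono)
    also have "\<dots> < \<infinity>" using C(1) by (simp add: ennreal_mult_less_top)
    finally show "(\<integral>\<^sup>+u. ennreal A * (K u * ennreal (japanese u powr - \<beta>)) \<partial>lborel) < \<infinity>" .
    show "AE u in lborel. (\<lambda>n. K u * ennreal (f n u)) \<longlonglongrightarrow> K u * ennreal (f' u)"
      using lim
    proof (rule eventually_mono)
      fix u assume "(\<lambda>n. f n u) \<longlonglongrightarrow> f' u"
      then show "(\<lambda>n. K u * ennreal (f n u)) \<longlonglongrightarrow> K u * ennreal (f' u)"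
        using K_fin[of u] by (intro ennreal_tendsto_cmult tendsto_ennrealI) auto
    qed
  qed measurable
  then show ?thesis by (simp add: freq_def K_eq)
qed

text \<open>
  Convergence fails only for \<open>u\<close> in a null set \<open>N\<close>. For almost every \<open>u\<close>, both \<open>u'\<close> and \<open>v'\<close> avoid \<open>N\<close> for
  almost every \<open>\<omega>\<close>, so the integrand converges; dominated convergence is then applied in \<open>\<omega>\<close> and
  in \<open>u\<close>.
\<close>
lemma gain_tendsto:
  assumes [measurable]: "\<And>n. f n \<in> borel_measurable borel" "f' \<in> borel_measurable borel"
    and nonneg: "\<And>n u. 0 \<le> f n u"
    and bound: "\<And>n u. f n u \<le> A * japanese u powr - \<beta>" and A: "0 \<le> A"
    and lim: "AE u in lborel. (\<lambda>n. f n u) \<longlonglongrightarrow> f' u"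
  shows "(\<lambda>n. gain (f n) v) \<longlonglongrightarrow> gain f' v"
proof -
  define J where "J g u = (\<integral>\<^sup>+\<omega>. ennreal (kernel v u \<omega> * g (post_u v u \<omega>) * g (post_v v u \<omega>)) \<partial>sphere_measure)"
    for g :: "R3 \<Rightarrow> real" and u
  have [measurable]: "J g \<in> borel_measurable borel" if [measurable]: "g \<in> borel_measurable borel" for g
    unfolding J_def post_u_def post_v_def by measurable
  define W where "W u = (\<integral>\<^sup>+\<omega>. ennreal (A\<^sup>2) * ennreal (kernel v u \<omega> * (japanese u powr - decay_u * japanese v powr - decay_v)) \<partial>sphere_measure)" for u
  have [measurable]: "W \<in> borel_measurable borel" unfolding W_def by measurable
  obtain C1 where C1: "C1 < \<infinity>" "\<And>v u. (\<integral>\<^sup>+\<omega>. ennreal (kernel v u \<omega>) \<partial>sphere_measure) \<le> C1 * ennreal (norm (v - u) powr \<gamma>)"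
    using kernel_average by blast
  have W_fin: "W u < \<infinity>" for u
  proof -
    have "(\<integral>\<^sup>+\<omega>. ennreal (kernel v u \<omega>) \<partial>sphere_measure) < \<infinity>"
      using C1(2)[of v u] C1(1) by (auto intro: order.strict_trans1 simp: ennreal_mult_less_top)
    then show ?thesis
      unfolding W_def by (simp add: ennreal_mult kernel_nonneg nn_integral_multc nn_integral_cmult ennreal_mult_less_top)
  qed
  obtain C where C: "C < \<infinity>" "\<And>v. freq (\<lambda>u. japanese u powr - decay_u * japanese v powr - decay_v) v
     \<le> C * ennreal (japanese v powr - decay)"
    using gain_bound by blast
  have W_int: "(\<integral>\<^sup>+u. W u \<partial>lborel) < \<infinity>"
  proof -
    have "(\<integral>\<^sup>+u. W u \<partial>lborel) \<le> ennreal (A\<^sup>2) * (C * ennreal (japanese v powr - decay))"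
      using C(2)[of v] unfolding W_def by (simp add: freq_def nn_integral_cmult mult_left_mono)
    also have "\<dots> < \<infinity>" using C(1) by (simp add: ennreal_mult_less_top)
    finally show ?thesis .
  qed
  let ?m = "\<lambda>u \<omega>. ennreal (A\<^sup>2) * ennreal (kernel v u \<omega> * (japanese u powr - decay_u * japanese v powr - decay_v))"
  let ?g = "\<lambda>n u \<omega>. ennreal (kernel v u \<omega> * f n (post_u v u \<omega>) * f n (post_v v u \<omega>))"
  let ?g' = "\<lambda>u \<omega>. ennreal (kernel v u \<omega> * f' (post_u v u \<omega>) * f' (post_v v u \<omega>))"
  have pw: "AE \<omega> in sphere_measure. ?g n u \<omega>
      \<le> ?m u \<omega>" for n u
    using AE_sphere_measure
  proof (rule eventually_mono)
    fix \<omega> :: R3 assume "norm \<omega> = 1"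
    from product_post_le[of "f n", OF nonneg bound A this, of v u]
    show "?g n u \<omega>
      \<le> ?m u \<omega>"
      by (simp add: ennreal_mult[symmetric] kernel_nonneg ennreal_leI)
  qed
  obtain N where N: "{u. \<not> (\<lambda>n. f n u) \<longlonglongrightarrow> f' u} \<subseteq> N" "N \<in> null_sets lborel"
    using lim by (auto simp: eventually_ae_filter)
  have "AE u in lborel. u \<notin> N" using N(2) by (rule AE_not_in)
  then have "AE u in lborel. AE \<omega> in sphere_measure. post_u v u \<omega> \<notin> N \<and> post_v v u \<omega> \<notin> N"
    using N(2) by (intro AE_post_notin) auto
  then have J_lim: "AE u in lborel. (\<lambda>n. J (f n) u) \<longlonglongrightarrow> J f' u"
  proof (rule eventually_mono)
    fix u assume u: "AE \<omega> in sphere_measure. post_u v u \<omega> \<notin> N \<and> post_v v u \<omega> \<notin> N"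
    have [measurable]: "post_u v u \<in> borel_measurable borel" "post_v v u \<in> borel_measurable borel"
      unfolding post_u_def[abs_def] post_v_def[abs_def] by measurable
    show "(\<lambda>n. J (f n) u) \<longlonglongrightarrow> J f' u"
      unfolding J_def
    proof (rule nn_integral_dominated_convergence[OF _ _ _ pw])
      show "(\<integral>\<^sup>+\<omega>. ?m u \<omega> \<partial>sphere_measure) < \<infinity>"
        using W_fin[of u] by (simp add: W_def)
      show "AE \<omega> in sphere_measure. (\<lambda>n. ?g n u \<omega>)
        \<longlonglongrightarrow> ?g' u \<omega>"
        using u
      proof (rule eventually_mono)
        fix \<omega> assume "post_u v u \<omega> \<notin> N \<and> post_v v u \<omega> \<notin> N"
        then have "(\<lambda>n. f n (post_u v u \<omega>)) \<longlonglongrightarrow> f' (post_u v u \<omega>)" "(\<lambda>n. f n (post_v v u \<omega>)) \<longlonglongrightarrow> f' (post_v v u \<omega>)"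
          using N(1) by auto
        then show "(\<lambda>n. ?g n u \<omega>)
        \<longlonglongrightarrow> ?g' u \<omega>"
          by (intro tendsto_intros)
      qed
    qed measurable
  qed
  have "(\<lambda>n. \<integral>\<^sup>+u. J (f n) u \<partial>lborel) \<longlonglongrightarrow> (\<integral>\<^sup>+u. J f' u \<partial>lborel)"
  proof (rule nn_integral_dominated_convergence[where w = W])
    show "AE u in lborel. J (f n) u \<le> W u" for n
      unfolding J_def W_def by (intro AE_I2 nn_integral_mono_AE pw)
    show "(\<integral>\<^sup>+u. W u \<partial>lborel) < \<infinity>" by (rule W_int)
    show "AE u in lborel. (\<lambda>n. J (f n) u) \<longlonglongrightarrow> J f' u" by (rule J_lim)
  qed measurable
  then show ?thesis by (simp add: gain_def J_def)
qed

end

section \<open>Continuity of affine slices in the mean\<close>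

text \<open>
  A finite measure with the null sets of Lebesgue measure. The polynomial density is chosen
  because an affine change of variables alters it only by a bounded factor.
\<close>
definition weight :: "R3 measure" where
  "weight = density lborel (\<lambda>v. ennreal (japanese v powr - 4))"

lemma sets_weight [measurable_cong, simp]: "sets weight = sets borel"
  by (simp add: weight_def)

lemma space_weight [simp]: "space weight = UNIV"
  by (simp add: weight_def)

interpretation weight: finite_measure weight
proof
  show "emeasure weight (space weight) \<noteq> \<infinity>"
    using nn_integral_japanese_powr_finite[of 4] by (simp add: weight_def emeasure_density)
qed

lemma AE_weight_iff: "(AE v in weight. P v) \<longleftrightarrow> (AE v in lborel. P v)"
  unfolding weight_def by (subst AE_density) auto

lemma nn_integral_weight:
  "\<phi> \<in> borel_measurable borel \<Longrightarrow> (\<integral>\<^sup>+v. \<phi> v \<partial>weight) = (\<integral>\<^sup>+v. ennreal (japanese v powr - 4) * \<phi> v \<partial>lborel)"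
  unfolding weight_def by (subst nn_integral_density) auto

lemma nn_integral_weight_tendsto_0:
  fixes u :: "nat \<Rightarrow> R3 \<Rightarrow> real"
  assumes [measurable]: "\<And>n. u n \<in> borel_measurable borel" and bound: "\<And>n v. \<bar>u n v\<bar> \<le> C"
    and lim: "AE v in lborel. (\<lambda>n. u n v) \<longlonglongrightarrow> 0"
  shows "(\<lambda>n. \<integral>\<^sup>+v. ennreal \<bar>u n v\<bar> \<partial>weight) \<longlonglongrightarrow> 0"
proof -
  have "(\<lambda>n. \<integral>\<^sup>+v. ennreal \<bar>u n v\<bar> \<partial>weight) \<longlonglongrightarrow> (\<integral>\<^sup>+v. 0 \<partial>weight)"
  proof (rule nn_integral_dominated_convergence[where w = "\<lambda>_. ennreal C"])
    show "(\<integral>\<^sup>+v. ennreal C \<partial>weight) < \<infinity>"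
      using weight.emeasure_finite[of UNIV] by (simp add: ennreal_mult_eq_top_iff less_top[symmetric])
    show "AE v in weight. (\<lambda>n. ennreal \<bar>u n v\<bar>) \<longlonglongrightarrow> 0"
      unfolding AE_weight_iff using lim
      by (rule eventually_mono) (use tendsto_ennrealI[OF tendsto_rabs_zero] in fastforce)
  qed (auto intro!: AE_I2 ennreal_leI bound)
  then show ?thesis by simp
qed

lemma ennreal_pos_real_below:
  fixes e :: ennreal
  assumes "0 < e"
  obtains c :: real where "0 < c" "ennreal c \<le> e"
proof (cases e)
  case (real r)
  then show ?thesis using assms that[of r] by auto
next
  case top
  then show ?thesis using that[of 1] by auto
qed

lemma continuous_approx_weight:
  fixes k :: "R3 \<Rightarrow> real"
  assumes [measurable]: "k \<in> borel_measurable borel" and k: "\<And>x. \<bar>k x\<bar> \<le> 1" and e: "0 < e"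
  obtains g where "continuous_on UNIV g" "\<And>x. \<bar>g x\<bar> \<le> 1" "(\<integral>\<^sup>+v. ennreal \<bar>k v - g v\<bar> \<partial>weight) < e"
proof -
  have "k measurable_on UNIV"
    by (intro lebesgue_measurable_imp_measurable_on_real) (auto intro: measurable_completion)
  then obtain N G where N: "negligible N" and G: "\<And>n. continuous_on UNIV (G n)"
    and lim: "\<And>x. x \<notin> N \<Longrightarrow> (\<lambda>n. G n x) \<longlonglongrightarrow> k x"
    by (auto simp: measurable_on_def)
  define g where "g n x = max (-1) (min 1 (G n x))" for n :: nat and x
  have g_cont: "continuous_on UNIV (g n)" for n
    unfolding g_def by (intro continuous_intros G)
  have [measurable]: "g n \<in> borel_measurable borel" for n
    by (rule borel_measurable_continuous_onI[OF g_cont])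
  have g_le: "\<bar>g n x\<bar> \<le> 1" for n x by (auto simp: g_def)
  have "(\<lambda>n. \<integral>\<^sup>+v. ennreal \<bar>k v - g n v\<bar> \<partial>weight) \<longlonglongrightarrow> 0"
  proof (rule nn_integral_weight_tendsto_0[where C = 2])
    show "\<bar>k v - g n v\<bar> \<le> 2" for n v using k[of v] g_le[of n v] by linarith
    have "AE x in lborel. x \<notin> N" using N by (simp add: AE_lborel_iff_negligible)
    then show "AE v in lborel. (\<lambda>n. k v - g n v) \<longlonglongrightarrow> 0"
    proof (rule eventually_mono)
      fix v assume "v \<notin> N"
      then have "(\<lambda>n. g n v) \<longlonglongrightarrow> max (-1) (min 1 (k v))"
        unfolding g_def by (intro tendsto_intros lim)
      moreover have "max (-1) (min 1 (k v)) = k v" using k[of v] by (auto simp: abs_le_iff)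
      ultimately have "(\<lambda>n. k v - g n v) \<longlonglongrightarrow> k v - k v" by (intro tendsto_intros) simp
      then show "(\<lambda>n. k v - g n v) \<longlonglongrightarrow> 0" by simp
    qed
  qed measurable
  then have "eventually (\<lambda>n. (\<integral>\<^sup>+v. ennreal \<bar>k v - g n v\<bar> \<partial>weight) < e) sequentially"
    using e by (intro order_tendstoD) auto
  then obtain n where "(\<integral>\<^sup>+v. ennreal \<bar>k v - g n v\<bar> \<partial>weight) < e"
    by (auto simp: eventually_sequentially)
  then show ?thesis using that[of "g n"] g_cont g_le by blast
qed

lemma japanese_affine_le: "japanese (\<xi> + c *\<^sub>R v) \<le> (1 + norm \<xi> + \<bar>c\<bar>) * japanese v"
proof -
  have "japanese (\<xi> + c *\<^sub>R v) \<le> 1 + norm (\<xi> + c *\<^sub>R v)"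
    unfolding japanese_def using sqrt_sum_squares_le_sum[of 1 "norm (\<xi> + c *\<^sub>R v)"] by simp
  also have "\<dots> \<le> 1 + (norm \<xi> + \<bar>c\<bar> * norm v)"
    using norm_triangle_ineq[of \<xi> "c *\<^sub>R v"] by simp
  also have "\<dots> \<le> 1 * japanese v + (norm \<xi> * japanese v + \<bar>c\<bar> * japanese v)"
    using japanese_ge_1[of v] norm_le_japanese[of v]
    by (intro add_mono mult_left_mono) (auto simp: mult_le_cancel_left1)
  finally show ?thesis by (simp add: distrib_right)
qed

lemma nn_integral_weight_affine_le:
  assumes [measurable]: "\<phi> \<in> borel_measurable borel" and c: "c \<noteq> 0"
  shows "(\<integral>\<^sup>+v. \<phi> (\<xi> + c *\<^sub>R v) \<partial>weight)
    \<le> ennreal ((1 + norm \<xi> + \<bar>c\<bar>) ^ 4 / \<bar>c\<bar> ^ 3) * (\<integral>\<^sup>+v. \<phi> v \<partial>weight)"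
proof -
  define B where "B = 1 + norm \<xi> + \<bar>c\<bar>"
  have B: "B > 0" unfolding B_def by (smt (verit) norm_ge_zero abs_ge_zero)
  have pw: "japanese v powr - 4 \<le> B ^ 4 * japanese (\<xi> + c *\<^sub>R v) powr - 4" for v
  proof -
    have "(B * japanese v) powr - 4 \<le> japanese (\<xi> + c *\<^sub>R v) powr - 4"
      using japanese_affine_le[of \<xi> c v] by (intro powr_mono2') (auto simp: B_def)
    then have "B ^ 4 * (B * japanese v) powr - 4 \<le> B ^ 4 * japanese (\<xi> + c *\<^sub>R v) powr - 4"
      using B by (intro mult_left_mono) auto
    also have "B ^ 4 * (B * japanese v) powr - 4 = (B powr 4 * B powr - 4) * japanese v powr - 4"
      using B by (simp add: powr_mult less_imp_le)
    also have "B powr 4 * B powr - 4 = 1"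
      using B by (simp add: powr_add[symmetric] del: powr_numeral)
    finally show ?thesis by simp
  qed
  have "(\<integral>\<^sup>+v. \<phi> (\<xi> + c *\<^sub>R v) \<partial>weight) = (\<integral>\<^sup>+v. ennreal (japanese v powr - 4) * \<phi> (\<xi> + c *\<^sub>R v) \<partial>lborel)"
    by (rule nn_integral_weight) measurable
  also have "\<dots> \<le> (\<integral>\<^sup>+v. ennreal (B ^ 4) * (ennreal (japanese (\<xi> + c *\<^sub>R v) powr - 4) * \<phi> (\<xi> + c *\<^sub>R v)) \<partial>lborel)"
  proof (intro nn_integral_mono)
    fix v
    have "ennreal (japanese v powr - 4) \<le> ennreal (B ^ 4) * ennreal (japanese (\<xi> + c *\<^sub>R v) powr - 4)"
      using pw[of v] B by (simp add: ennreal_leI flip: ennreal_mult)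
    then show "ennreal (japanese v powr - 4) * \<phi> (\<xi> + c *\<^sub>R v)
        \<le> ennreal (B ^ 4) * (ennreal (japanese (\<xi> + c *\<^sub>R v) powr - 4) * \<phi> (\<xi> + c *\<^sub>R v))"
      by (simp add: mult.assoc[symmetric] mult_right_mono)
  qed
  also have "\<dots> = ennreal (B ^ 4) * (\<integral>\<^sup>+v. ennreal (japanese (\<xi> + c *\<^sub>R v) powr - 4) * \<phi> (\<xi> + c *\<^sub>R v) \<partial>lborel)"
    by (rule nn_integral_cmult) measurable
  also have "\<dots> = ennreal (B ^ 4 / \<bar>c\<bar> ^ 3) * (ennreal (\<bar>c\<bar> ^ 3) * (\<integral>\<^sup>+v. ennreal (japanese (\<xi> + c *\<^sub>R v) powr - 4) * \<phi> (\<xi> + c *\<^sub>R v) \<partial>lborel))"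
    using c B by (simp add: mult.assoc[symmetric] flip: ennreal_mult)
  also have "ennreal (\<bar>c\<bar> ^ 3) * (\<integral>\<^sup>+v. ennreal (japanese (\<xi> + c *\<^sub>R v) powr - 4) * \<phi> (\<xi> + c *\<^sub>R v) \<partial>lborel)
      = (\<integral>\<^sup>+v. ennreal (japanese v powr - 4) * \<phi> v \<partial>lborel)"
    using nn_integral_lborel_affine[of "\<lambda>v::R3. ennreal (japanese v powr - 4) * \<phi> v" c \<xi>] c by simp
  also have "\<dots> = (\<integral>\<^sup>+v. \<phi> v \<partial>weight)"
    by (rule nn_integral_weight[symmetric]) measurable
  finally show ?thesis by (simp add: B_def)
qed

text \<open>
  The classical argument for continuity of translations in \<open>L\<^sup>1\<close>: replace \<open>k\<close> by a bounded continuous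
  function. The error of this replacement is controlled uniformly in the affine maps because their
  scaling factors stay away from zero.
\<close>
lemma affine_L1_continuity:
  fixes k :: "R3 \<Rightarrow> real"
  assumes [measurable]: "k \<in> borel_measurable borel" and k: "\<And>x. \<bar>k x\<bar> \<le> 1"
    and \<xi>: "\<xi> \<longlonglongrightarrow> \<xi>'" and c: "c \<longlonglongrightarrow> c'" and c': "c' \<noteq> 0"
  shows "(\<lambda>n. \<integral>\<^sup>+v. ennreal \<bar>k (\<xi> n + c n *\<^sub>R v) - k (\<xi>' + c' *\<^sub>R v)\<bar> \<partial>weight) \<longlonglongrightarrow> 0"
proof (rule order_tendstoI)
  fix e :: ennreal assume e: "0 < e"
  define b where "b n = (1 + norm (\<xi> n) + \<bar>c n\<bar>) ^ 4 / \<bar>c n\<bar> ^ 3" for n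
  define b' where "b' = (1 + norm \<xi>' + \<bar>c'\<bar>) ^ 4 / \<bar>c'\<bar> ^ 3"
  have "b \<longlonglongrightarrow> b'" unfolding b_def b'_def using c' by (intro tendsto_intros \<xi> c) auto
  then have b_ev: "eventually (\<lambda>n. b n < b' + 1) sequentially" by (rule order_tendstoD) simp
  have b'0: "0 \<le> b'" by (simp add: b'_def)
  obtain e' :: real where e': "0 < e'" "ennreal e' \<le> e" using ennreal_pos_real_below[OF e] .
  \<comment> \<open>The factor \<open>b' + 1\<close> eventually bounds the distortion of \<open>weight\<close> by all the affine maps involved.\<close>
  define d where "d = e' / (4 * (b' + 1))"
  have d: "0 < d" "(b' + 1) * d = e' / 4" "b' * d \<le> e' / 4" using e' b'0 by (auto simp: d_def field_simps)
  obtain g where g: "continuous_on UNIV g" "\<And>x. \<bar>g x\<bar> \<le> 1" "(\<integral>\<^sup>+v. ennreal \<bar>k v - g v\<bar> \<partial>weight) < ennreal d"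
    using continuous_approx_weight[of k "ennreal d"] k d by auto
  have [measurable]: "g \<in> borel_measurable borel" by (rule borel_measurable_continuous_onI[OF g(1)])
  have "(\<lambda>n. \<integral>\<^sup>+v. ennreal \<bar>g (\<xi> n + c n *\<^sub>R v) - g (\<xi>' + c' *\<^sub>R v)\<bar> \<partial>weight) \<longlonglongrightarrow> 0"
  proof (rule nn_integral_weight_tendsto_0[where C = 2])
    show "\<bar>g (\<xi> n + c n *\<^sub>R v) - g (\<xi>' + c' *\<^sub>R v)\<bar> \<le> 2" for n v
      using g(2)[of "\<xi> n + c n *\<^sub>R v"] g(2)[of "\<xi>' + c' *\<^sub>R v"] by linarith
    show "AE v in lborel. (\<lambda>n. g (\<xi> n + c n *\<^sub>R v) - g (\<xi>' + c' *\<^sub>R v)) \<longlonglongrightarrow> 0"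
    proof (intro AE_I2 LIM_zero)
      fix v
      have "isCont g (\<xi>' + c' *\<^sub>R v)" using g(1) by (simp add: continuous_on_eq_continuous_at)
      moreover have "(\<lambda>n. \<xi> n + c n *\<^sub>R v) \<longlonglongrightarrow> \<xi>' + c' *\<^sub>R v" by (intro tendsto_intros \<xi> c)
      ultimately show "(\<lambda>n. g (\<xi> n + c n *\<^sub>R v)) \<longlonglongrightarrow> g (\<xi>' + c' *\<^sub>R v)" by (rule isCont_tendsto_compose)
    qed
  qed measurable
  then have mid_ev: "eventually (\<lambda>n. (\<integral>\<^sup>+v. ennreal \<bar>g (\<xi> n + c n *\<^sub>R v) - g (\<xi>' + c' *\<^sub>R v)\<bar> \<partial>weight) < ennreal (e' / 4)) sequentially"
    using e' by (intro order_tendstoD) auto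
  have "eventually (\<lambda>n. c n \<noteq> 0) sequentially"
    using tendsto_imp_eventually_ne[OF c c'] .
  then show "eventually (\<lambda>n. (\<integral>\<^sup>+v. ennreal \<bar>k (\<xi> n + c n *\<^sub>R v) - k (\<xi>' + c' *\<^sub>R v)\<bar> \<partial>weight) < e) sequentially"
    using mid_ev b_ev
  proof eventually_elim
    case (elim n)
    have dist: "ennreal \<bar>k y - k y'\<bar> \<le> ennreal \<bar>k y - g y\<bar> + ennreal \<bar>g y - g y'\<bar> + ennreal \<bar>k y' - g y'\<bar>" for y y'
      by (simp add: ennreal_leI flip: ennreal_plus)
    have far: "(\<integral>\<^sup>+v. ennreal \<bar>k (\<xi> + c *\<^sub>R v) - g (\<xi> + c *\<^sub>R v)\<bar> \<partial>weight) \<le> ennreal (e' / 4)"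
      if "(1 + norm \<xi> + \<bar>c\<bar>) ^ 4 / \<bar>c\<bar> ^ 3 \<le> b' + 1" "c \<noteq> 0" for \<xi> and c :: real
    proof -
      have "(\<integral>\<^sup>+v. ennreal \<bar>k (\<xi> + c *\<^sub>R v) - g (\<xi> + c *\<^sub>R v)\<bar> \<partial>weight)
         \<le> ennreal ((1 + norm \<xi> + \<bar>c\<bar>) ^ 4 / \<bar>c\<bar> ^ 3) * (\<integral>\<^sup>+v. ennreal \<bar>k v - g v\<bar> \<partial>weight)"
        using nn_integral_weight_affine_le[of "\<lambda>v. ennreal \<bar>k v - g v\<bar>" c \<xi>] that by simp
      also have "\<dots> \<le> ennreal (b' + 1) * ennreal d"
        using that g(3) by (intro mult_mono ennreal_leI) auto
      also have "\<dots> = ennreal ((b' + 1) * d)" using d b'0 by (intro ennreal_mult[symmetric]) auto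
      also have "\<dots> = ennreal (e' / 4)" by (simp only: d)
      finally show ?thesis .
    qed
    have "(\<integral>\<^sup>+v. ennreal \<bar>k (\<xi> n + c n *\<^sub>R v) - k (\<xi>' + c' *\<^sub>R v)\<bar> \<partial>weight)
       \<le> (\<integral>\<^sup>+v. ennreal \<bar>k (\<xi> n + c n *\<^sub>R v) - g (\<xi> n + c n *\<^sub>R v)\<bar>
           + ennreal \<bar>g (\<xi> n + c n *\<^sub>R v) - g (\<xi>' + c' *\<^sub>R v)\<bar>
           + ennreal \<bar>k (\<xi>' + c' *\<^sub>R v) - g (\<xi>' + c' *\<^sub>R v)\<bar> \<partial>weight)"
      by (intro nn_integral_mono dist)
    also have "\<dots> = (\<integral>\<^sup>+v. ennreal \<bar>k (\<xi> n + c n *\<^sub>R v) - g (\<xi> n + c n *\<^sub>R v)\<bar> \<partial>weight)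
        + (\<integral>\<^sup>+v. ennreal \<bar>g (\<xi> n + c n *\<^sub>R v) - g (\<xi>' + c' *\<^sub>R v)\<bar> \<partial>weight)
        + (\<integral>\<^sup>+v. ennreal \<bar>k (\<xi>' + c' *\<^sub>R v) - g (\<xi>' + c' *\<^sub>R v)\<bar> \<partial>weight)"
      by (simp add: nn_integral_add)
    also have "\<dots> \<le> ennreal (e' / 4) + ennreal (e' / 4) + ennreal (e' / 4)"
      using elim c' by (intro add_mono far) (auto simp: b_def b'_def less_imp_le)
    also have "\<dots> = ennreal (3 * e' / 4)" using e' by (simp flip: ennreal_plus)
    also have "\<dots> < ennreal e'" using e' by (intro ennreal_lessI) auto
    also have "\<dots> \<le> e" by (rule e')
    finally show ?case .
  qed
qed simp

lemma nn_integral_tendsto_0_AE_subseq: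
  fixes u :: "nat \<Rightarrow> 'a \<Rightarrow> real"
  assumes [measurable]: "\<And>n. u n \<in> borel_measurable M"
    and lim: "(\<lambda>n. \<integral>\<^sup>+x. ennreal \<bar>u n x\<bar> \<partial>M) \<longlonglongrightarrow> 0"
    and fin: "\<And>n. (\<integral>\<^sup>+x. ennreal \<bar>u n x\<bar> \<partial>M) < \<infinity>"
  shows "\<exists>r::nat\<Rightarrow>nat. strict_mono r \<and> (AE x in M. (\<lambda>n. u (r n) x) \<longlonglongrightarrow> 0)"
proof (rule tendsto_L1_AE_subseq)
  show "integrable M (u n)" for n using fin[of n] by (auto simp: integrable_iff_bounded)
  have "(\<integral>x. norm (u n x) \<partial>M) = enn2real (\<integral>\<^sup>+x. ennreal \<bar>u n x\<bar> \<partial>M)" for n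
    by (subst integral_eq_nn_integral) auto
  moreover have "(\<lambda>n. enn2real (\<integral>\<^sup>+x. ennreal \<bar>u n x\<bar> \<partial>M)) \<longlonglongrightarrow> 0"
    using lim by (intro tendsto_enn2real) auto
  ultimately show "(\<lambda>n. \<integral>x. norm (u n x) \<partial>M) \<longlonglongrightarrow> 0" by simp
qed

text \<open>
  Mean convergence for each parameter \<open>p\<close> becomes mean convergence on the product space by dominated
  convergence, so that one subsequence serves almost all parameters at once.
\<close>
lemma affine_AE_subseq:
  fixes k :: "'p \<Rightarrow> R3 \<Rightarrow> real" and \<xi> :: "nat \<Rightarrow> 'p \<Rightarrow> R3" and c :: "nat \<Rightarrow> 'p \<Rightarrow> real"
  assumes M: "finite_measure M" and km: "case_prod k \<in> borel_measurable (M \<Otimes>\<^sub>M borel)" and k: "\<And>p x. \<bar>k p x\<bar> \<le> 1"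
    and [measurable]: "\<And>n. \<xi> n \<in> borel_measurable M" "\<And>n. c n \<in> borel_measurable M"
      "\<xi>' \<in> borel_measurable M" "c' \<in> borel_measurable M"
    and \<xi>: "AE p in M. (\<lambda>n. \<xi> n p) \<longlonglongrightarrow> \<xi>' p" and c: "AE p in M. (\<lambda>n. c n p) \<longlonglongrightarrow> c' p"
    and c': "AE p in M. c' p \<noteq> 0"
  shows "\<exists>r::nat\<Rightarrow>nat. strict_mono r \<and>
    (AE p in M. AE v in lborel. (\<lambda>n. k p (\<xi> (r n) p + c (r n) p *\<^sub>R v)) \<longlonglongrightarrow> k p (\<xi>' p + c' p *\<^sub>R v))"
proof -
  interpret M: finite_measure M by (rule M)
  interpret pair_sigma_finite M weight ..
  have [measurable]: "(\<lambda>z. k (a z) (b z)) \<in> borel_measurable N"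
    if "a \<in> measurable N M" "b \<in> borel_measurable N" for a b and N :: "'z measure"
    using measurable_compose[OF measurable_Pair[OF that] km] by simp
  define u where "u n z = k (fst z) (\<xi> n (fst z) + c n (fst z) *\<^sub>R snd z) - k (fst z) (\<xi>' (fst z) + c' (fst z) *\<^sub>R snd z)"
    for n and z :: "'p \<times> R3"
  have [measurable]: "u n \<in> borel_measurable (M \<Otimes>\<^sub>M weight)" for n
    unfolding u_def by measurable
  have u2: "ennreal \<bar>u n z\<bar> \<le> 2" for n z
  proof -
    have "\<bar>u n z\<bar> \<le> 2"
      using k[of "fst z" "\<xi> n (fst z) + c n (fst z) *\<^sub>R snd z"] k[of "fst z" "\<xi>' (fst z) + c' (fst z) *\<^sub>R snd z"]
      unfolding u_def by linarith
    then have "ennreal \<bar>u n z\<bar> \<le> ennreal 2" by (rule ennreal_leI)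
    then show ?thesis by simp
  qed
  have inner2: "(\<integral>\<^sup>+v. ennreal \<bar>u n (p, v)\<bar> \<partial>weight) \<le> 2 * emeasure weight UNIV" for n p
    using nn_integral_mono[of weight "\<lambda>v. ennreal \<bar>u n (p, v)\<bar>" "\<lambda>_. 2"] u2 by simp
  have tot: "(\<integral>\<^sup>+p. 2 * emeasure weight UNIV \<partial>M) < \<infinity>"
    using weight.emeasure_finite[of UNIV] M.emeasure_finite[of "space M"]
    by (simp add: ennreal_mult_eq_top_iff less_top[symmetric])
  have eq: "(\<integral>\<^sup>+z. ennreal \<bar>u n z\<bar> \<partial>(M \<Otimes>\<^sub>M weight)) = (\<integral>\<^sup>+p. \<integral>\<^sup>+v. ennreal \<bar>u n (p, v)\<bar> \<partial>weight \<partial>M)" for n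
    by (rule weight.nn_integral_fst[symmetric]) measurable
  have "\<exists>r::nat\<Rightarrow>nat. strict_mono r \<and> (AE z in M \<Otimes>\<^sub>M weight. (\<lambda>n. u (r n) z) \<longlonglongrightarrow> 0)"
  proof (rule nn_integral_tendsto_0_AE_subseq)
    show "(\<integral>\<^sup>+z. ennreal \<bar>u n z\<bar> \<partial>(M \<Otimes>\<^sub>M weight)) < \<infinity>" for n
      unfolding eq using nn_integral_mono[of M, OF inner2] tot by (rule order.strict_trans1)
    have "(\<lambda>n. \<integral>\<^sup>+p. \<integral>\<^sup>+v. ennreal \<bar>u n (p, v)\<bar> \<partial>weight \<partial>M) \<longlonglongrightarrow> (\<integral>\<^sup>+p. 0 \<partial>M)"
    proof (rule nn_integral_dominated_convergence[where w = "\<lambda>_. 2 * emeasure weight UNIV"])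
      show "AE p in M. (\<lambda>n. \<integral>\<^sup>+v. ennreal \<bar>u n (p, v)\<bar> \<partial>weight) \<longlonglongrightarrow> 0"
        using \<xi> c c' AE_space
      proof eventually_elim
        case (elim p)
        have [measurable]: "k p \<in> borel_measurable borel"
          using measurable_Pair2[OF km elim(4)] by simp
        show ?case unfolding u_def fst_conv snd_conv
          by (rule affine_L1_continuity) (use elim k in auto)
      qed
    qed (use inner2 tot in auto)
    then show "(\<lambda>n. \<integral>\<^sup>+z. ennreal \<bar>u n z\<bar> \<partial>(M \<Otimes>\<^sub>M weight)) \<longlonglongrightarrow> 0" by (simp add: eq)
  qed measurable
  then obtain r :: "nat \<Rightarrow> nat" where r: "strict_mono r" "AE z in M \<Otimes>\<^sub>M weight. (\<lambda>n. u (r n) z) \<longlonglongrightarrow> 0"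
    by blast
  from AE_pair[OF r(2)] have "AE p in M. AE v in lborel. (\<lambda>n. u (r n) (p, v)) \<longlonglongrightarrow> 0"
    by (simp add: AE_weight_iff)
  then have "AE p in M. AE v in lborel. (\<lambda>n. k p (\<xi> (r n) p + c (r n) p *\<^sub>R v)) \<longlonglongrightarrow> k p (\<xi>' p + c' p *\<^sub>R v)"
    by (rule eventually_mono) (auto simp: u_def elim!: eventually_mono intro: Lim_transform_eq[THEN iffD1] LIM_zero_cancel)
  with r(1) show ?thesis by blast
qed

section \<open>Absorption and source along characteristics\<close>

text \<open>
  Exchanging the order of two almost everywhere quantifiers requires that the set of convergence is
  measurable.
\<close>
lemma measurable_tendsto_0 [measurable]:
  fixes u :: "nat \<Rightarrow> 'a \<Rightarrow> real"
  assumes [measurable]: "\<And>n. u n \<in> borel_measurable M"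
  shows "Measurable.pred M (\<lambda>x. (\<lambda>n. u n x) \<longlonglongrightarrow> 0)"
proof -
  have "(\<lambda>n. u n x) \<longlonglongrightarrow> 0 \<longleftrightarrow> (\<forall>k::nat. \<exists>N. \<forall>n\<ge>N. \<bar>u n x\<bar> < inverse (Suc k))" for x
  proof
    assume "(\<lambda>n. u n x) \<longlonglongrightarrow> 0"
    from LIMSEQ_D[OF this] show "\<forall>k::nat. \<exists>N. \<forall>n\<ge>N. \<bar>u n x\<bar> < inverse (Suc k)" by simp
  next
    assume *: "\<forall>k::nat. \<exists>N. \<forall>n\<ge>N. \<bar>u n x\<bar> < inverse (Suc k)"
    show "(\<lambda>n. u n x) \<longlonglongrightarrow> 0"
    proof (rule LIMSEQ_I)
      fix e :: real assume "0 < e"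
      then obtain k where k: "inverse (real (Suc k)) < e" using reals_Archimedean by blast
      obtain N where "\<forall>n\<ge>N. \<bar>u n x\<bar> < inverse (Suc k)" using * by blast
      then show "\<exists>N. \<forall>n\<ge>N. norm (u n x - 0) < e" using k by (intro exI[of _ N]) force
    qed
  qed
  then show ?thesis by simp
qed

text \<open>
  The density \<open>f\<close> is a Borel representative of the solution. The square of \<open>W\<close> appears because the gain
  term is quadratic in \<open>f\<close>.
\<close>
locale dominated_density = collision_kernel +
  fixes f :: "real \<Rightarrow> R3 \<Rightarrow> R3 \<Rightarrow> real" and W :: "real \<Rightarrow> real"
  assumes f_borel: "(\<lambda>(\<tau>, y, u). f \<tau> y u) \<in> borel_measurable borel"
    and f_nonneg: "\<And>\<tau> y u. 0 \<le> f \<tau> y u"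
    and f_le: "\<And>\<tau> y u. f \<tau> y u \<le> W \<tau> * japanese u powr - \<beta>"
    and W_borel [measurable]: "W \<in> borel_measurable borel"
    and W_nonneg: "\<And>\<tau>. 0 \<le> W \<tau>"
    and W_square: "\<And>T. (\<integral>\<^sup>+\<tau>. ennreal ((W \<tau>)\<^sup>2) * indicator {0..T} \<tau> \<partial>lborel) < \<infinity>"
begin

lemma f_measurable [measurable]:
  assumes [measurable]: "a \<in> borel_measurable M" "b \<in> borel_measurable M" "c \<in> borel_measurable M"
  shows "(\<lambda>x. f (a x) (b x) (c x)) \<in> borel_measurable M"
proof -
  have "(\<lambda>x. (a x, b x, c x)) \<in> borel_measurable M" by measurable
  from measurable_compose[OF this f_borel] show ?thesis by simp
qed

lemma W_integral: "(\<integral>\<^sup>+\<tau>. ennreal (W \<tau>) * indicator {0..T} \<tau> \<partial>lborel) < \<infinity>"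
proof -
  have "(\<integral>\<^sup>+\<tau>. ennreal (W \<tau>) * indicator {0..T} \<tau> \<partial>lborel)
      \<le> (\<integral>\<^sup>+\<tau>. ennreal ((W \<tau>)\<^sup>2) * indicator {0..T} \<tau> + indicator {0..T} \<tau> \<partial>lborel)"
  proof (intro nn_integral_mono)
    fix \<tau>
    have "0 \<le> (W \<tau> - 1)\<^sup>2 + (W \<tau>)\<^sup>2 + 1" by simp
    then have "W \<tau> \<le> (W \<tau>)\<^sup>2 + 1" by (simp add: power2_diff)
    then have "ennreal (W \<tau>) \<le> ennreal ((W \<tau>)\<^sup>2) + 1" by (simp add: ennreal_leI flip: ennreal_plus ennreal_1)
    then show "ennreal (W \<tau>) * indicator {0..T} \<tau> \<le> ennreal ((W \<tau>)\<^sup>2) * indicator {0..T} \<tau> + indicator {0..T} \<tau>"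
      by (simp add: indicator_def)
  qed
  also have "\<dots> = (\<integral>\<^sup>+\<tau>. ennreal ((W \<tau>)\<^sup>2) * indicator {0..T} \<tau> \<partial>lborel) + emeasure lborel {0..T}"
    by (subst nn_integral_add) auto
  also have "\<dots> < \<infinity>" using W_square[of T] by (cases "0 \<le> T") auto
  finally show ?thesis .
qed

text \<open>
  The two integrals of the Duhamel formula along the characteristic that ends in \<open>(t, x)\<close> with
  velocity \<open>v\<close>.
\<close>
definition absorption :: "real \<Rightarrow> real \<Rightarrow> R3 \<Rightarrow> R3 \<Rightarrow> ennreal" where
  "absorption s t x v = (\<integral>\<^sup>+\<tau>. freq (f \<tau> (x - (t - \<tau>) *\<^sub>R v)) v * indicator {s..t} \<tau> \<partial>lborel)"

definition source :: "real \<Rightarrow> R3 \<Rightarrow> R3 \<Rightarrow> ennreal" where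
  "source t x v = (\<integral>\<^sup>+s. ennreal (exp (- enn2real (absorption s t x v)))
     * gain (f s (x - (t - s) *\<^sub>R v)) v * indicator {0..t} s \<partial>lborel)"

lemma absorption_measurable [measurable]:
  assumes [measurable]: "a \<in> borel_measurable M" "b \<in> borel_measurable M"
  shows "(\<lambda>p. absorption (a p) t x (b p)) \<in> borel_measurable M"
  unfolding absorption_def indicator_def atLeastAtMost_iff by measurable

lemma source_measurable [measurable]:
  "source t x \<in> borel_measurable borel"
  unfolding source_def by measurable

lemma freq_f_le:
  obtains C where "C < \<infinity>" "\<And>\<tau> y v. freq (f \<tau> y) v \<le> C * ennreal (japanese v) * ennreal (W \<tau>)"
proof -
  obtain C where C: "C < \<infinity>" "\<And>v. freq (\<lambda>u. japanese u powr - \<beta>) v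
     \<le> C * ennreal (japanese v)"
    using freq_bound by blast
  have "freq (f \<tau> y) v \<le> ennreal (W \<tau>) * (C * ennreal (japanese v))" for \<tau> y v
    by (rule order_trans[OF freq_le_const_mult[OF f_nonneg f_le W_nonneg] mult_left_mono[OF C(2)]]) simp
  then show ?thesis using that C(1) by (simp add: ac_simps)
qed

lemma gain_f_le:
  obtains C where "C < \<infinity>" "\<And>\<tau> y v. gain (f \<tau> y) v \<le> C * ennreal (japanese v powr - decay) * ennreal ((W \<tau>)\<^sup>2)"
proof -
  obtain C where C: "C < \<infinity>" "\<And>v. freq (\<lambda>u. japanese u powr - decay_u * japanese v powr - decay_v) v
     \<le> C * ennreal (japanese v powr - decay)"
    using gain_bound by blast
  have "gain (f \<tau> y) v \<le> ennreal ((W \<tau>)\<^sup>2) * (C * ennreal (japanese v powr - decay))" for \<tau> y v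
    by (rule order_trans[OF gain_le_const_mult[OF f_nonneg f_le W_nonneg] mult_left_mono[OF C(2)]]) simp
  then show ?thesis using that C(1) by (simp add: ac_simps)
qed

lemma absorption_finite: 
  assumes "0 \<le> s"
  shows "absorption s t x v < \<infinity>"
proof -
  obtain C where C: "C < \<infinity>" "\<And>\<tau> y v. freq (f \<tau> y) v \<le> C * ennreal (japanese v) * ennreal (W \<tau>)"
    using freq_f_le by blast
  have "absorption s t x v \<le> (\<integral>\<^sup>+\<tau>. (C * ennreal (japanese v)) * (ennreal (W \<tau>) * indicator {0..t} \<tau>) \<partial>lborel)"
    unfolding absorption_def
    by (intro nn_integral_mono) (use assms C(2) in \<open>auto simp: indicator_def mult.assoc\<close>)
  also have "\<dots> = (C * ennreal (japanese v)) * (\<integral>\<^sup>+\<tau>. ennreal (W \<tau>) * indicator {0..t} \<tau> \<partial>lborel)"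
    by (rule nn_integral_cmult) measurable
  also have "\<dots> < \<infinity>" using C(1) W_integral by (simp add: ennreal_mult_less_top)
  finally show ?thesis .
qed

lemma source_le:
  obtains C where "0 \<le> C" "\<And>t x v. t \<le> T \<Longrightarrow> source t x v \<le> ennreal (C * japanese v powr - decay)"
proof -
  obtain C where C: "C < \<infinity>" "\<And>\<tau> y v. gain (f \<tau> y) v \<le> C * ennreal (japanese v powr - decay) * ennreal ((W \<tau>)\<^sup>2)"
    using gain_f_le by blast
  define B where "B = C * (\<integral>\<^sup>+\<tau>. ennreal ((W \<tau>)\<^sup>2) * indicator {0..T} \<tau> \<partial>lborel)"
  have B: "B < \<infinity>" using C(1) W_square[of T] by (simp add: B_def ennreal_mult_less_top)
  have "source t x v \<le> ennreal (enn2real B * japanese v powr - decay)" if "t \<le> T" for t x v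
  proof -
    have "source t x v \<le> (\<integral>\<^sup>+\<tau>. (C * ennreal (japanese v powr - decay)) * (ennreal ((W \<tau>)\<^sup>2) * indicator {0..T} \<tau>) \<partial>lborel)"
      unfolding source_def
    proof (intro nn_integral_mono)
      fix s
      have "ennreal (exp (- enn2real (absorption s t x v))) * gain (f s (x - (t - s) *\<^sub>R v)) v
        \<le> 1 * (C * ennreal (japanese v powr - decay) * ennreal ((W s)\<^sup>2))"
        by (intro mult_mono C) auto
      then show "ennreal (exp (- enn2real (absorption s t x v))) * gain (f s (x - (t - s) *\<^sub>R v)) v * indicator {0..t} s
        \<le> (C * ennreal (japanese v powr - decay)) * (ennreal ((W s)\<^sup>2) * indicator {0..T} s)"
        using that by (auto simp: indicator_def)
    qed
    also have "\<dots> = (C * ennreal (japanese v powr - decay)) * (\<integral>\<^sup>+\<tau>. ennreal ((W \<tau>)\<^sup>2) * indicator {0..T} \<tau> \<partial>lborel)"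
      by (rule nn_integral_cmult) measurable
    also have "\<dots> = B * ennreal (japanese v powr - decay)" by (simp add: B_def ac_simps)
    also have "\<dots> = ennreal (enn2real B * japanese v powr - decay)"
      using B by (simp add: ennreal_mult less_top[symmetric])
    finally show ?thesis .
  qed
  then show ?thesis using that[of "enn2real B"] by simp
qed

text \<open>
  For fixed \<open>\<tau> < t'\<close> and \<open>u\<close> the map \<open>v \<mapsto> x - (t - \<tau>) v\<close> is affine with a nonzero factor, so
  \<open>affine_AE_subseq\<close> applies with parameter \<open>(\<tau>, u)\<close>. Since \<open>W\<close> may be unbounded, it is applied to \<open>f / (1 + W)\<close>; the
  factor \<open>1 + W \<tau>\<close> is the same in all members of the sequence.
\<close>
lemma slice_subseq:
  assumes t: "t \<longlonglongrightarrow> t'" and x: "x \<longlonglongrightarrow> x'"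
  shows "\<exists>r::nat\<Rightarrow>nat. strict_mono r \<and>
    (AE v in lborel. AE \<tau> in lborel. \<tau> \<in> {0..<t'} \<longrightarrow>
      (AE u in lborel. (\<lambda>n. f \<tau> (x (r n) - (t (r n) - \<tau>) *\<^sub>R v) u) \<longlonglongrightarrow> f \<tau> (x' - (t' - \<tau>) *\<^sub>R v) u))"
proof -
  \<comment> \<open>A finite measure on the parameters \<open>(\<tau>, u)\<close> that charges all of \<open>0 \<le> \<tau> < t'\<close>.\<close>
  define \<rho> where "\<rho> p = ennreal (japanese (snd p) powr - 4) * indicator {0..<t'} (fst p)" for p :: "real \<times> R3"
  have [measurable]: "\<rho> \<in> borel_measurable borel" unfolding \<rho>_def by measurable
  define M where "M = density (lborel :: (real \<times> R3) measure) \<rho>"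
  define k where "k p y = f (fst p) y (snd p) / (1 + W (fst p))" for p :: "real \<times> R3" and y
  have W1: "1 + W \<tau> > 0" for \<tau> using W_nonneg[of \<tau>] by linarith
  have [measurable_cong, simp]: "sets M = sets borel" by (simp add: M_def)
  have "\<exists>r::nat\<Rightarrow>nat. strict_mono r \<and>
    (AE p in M. AE v in lborel. (\<lambda>n. k p (x (r n) + (- (t (r n) - fst p)) *\<^sub>R v)) \<longlonglongrightarrow> k p (x' + (- (t' - fst p)) *\<^sub>R v))"
  proof (rule affine_AE_subseq)
    show "finite_measure M"
    proof
      have "emeasure M (space M) = (\<integral>\<^sup>+p. \<rho> p \<partial>lborel)"
        by (simp add: M_def emeasure_density)
      also have "\<dots> = (\<integral>\<^sup>+\<tau>. \<integral>\<^sup>+u. \<rho> (\<tau>, u) \<partial>lborel \<partial>lborel)"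
        unfolding lborel_prod[symmetric] by (rule lborel.nn_integral_fst[symmetric]) (unfold lborel_prod, measurable)
      also have "\<dots> = (\<integral>\<^sup>+u. ennreal (japanese u powr - 4) \<partial>lborel) * emeasure lborel {0..<t'}"
        by (simp add: \<rho>_def nn_integral_multc nn_integral_cmult)
      also have "\<dots> < \<infinity>"
        using nn_integral_japanese_powr_finite[of 4] by (cases "0 \<le> t'") (auto simp: ennreal_mult_less_top)
      finally show "emeasure M (space M) \<noteq> \<infinity>" by simp
    qed
    show "case_prod k \<in> borel_measurable (M \<Otimes>\<^sub>M borel)"
      unfolding k_def by measurable
    show "\<bar>k p y\<bar> \<le> 1" for p y
    proof -
      have "W (fst p) * japanese (snd p) powr - \<beta> \<le> W (fst p) * 1"
        using powr_mono[of "- \<beta>" 0 "japanese (snd p)"] japanese_ge_1[of "snd p"] beta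
        by (intro mult_left_mono W_nonneg) auto
      then have "f (fst p) y (snd p) \<le> 1 + W (fst p)"
        using f_le[of "fst p" y "snd p"] by linarith
      then show ?thesis
        using W1[of "fst p"] f_nonneg[of "fst p" y "snd p"] by (simp add: k_def)
    qed
    have "AE \<tau> in lborel. \<tau> \<noteq> t'" by (rule AE_lborel_singleton)
    then have "AE \<tau> in lborel. AE u :: R3 in lborel. \<tau> \<noteq> t'" by (rule eventually_mono) simp
    then have "AE p :: real \<times> R3 in lborel. fst p \<noteq> t'" by (rule AE_lborel_pairI) measurable
    then show "AE p in M. - (t' - fst p) \<noteq> 0"
      unfolding M_def by (subst AE_density) (auto elim!: eventually_mono)
  qed (auto intro!: tendsto_intros x t)
  then obtain r :: "nat \<Rightarrow> nat" where r: "strict_mono r"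
    "AE p in M. AE v in lborel. (\<lambda>n. k p (x (r n) + (- (t (r n) - fst p)) *\<^sub>R v)) \<longlonglongrightarrow> k p (x' + (- (t' - fst p)) *\<^sub>R v)"
    by blast
  let ?conv = "\<lambda>v \<tau> u. (\<lambda>n. f \<tau> (x (r n) - (t (r n) - \<tau>) *\<^sub>R v) u) \<longlonglongrightarrow> f \<tau> (x' - (t' - \<tau>) *\<^sub>R v) u"
  have eq: "a + (- c) *\<^sub>R v = a - c *\<^sub>R v" for a v :: R3 and c by simp
  define d where "d n p v = k p (x (r n) - (t (r n) - fst p) *\<^sub>R v) - k p (x' - (t' - fst p) *\<^sub>R v)" for n p v
  have "AE p in M. AE v in lborel. (\<lambda>n. d n p v) \<longlonglongrightarrow> 0"
    using r(2) unfolding d_def eq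
    by (rule eventually_mono) (auto elim!: eventually_mono intro: LIM_zero)
  then have "AE p in lborel. AE v in lborel. fst p \<in> {0..<t'} \<longrightarrow> (\<lambda>n. d n p v) \<longlonglongrightarrow> 0"
    unfolding M_def by (subst (asm) AE_density) (auto simp: \<rho>_def indicator_def elim!: eventually_mono)
  then have "AE z in lborel. fst (fst z) \<in> {0..<t'} \<longrightarrow> (\<lambda>n. d n (fst z) (snd z)) \<longlonglongrightarrow> 0"
  proof (rule AE_lborel_pairI)
    show "{z :: (real \<times> R3) \<times> R3. fst (fst z) \<in> {0..<t'} \<longrightarrow> (\<lambda>n. d n (fst z) (snd z)) \<longlonglongrightarrow> 0} \<in> sets borel"
      unfolding d_def k_def by measurable
  qed
  then have "AE v in lborel. AE p in lborel. fst p \<in> {0..<t'} \<longrightarrow> (\<lambda>n. d n p v) \<longlonglongrightarrow> 0"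
    by (rule AE_lborel_swap)
  then have "AE v in lborel. AE \<tau> in lborel. \<tau> \<in> {0..<t'} \<longrightarrow>
      (AE u in lborel. ?conv v \<tau> u)"
  proof (rule eventually_mono)
    fix v assume "AE p in lborel. fst p \<in> {0..<t'} \<longrightarrow> (\<lambda>n. d n p v) \<longlonglongrightarrow> 0"
    from AE_lborel_pair[OF this]
    show "AE \<tau> in lborel. \<tau> \<in> {0..<t'} \<longrightarrow>
      (AE u in lborel. ?conv v \<tau> u)"
    proof (rule eventually_mono, intro impI)
      fix \<tau> assume "AE u in lborel. fst (\<tau>, u) \<in> {0..<t'} \<longrightarrow> (\<lambda>n. d n (\<tau>, u) v) \<longlonglongrightarrow> 0" and \<tau>: "\<tau> \<in> {0..<t'}"
      then show "AE u in lborel. ?conv v \<tau> u"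
      proof (elim eventually_mono)
        fix u assume "fst (\<tau>, u) \<in> {0..<t'} \<longrightarrow> (\<lambda>n. d n (\<tau>, u) v) \<longlonglongrightarrow> 0"
        then have "(\<lambda>n. (1 + W \<tau>) * d n (\<tau>, u) v) \<longlonglongrightarrow> (1 + W \<tau>) * 0"
          using \<tau> by (intro tendsto_intros) auto
        moreover have "(1 + W \<tau>) * d n (\<tau>, u) v = f \<tau> (x (r n) - (t (r n) - \<tau>) *\<^sub>R v) u - f \<tau> (x' - (t' - \<tau>) *\<^sub>R v) u" for n
          using W1[of \<tau>] by (simp add: d_def k_def right_diff_distrib)
        ultimately have "(\<lambda>n. f \<tau> (x (r n) - (t (r n) - \<tau>) *\<^sub>R v) u - f \<tau> (x' - (t' - \<tau>) *\<^sub>R v) u) \<longlonglongrightarrow> 0" by simp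
        then show "?conv v \<tau> u"
          by (rule LIM_zero_cancel)
      qed
    qed
  qed
  with r(1) show ?thesis by blast
qed

lemma tendsto_moving_indicator:
  fixes t :: "nat \<Rightarrow> real" and g :: "nat \<Rightarrow> ennreal"
  assumes t: "t \<longlonglongrightarrow> t'" and s: "0 \<le> s" and \<tau>: "\<tau> \<noteq> t'" and g: "\<tau> \<in> {0..<t'} \<Longrightarrow> g \<longlonglongrightarrow> g'"
  shows "(\<lambda>n. g n * indicator {s..t n} \<tau>) \<longlonglongrightarrow> g' * indicator {s..t'} \<tau>"
proof (cases "s \<le> \<tau> \<and> \<tau> < t'")
  case True
  then have "eventually (\<lambda>n. \<tau> < t n) sequentially" by (intro order_tendstoD[OF t]) auto
  then have ev: "eventually (\<lambda>n. g n * indicator {s..t n} \<tau> = g n) sequentially"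
    by (rule eventually_mono) (use True in auto)
  have "g \<longlonglongrightarrow> g'" using True s by (intro g) auto
  then have "(\<lambda>n. g n * indicator {s..t n} \<tau>) \<longlonglongrightarrow> g'"
    by (rule Lim_transform_eventually) (use ev in \<open>auto elim: eventually_mono\<close>)
  then show ?thesis using True by simp
next
  case False
  have "eventually (\<lambda>n. g n * indicator {s..t n} \<tau> = 0) sequentially"
  proof (cases "\<tau> < s")
    case False
    then have "t' < \<tau>" using \<open>\<not> (s \<le> \<tau> \<and> \<tau> < t')\<close> \<tau> by auto
    then have "eventually (\<lambda>n. t n < \<tau>) sequentially" by (intro order_tendstoD[OF t]) auto
    then show ?thesis by (rule eventually_mono) auto
  qed auto
  then have "(\<lambda>n. g n * indicator {s..t n} \<tau>) \<longlonglongrightarrow> 0" by (rule tendsto_eventually)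
  moreover have "g' * indicator {s..t'} \<tau> = 0" using False \<tau> by (auto simp: indicator_def)
  ultimately show ?thesis by (simp only:)
qed

text \<open>
  For almost every \<open>v\<close> the frequency and the gain term converge for almost every time before \<open>t'\<close>,
  and later times drop out of the integrals in the limit. The time integrals have the majorants
  \<open>W\<close> and \<open>W\<^sup>2\<close>, up to factors that depend on \<open>v\<close>.
\<close>
lemma absorption_source_subseq:
  assumes t: "t \<longlonglongrightarrow> t'" and x: "x \<longlonglongrightarrow> x'"
  shows "\<exists>r::nat\<Rightarrow>nat. strict_mono r \<and> (AE v in lborel.
     (\<lambda>n. absorption 0 (t (r n)) (x (r n)) v) \<longlonglongrightarrow> absorption 0 t' x' v \<and>
     (\<lambda>n. source (t (r n)) (x (r n)) v) \<longlonglongrightarrow> source t' x' v)"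
proof -
  obtain r :: "nat \<Rightarrow> nat" where r: "strict_mono r"
    "AE v in lborel. AE \<tau> in lborel. \<tau> \<in> {0..<t'} \<longrightarrow>
      (AE u in lborel. (\<lambda>n. f \<tau> (x (r n) - (t (r n) - \<tau>) *\<^sub>R v) u) \<longlonglongrightarrow> f \<tau> (x' - (t' - \<tau>) *\<^sub>R v) u)"
    using slice_subseq[OF t x] by blast
  have tr: "(\<lambda>n. t (r n)) \<longlonglongrightarrow> t'" using LIMSEQ_subseq_LIMSEQ[OF t r(1)] by (simp add: o_def)
  obtain T where T: "\<And>n. t n \<le> T"
    using convergent_imp_Bseq[OF convergentI[OF t]] by (auto simp: Bseq_def abs_le_iff)
  obtain Cf where Cf: "Cf < \<infinity>" "\<And>\<tau> y v. freq (f \<tau> y) v \<le> Cf * ennreal (japanese v) * ennreal (W \<tau>)"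
    using freq_f_le by blast
  obtain Cg where Cg: "Cg < \<infinity>" "\<And>\<tau> y v. gain (f \<tau> y) v \<le> Cg * ennreal (japanese v powr - decay) * ennreal ((W \<tau>)\<^sup>2)"
    using gain_f_le by blast
  have "AE v in lborel. (\<lambda>n. absorption 0 (t (r n)) (x (r n)) v) \<longlonglongrightarrow> absorption 0 t' x' v \<and>
     (\<lambda>n. source (t (r n)) (x (r n)) v) \<longlonglongrightarrow> source t' x' v"
    using r(2)
  proof (rule eventually_mono)
    fix v
    assume v: "AE \<tau> in lborel. \<tau> \<in> {0..<t'} \<longrightarrow>
      (AE u in lborel. (\<lambda>n. f \<tau> (x (r n) - (t (r n) - \<tau>) *\<^sub>R v) u) \<longlonglongrightarrow> f \<tau> (x' - (t' - \<tau>) *\<^sub>R v) u)"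
    let ?fr = "\<lambda>n \<tau>. freq (f \<tau> (x (r n) - (t (r n) - \<tau>) *\<^sub>R v)) v"
    let ?fr' = "\<lambda>\<tau>. freq (f \<tau> (x' - (t' - \<tau>) *\<^sub>R v)) v"
    let ?ga = "\<lambda>n \<tau>. gain (f \<tau> (x (r n) - (t (r n) - \<tau>) *\<^sub>R v)) v"
    let ?ga' = "\<lambda>\<tau>. gain (f \<tau> (x' - (t' - \<tau>) *\<^sub>R v)) v"
    let ?ex = "\<lambda>n s. ennreal (exp (- enn2real (absorption s (t (r n)) (x (r n)) v)))"
    let ?ex' = "\<lambda>s. ennreal (exp (- enn2real (absorption s t' x' v)))"
    have good: "AE \<tau> in lborel. \<tau> \<noteq> t' \<and> (\<tau> \<in> {0..<t'} \<longrightarrow>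
        (\<lambda>n. ?fr n \<tau>) \<longlonglongrightarrow> ?fr' \<tau> \<and>
        (\<lambda>n. ?ga n \<tau>) \<longlonglongrightarrow> ?ga' \<tau>)"
      using v AE_lborel_singleton[of t']
      by eventually_elim (auto intro!: freq_tendsto[OF _ _ f_le W_nonneg] gain_tendsto[OF _ _ f_nonneg f_le W_nonneg])
    have abs_lim: "(\<lambda>n. absorption s (t (r n)) (x (r n)) v) \<longlonglongrightarrow> absorption s t' x' v" if s: "0 \<le> s" for s
      unfolding absorption_def
    proof (rule nn_integral_dominated_convergence[where w = "\<lambda>\<tau>. Cf * ennreal (japanese v) * (ennreal (W \<tau>) * indicator {0..T} \<tau>)"])
      show "AE \<tau> in lborel. ?fr n \<tau> * indicator {s..t (r n)} \<tau>
        \<le> Cf * ennreal (japanese v) * (ennreal (W \<tau>) * indicator {0..T} \<tau>)" for n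
        using T[of "r n"] s Cf(2) by (intro AE_I2) (auto simp: indicator_def mult.assoc)
      show "(\<integral>\<^sup>+\<tau>. Cf * ennreal (japanese v) * (ennreal (W \<tau>) * indicator {0..T} \<tau>) \<partial>lborel) < \<infinity>"
        using Cf(1) W_integral[of T] by (subst nn_integral_cmult) (auto simp: ennreal_mult_less_top)
      show "AE \<tau> in lborel. (\<lambda>n. ?fr n \<tau> * indicator {s..t (r n)} \<tau>)
         \<longlonglongrightarrow> ?fr' \<tau> * indicator {s..t'} \<tau>"
        using good by (rule eventually_mono) (auto intro!: tendsto_moving_indicator[OF tr s])
    qed measurable
    have "(\<lambda>n. source (t (r n)) (x (r n)) v) \<longlonglongrightarrow> source t' x' v"
      unfolding source_def
    proof (rule nn_integral_dominated_convergence[where w = "\<lambda>\<tau>. Cg * ennreal (japanese v powr - decay) * (ennreal ((W \<tau>)\<^sup>2) * indicator {0..T} \<tau>)"])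
      show "AE s in lborel. ?ex n s
          * ?ga n s * indicator {0..t (r n)} s
        \<le> Cg * ennreal (japanese v powr - decay) * (ennreal ((W s)\<^sup>2) * indicator {0..T} s)" for n
      proof (rule AE_I2)
        fix s
        have "?ex n s * ?ga n s
          \<le> 1 * (Cg * ennreal (japanese v powr - decay) * ennreal ((W s)\<^sup>2))"
          by (intro mult_mono Cg) auto
        then show "?ex n s
          * ?ga n s * indicator {0..t (r n)} s
          \<le> Cg * ennreal (japanese v powr - decay) * (ennreal ((W s)\<^sup>2) * indicator {0..T} s)"
          using T[of "r n"] by (auto simp: indicator_def mult.assoc)
      qed
      show "(\<integral>\<^sup>+\<tau>. Cg * ennreal (japanese v powr - decay) * (ennreal ((W \<tau>)\<^sup>2) * indicator {0..T} \<tau>) \<partial>lborel) < \<infinity>"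
        using Cg(1) W_square[of T] by (subst nn_integral_cmult) (auto simp: ennreal_mult_less_top)
      show "AE s in lborel. (\<lambda>n. ?ex n s
          * ?ga n s * indicator {0..t (r n)} s)
         \<longlonglongrightarrow> ?ex' s * ?ga' s * indicator {0..t'} s"
        using good
      proof (rule eventually_mono)
        fix s
        assume g: "s \<noteq> t' \<and> (s \<in> {0..<t'} \<longrightarrow>
          (\<lambda>n. ?fr n s) \<longlonglongrightarrow> ?fr' s \<and>
          (\<lambda>n. ?ga n s) \<longlonglongrightarrow> ?ga' s)"
        show "(\<lambda>n. ?ex n s
          * ?ga n s * indicator {0..t (r n)} s)
         \<longlonglongrightarrow> ?ex' s * ?ga' s * indicator {0..t'} s"
        proof (rule tendsto_moving_indicator[OF tr])
          assume s: "s \<in> {0..<t'}"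
          have fin: "absorption s t' x' v < \<infinity>" using s by (intro absorption_finite) auto
          have "(\<lambda>n. enn2real (absorption s (t (r n)) (x (r n)) v)) \<longlonglongrightarrow> enn2real (absorption s t' x' v)"
            using fin abs_lim[of s] s by (intro tendsto_enn2real) (auto simp: less_top[symmetric])
          then have "(\<lambda>n. ?ex n s) \<longlonglongrightarrow> ?ex' s"
            by (intro tendsto_ennrealI tendsto_exp tendsto_minus)
          then show "(\<lambda>n. ?ex n s * ?ga n s)
            \<longlonglongrightarrow> ?ex' s * ?ga' s"
            using g s by (intro tendsto_mult_ennreal) auto
        qed (use g in auto)
      qed
    qed measurable
    with abs_lim[of 0] show "(\<lambda>n. absorption 0 (t (r n)) (x (r n)) v) \<longlonglongrightarrow> absorption 0 t' x' v \<and>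
     (\<lambda>n. source (t (r n)) (x (r n)) v) \<longlonglongrightarrow> source t' x' v" by simp
  qed
  with r(1) show ?thesis by blast
qed

end

section \<open>Velocity moments and the transported initial datum\<close>

lemma tendsto_by_subsubsequences:
  fixes X :: "nat \<Rightarrow> 'a::metric_space"
  assumes "\<And>r :: nat \<Rightarrow> nat. strict_mono r \<Longrightarrow> \<exists>r' :: nat \<Rightarrow> nat. strict_mono r' \<and> (\<lambda>n. X (r (r' n))) \<longlonglongrightarrow> L"
  shows "X \<longlonglongrightarrow> L"
proof (rule ccontr)
  assume "\<not> X \<longlonglongrightarrow> L"
  then obtain e where e: "0 < e" "\<not> (\<forall>\<^sub>F n in sequentially. dist (X n) L < e)"
    by (auto simp: tendsto_iff)
  define S where "S = {n. e \<le> dist (X n) L}"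
  have "infinite S"
    using e(2) by (simp add: S_def frequently_cofinite[symmetric] cofinite_eq_sequentially frequently_def not_le)
  then have r: "strict_mono (enumerate S)" "\<And>n. enumerate S n \<in> S"
    by (auto simp: strict_mono_enumerate enumerate_in_set)
  obtain r' :: "nat \<Rightarrow> nat" where "(\<lambda>n. X (enumerate S (r' n))) \<longlonglongrightarrow> L" using assms[OF r(1)] by blast
  from tendstoD[OF this e(1)] obtain n where "dist (X (enumerate S (r' n))) L < e"
    by (auto simp: eventually_sequentially)
  then show False using r(2)[of "r' n"] by (simp add: S_def)
qed

lemma integrable_japanese_powr:
  assumes "3 < a"
  shows "integrable lebesgue (\<lambda>v. C * japanese v powr - a)"
proof -
  have "integrable lborel (\<lambda>v. japanese v powr - a)"
    using nn_integral_japanese_powr_finite[OF assms] by (intro integrableI_nonneg) auto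
  then have "integrable lborel (\<lambda>v. C * japanese v powr - a)" by (rule integrable_mult_right)
  then show ?thesis by (subst integrable_completion) auto
qed

text \<open>
  A bound with a power below \<open>-5\<close> leaves an integrable majorant after multiplication by the square of
  the bracket. For sequential continuity it suffices that every subsequence has a further
  subsequence along which the integrals converge.
\<close>
lemma moments_continuous:
  fixes G :: "real \<Rightarrow> R3 \<Rightarrow> R3 \<Rightarrow> real" and \<phi> :: "R3 \<Rightarrow> 'b::euclidean_space"
  assumes meas: "\<And>t x. 0 < t \<Longrightarrow> G t x \<in> borel_measurable lebesgue"
    and bound: "\<And>T. \<exists>C. \<forall>t x. 0 < t \<longrightarrow> t \<le> T \<longrightarrow> (AE v in lborel. \<bar>G t x v\<bar> \<le> C * japanese v powr - a)"
    and a: "5 < a"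
    and subseq: "\<And>t x t' x'. (\<And>n. 0 < t n) \<Longrightarrow> 0 < t' \<Longrightarrow> t \<longlonglongrightarrow> t' \<Longrightarrow> x \<longlonglongrightarrow> x' \<Longrightarrow>
      \<exists>r::nat\<Rightarrow>nat. strict_mono r \<and> (AE v in lborel. (\<lambda>n. G (t (r n)) (x (r n)) v) \<longlonglongrightarrow> G t' x' v)"
    and \<phi>: "\<phi> \<in> borel_measurable borel" "\<And>v. norm (\<phi> v) \<le> (japanese v)\<^sup>2"
  shows "0 < t \<Longrightarrow> integrable lebesgue (\<lambda>v. G t x v *\<^sub>R \<phi> v)"
    and "continuous_on (UNIV \<times> {0<..}) (\<lambda>(x, t). LINT v|lebesgue. G t x v *\<^sub>R \<phi> v)"
proof -
  have [measurable]: "\<phi> \<in> borel_measurable lebesgue" using \<phi>(1) by (intro measurable_completion) simp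
  have Gphi [measurable]: "(\<lambda>v. G t x v *\<^sub>R \<phi> v) \<in> borel_measurable lebesgue" if "0 < t" for t x
    using meas[OF that, of x] by measurable
  have dom: "\<exists>C. \<forall>t x. 0 < t \<longrightarrow> t \<le> T \<longrightarrow> (AE v in lebesgue. norm (G t x v *\<^sub>R \<phi> v) \<le> C * japanese v powr - (a - 2))" for T
  proof -
    obtain C where C: "\<And>t x. 0 < t \<Longrightarrow> t \<le> T \<Longrightarrow> AE v in lborel. \<bar>G t x v\<bar> \<le> C * japanese v powr - a"
      using bound[of T] by blast
    have "AE v in lebesgue. norm (G t x v *\<^sub>R \<phi> v) \<le> C * japanese v powr - (a - 2)" if "0 < t" "t \<le> T" for t x
      unfolding AE_completion_iff using C[OF that]
    proof (rule eventually_mono)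
      fix v assume "\<bar>G t x v\<bar> \<le> C * japanese v powr - a"
      then have "\<bar>G t x v\<bar> * norm (\<phi> v) \<le> (C * japanese v powr - a) * (japanese v)\<^sup>2"
        using \<phi>(2)[of v] by (intro mult_mono) (auto intro: order_trans[OF abs_ge_zero])
      also have "(japanese v)\<^sup>2 = japanese v powr 2"
        using powr_realpow[of "japanese v" 2] by (simp only: japanese_pos) simp
      also have "C * japanese v powr - a * japanese v powr 2 = C * japanese v powr - (a - 2)"
        by (simp add: powr_add[symmetric] del: powr_numeral)
      finally show "norm (G t x v *\<^sub>R \<phi> v) \<le> C * japanese v powr - (a - 2)" by simp
    qed
    then show ?thesis by blast
  qed
  have dom_int: "integrable lebesgue (\<lambda>v. C * japanese v powr - (a - 2))" for C
    using a by (intro integrable_japanese_powr) simp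
  show "integrable lebesgue (\<lambda>v. G t x v *\<^sub>R \<phi> v)" if t: "0 < t"
  proof -
    obtain C where "AE v in lebesgue. norm (G t x v *\<^sub>R \<phi> v) \<le> C * japanese v powr - (a - 2)"
      using dom[of t] t by blast
    then show ?thesis
      by (intro Bochner_Integration.integrable_bound[OF dom_int[of C]] Gphi t) (auto elim!: eventually_mono)
  qed
  show "continuous_on (UNIV \<times> {0<..}) (\<lambda>(x, t). LINT v|lebesgue. G t x v *\<^sub>R \<phi> v)"
    unfolding continuous_on_sequentially
  proof (intro allI ballI impI)
    fix z :: "nat \<Rightarrow> R3 \<times> real" and z' assume z': "z' \<in> UNIV \<times> {0<..}" and "(\<forall>n. z n \<in> UNIV \<times> {0<..}) \<and> z \<longlonglongrightarrow> z'"
    then have z: "\<And>n. 0 < snd (z n)" "z \<longlonglongrightarrow> z'" "0 < snd z'"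
      by (auto simp: mem_Times_iff)
    obtain T where T: "\<And>n. snd (z n) \<le> T"
      using convergent_imp_Bseq[OF convergentI[OF tendsto_snd[OF z(2)]]] by (auto simp: Bseq_def abs_le_iff)
    obtain C where C: "\<And>t x. 0 < t \<Longrightarrow> t \<le> T \<Longrightarrow> AE v in lebesgue. norm (G t x v *\<^sub>R \<phi> v) \<le> C * japanese v powr - (a - 2)"
      using dom[of T] by blast
    have "(\<lambda>n. LINT v|lebesgue. G (snd (z n)) (fst (z n)) v *\<^sub>R \<phi> v) \<longlonglongrightarrow> (LINT v|lebesgue. G (snd z') (fst z') v *\<^sub>R \<phi> v)"
    proof (rule tendsto_by_subsubsequences)
      fix r :: "nat \<Rightarrow> nat" assume r: "strict_mono r"
      have zr: "(\<lambda>n. z (r n)) \<longlonglongrightarrow> z'" using LIMSEQ_subseq_LIMSEQ[OF z(2) r] by (simp add: o_def)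
      obtain r' :: "nat \<Rightarrow> nat" where r': "strict_mono r'"
        "AE v in lborel. (\<lambda>n. G (snd (z (r (r' n)))) (fst (z (r (r' n)))) v) \<longlonglongrightarrow> G (snd z') (fst z') v"
        using subseq[of "\<lambda>n. snd (z (r n))" "snd z'" "\<lambda>n. fst (z (r n))" "fst z'"] z tendsto_fst[OF zr] tendsto_snd[OF zr]
        by blast
      have "(\<lambda>n. LINT v|lebesgue. G (snd (z (r (r' n)))) (fst (z (r (r' n)))) v *\<^sub>R \<phi> v)
         \<longlonglongrightarrow> (LINT v|lebesgue. G (snd z') (fst z') v *\<^sub>R \<phi> v)"
      proof (rule integral_dominated_convergence[OF _ _ dom_int[of C]])
        show "AE v in lebesgue. (\<lambda>n. G (snd (z (r (r' n)))) (fst (z (r (r' n)))) v *\<^sub>R \<phi> v) \<longlonglongrightarrow> G (snd z') (fst z') v *\<^sub>R \<phi> v"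
          unfolding AE_completion_iff using r'(2) by (rule eventually_mono) (intro tendsto_intros)
        show "AE v in lebesgue. norm (G (snd (z (r (r' n)))) (fst (z (r (r' n)))) v *\<^sub>R \<phi> v) \<le> C * japanese v powr - (a - 2)" for n
          by (intro C z T)
      qed (intro Gphi z)+
      with r'(1) show "\<exists>r' :: nat \<Rightarrow> nat. strict_mono r' \<and>
          (\<lambda>n. LINT v|lebesgue. G (snd (z (r (r' n)))) (fst (z (r (r' n)))) v *\<^sub>R \<phi> v) \<longlonglongrightarrow> (LINT v|lebesgue. G (snd z') (fst z') v *\<^sub>R \<phi> v)"
        by blast
    qed
    then show "((\<lambda>(x, t). LINT v|lebesgue. G t x v *\<^sub>R \<phi> v) \<circ> z) \<longlonglongrightarrow> (case z' of (x, t) \<Rightarrow> LINT v|lebesgue. G t x v *\<^sub>R \<phi> v)"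
      by (simp add: o_def case_prod_unfold)
  qed
qed

text \<open>
  Convergence in the mean on each ball yields convergence in the mean for the finite measure
  \<open>weight\<close>, since the functions are uniformly bounded and the weight has small tails. This provides a
  single subsequence for all balls.
\<close>
lemma bounded_L1_loc_AE_subseq:
  fixes d :: "nat \<Rightarrow> R3 \<Rightarrow> real"
  assumes meas: "\<And>n. d n \<in> borel_measurable lebesgue" and A: "\<And>n v. \<bar>d n v\<bar> \<le> A"
    and lim: "\<And>R. (\<lambda>n. \<integral>\<^sup>+v. ennreal \<bar>d n v\<bar> * indicator (ball 0 R) v \<partial>lborel) \<longlonglongrightarrow> 0"
  shows "\<exists>r::nat\<Rightarrow>nat. strict_mono r \<and> (AE v in lborel. (\<lambda>n. d (r n) v) \<longlonglongrightarrow> 0)"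
proof -
  have [measurable]: "ball (0::R3) r \<in> sets borel" for r by simp
  have "\<exists>b\<in>borel_measurable lborel. AE v in lborel. d n v = b v" for n
    using completion_ex_borel_measurable_real[OF meas[of n]] .
  then obtain b where b: "\<And>n. b n \<in> borel_measurable lborel" "\<And>n. AE v in lborel. d n v = b n v"
    by metis
  have [measurable]: "b n \<in> borel_measurable borel" for n using b(1)[of n] by simp
  have b_le: "AE v in lborel. \<bar>b n v\<bar> \<le> A" for n
    using b(2)[of n] by (rule eventually_mono) (metis A)
  let ?I = "\<lambda>n k. \<integral>\<^sup>+v. ennreal \<bar>b n v\<bar> * indicator (ball 0 (real k)) v \<partial>lborel"
  let ?J = "\<lambda>k. \<integral>\<^sup>+v. ennreal \<bar>A * indicator (- ball 0 (real k)) v\<bar> \<partial>weight"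
  have tail: "?J \<longlonglongrightarrow> 0"
  proof (rule nn_integral_weight_tendsto_0[where C = "\<bar>A\<bar>"])
    show "AE v in lborel. (\<lambda>k. A * indicator (- ball (0::R3) (real k)) v) \<longlonglongrightarrow> 0"
    proof (rule AE_I2, rule tendsto_eventually)
      fix v :: R3
      obtain N :: nat where "norm v < real N" using reals_Archimedean2 by blast
      then show "\<forall>\<^sub>F k in sequentially. A * indicator (- ball 0 (real k)) v = 0"
        unfolding eventually_sequentially by (intro exI[of _ N]) auto
    qed
  qed (auto simp: indicator_def)
  have split: "(\<integral>\<^sup>+v. ennreal \<bar>b n v\<bar> \<partial>weight) \<le> ?I n k + ?J k" for n k
  proof -
    have "(\<integral>\<^sup>+v. ennreal \<bar>b n v\<bar> \<partial>weight)
       \<le> (\<integral>\<^sup>+v. ennreal \<bar>b n v\<bar> * indicator (ball 0 (real k)) v + ennreal \<bar>A * indicator (- ball 0 (real k)) v\<bar> \<partial>weight)"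
      using b_le[of n] unfolding AE_weight_iff[symmetric]
      by (intro nn_integral_mono_AE) (auto elim!: eventually_mono simp: indicator_def intro!: ennreal_leI)
    also have "\<dots> = (\<integral>\<^sup>+v. ennreal \<bar>b n v\<bar> * indicator (ball 0 (real k)) v \<partial>weight) + ?J k"
      by (rule nn_integral_add) measurable
    also have "(\<integral>\<^sup>+v. ennreal \<bar>b n v\<bar> * indicator (ball 0 (real k)) v \<partial>weight) \<le> ?I n k"
    proof (subst nn_integral_weight)
      have "ennreal (japanese v powr - 4) * c \<le> c" for v c
      proof -
        have "japanese v powr - 4 \<le> 1" using powr_mono[of "- 4" 0 "japanese v"] japanese_ge_1[of v] by simp
        then have "ennreal (japanese v powr - 4) \<le> 1" by (metis ennreal_1 ennreal_leI)
        from mult_right_mono[OF this, of c] show ?thesis by simp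
      qed
      then show "(\<integral>\<^sup>+v. ennreal (japanese v powr - 4) * (ennreal \<bar>b n v\<bar> * indicator (ball 0 (real k)) v) \<partial>lborel) \<le> ?I n k"
        by (intro nn_integral_mono)
    qed measurable
    finally show ?thesis by (simp add: add_right_mono)
  qed
  have I_lim: "(\<lambda>n. ?I n k) \<longlonglongrightarrow> 0" for k
  proof -
    have "?I n k = (\<integral>\<^sup>+v. ennreal \<bar>d n v\<bar> * indicator (ball 0 (real k)) v \<partial>lborel)" for n
      using b(2)[of n] by (intro nn_integral_cong_AE) (auto elim!: eventually_mono)
    then show ?thesis using lim by simp
  qed
  have fin: "(\<integral>\<^sup>+v. ennreal \<bar>b n v\<bar> \<partial>weight) < \<infinity>" for n
  proof -
    have "(\<integral>\<^sup>+v. ennreal \<bar>b n v\<bar> \<partial>weight) \<le> (\<integral>\<^sup>+v. ennreal A \<partial>weight)"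
      using b_le[of n] unfolding AE_weight_iff[symmetric]
      by (intro nn_integral_mono_AE) (auto elim!: eventually_mono intro!: ennreal_leI)
    also have "\<dots> < \<infinity>" using weight.emeasure_finite[of UNIV] by (simp add: ennreal_mult_eq_top_iff less_top[symmetric])
    finally show ?thesis .
  qed
  have "(\<lambda>n. \<integral>\<^sup>+v. ennreal \<bar>b n v\<bar> \<partial>weight) \<longlonglongrightarrow> 0"
  proof (rule order_tendstoI)
    fix e :: ennreal assume e: "0 < e"
    obtain c :: real where c: "0 < c" "ennreal c \<le> e" using ennreal_pos_real_below[OF e] .
    define e' where "e' = ennreal (c / 2)"
    have e': "0 < e'" "e' + e' \<le> e" using c by (auto simp: e'_def simp flip: ennreal_plus)
    obtain k where k: "?J k < e'"
      using order_tendstoD(2)[OF tail e'(1)] by (auto simp: eventually_sequentially)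
    show "eventually (\<lambda>n. (\<integral>\<^sup>+v. ennreal \<bar>b n v\<bar> \<partial>weight) < e) sequentially"
      using order_tendstoD(2)[OF I_lim[of k] e'(1)]
      by (rule eventually_mono)
         (rule less_le_trans[OF le_less_trans[OF split[of _ k] add_strict_mono[OF _ k]] e'(2)])
  qed simp
  then obtain r :: "nat \<Rightarrow> nat" where r: "strict_mono r" "AE v in weight. (\<lambda>n. b (r n) v) \<longlonglongrightarrow> 0"
    using nn_integral_tendsto_0_AE_subseq[of b weight] fin by auto
  have "AE v in lborel. \<forall>n. d n v = b n v" using b(2) by (simp add: AE_all_countable)
  then have "AE v in lborel. (\<lambda>n. d (r n) v) \<longlonglongrightarrow> 0"
    using r(2) unfolding AE_weight_iff by eventually_elim simp
  with r(1) show ?thesis by blast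
qed

text \<open>
  The set \<open>{(x - t v, v)}\<close> is a null set, so Lebesgue measurability of \<open>F\<^sub>0\<close> says nothing about it
  directly. By Fubini the shifted function \<open>F\<^sub>0(x + \<delta> - t v, v)\<close> is measurable in \<open>v\<close> for almost every
  \<open>\<delta>\<close>, and the continuity hypothesis contains, for small \<open>\<delta>\<close>, measurability of its difference to the
  unshifted one.
\<close>
lemma transport_measurable:
  assumes meas: "(\<lambda>(x, v). F\<^sub>0 x v) \<in> borel_measurable lebesgue" and tc: "transport_L1_continuous F\<^sub>0" and t: "0 < t"
  shows "(\<lambda>v. F\<^sub>0 (x - t *\<^sub>R v) v) \<in> borel_measurable lebesgue"
proof -
  obtain B where B: "B \<in> borel_measurable lborel" "AE z in lborel. (case z of (x, v) \<Rightarrow> F\<^sub>0 x v) = B z"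
    using completion_ex_borel_measurable_real[OF meas] by blast
  have [measurable]: "B \<in> borel_measurable borel" using B(1) by simp
  have "AE z :: R3 \<times> R3 in lborel. True \<longrightarrow> (case (x + fst z - t *\<^sub>R snd z, snd z) of (x, v) \<Rightarrow> F\<^sub>0 x v) = B (x + fst z - t *\<^sub>R snd z, snd z)"
    by (rule AE_lborel_preimage[OF B(2), where f = "\<lambda>z. (x + fst z - t *\<^sub>R snd z, snd z)" and S = UNIV
        and g = "\<lambda>w. (fst w - x + t *\<^sub>R snd w, snd w)"]) (auto intro!: derivative_intros)
  then have "AE \<delta> in lborel. AE v in lborel. F\<^sub>0 (x + \<delta> - t *\<^sub>R v) v = B (x + \<delta> - t *\<^sub>R v, v)"
    using AE_lborel_pair by fastforce
  then have good: "AE \<delta> in lborel. (\<lambda>v. F\<^sub>0 (x + \<delta> - t *\<^sub>R v) v) \<in> borel_measurable lebesgue"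
  proof (rule eventually_mono)
    fix \<delta> assume *: "AE v in lborel. F\<^sub>0 (x + \<delta> - t *\<^sub>R v) v = B (x + \<delta> - t *\<^sub>R v, v)"
    have "(\<lambda>v. B (x + \<delta> - t *\<^sub>R v, v)) \<in> borel_measurable lborel" by measurable
    then have "(\<lambda>v. B (x + \<delta> - t *\<^sub>R v, v)) \<in> borel_measurable lebesgue" by (rule measurable_completion)
    then show "(\<lambda>v. F\<^sub>0 (x + \<delta> - t *\<^sub>R v) v) \<in> borel_measurable lebesgue"
      by (rule borel_measurable_AE) (use * in \<open>auto simp: AE_completion_iff elim!: eventually_mono\<close>)
  qed
  have loc: "(\<lambda>v. indicator (ball 0 (real n)) v * F\<^sub>0 (x - t *\<^sub>R v) v) \<in> borel_measurable lebesgue" for n :: nat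
  proof -
    have [measurable]: "ball (0::R3) (real n) \<in> sets lebesgue" by simp
    have "\<forall>\<^sub>F (\<sigma>, \<delta>) in at (0, 0). set_integrable lebesgue (ball 0 (real n)) (\<lambda>v. F\<^sub>0 (x + \<delta> - (t + \<sigma>) *\<^sub>R v) v - F\<^sub>0 (x - t *\<^sub>R v) v)"
      using tc t unfolding transport_L1_continuous_def by auto
    then obtain e where e: "0 < e" "\<And>\<sigma> \<delta>. (\<sigma>, \<delta>) \<noteq> (0, 0) \<Longrightarrow> dist (\<sigma>, \<delta>) (0, 0) < e \<Longrightarrow>
        set_integrable lebesgue (ball 0 (real n)) (\<lambda>v. F\<^sub>0 (x + \<delta> - (t + \<sigma>) *\<^sub>R v) v - F\<^sub>0 (x - t *\<^sub>R v) v)"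
      unfolding eventually_at by (auto simp: case_prod_unfold)
    have "\<exists>\<delta>. \<delta> \<in> ball 0 e - {0} \<and> (\<lambda>v. F\<^sub>0 (x + \<delta> - t *\<^sub>R v) v) \<in> borel_measurable lebesgue"
    proof (rule ccontr)
      assume "\<not> ?thesis"
      then have "ball 0 e - {0} \<subseteq> {\<delta>. \<not> (\<lambda>v. F\<^sub>0 (x + \<delta> - t *\<^sub>R v) v) \<in> borel_measurable lebesgue}" by blast
      then have neg: "negligible (ball (0::R3) e - {0})"
        using good negligible_subset unfolding AE_lborel_iff_negligible by blast
      have "open (ball (0::R3) e - {0})" by (simp add: open_Diff)
      moreover have "(e / 2) *\<^sub>R axis 1 1 \<in> ball (0::R3) e - {0}" using e by (simp add: axis_eq_0_iff)
      ultimately show False using neg open_not_negligible by blast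
    qed
    then obtain \<delta> where \<delta>: "\<delta> \<in> ball 0 e" "\<delta> \<noteq> 0" and m: "(\<lambda>v. F\<^sub>0 (x + \<delta> - t *\<^sub>R v) v) \<in> borel_measurable lebesgue"
      by blast
    have "set_integrable lebesgue (ball 0 (real n)) (\<lambda>v. F\<^sub>0 (x + \<delta> - t *\<^sub>R v) v - F\<^sub>0 (x - t *\<^sub>R v) v)"
      using e(2)[of 0 \<delta>] \<delta> by (simp add: dist_Pair_Pair)
    then have "(\<lambda>v. indicator (ball 0 (real n)) v *\<^sub>R (F\<^sub>0 (x + \<delta> - t *\<^sub>R v) v - F\<^sub>0 (x - t *\<^sub>R v) v)) \<in> borel_measurable lebesgue"
      unfolding set_integrable_def by (rule borel_measurable_integrable)
    from borel_measurable_diff[OF borel_measurable_times[OF borel_measurable_indicator m] this, of "ball 0 (real n)"]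
    show ?thesis by (simp add: algebra_simps)
  qed
  show ?thesis
  proof (rule borel_measurable_LIMSEQ_real[OF _ loc])
    fix v :: R3
    obtain N :: nat where "norm v < real N" using reals_Archimedean2 by blast
    then show "(\<lambda>n. indicator (ball 0 (real n)) v * F\<^sub>0 (x - t *\<^sub>R v) v) \<longlonglongrightarrow> F\<^sub>0 (x - t *\<^sub>R v) v"
      by (intro tendsto_eventually) (auto simp: eventually_sequentially intro!: exI[of _ N])
  qed
qed

lemma transport_AE_subseq:
  assumes meas: "(\<lambda>(x, v). F\<^sub>0 x v) \<in> borel_measurable lebesgue" and tc: "transport_L1_continuous F\<^sub>0"
    and A: "\<And>x v. \<bar>F\<^sub>0 x v\<bar> \<le> A"
    and t: "\<And>n. 0 < t n" "0 < t'" "t \<longlonglongrightarrow> t'" and x: "x \<longlonglongrightarrow> x'"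
  shows "\<exists>r::nat\<Rightarrow>nat. strict_mono r \<and>
    (AE v in lborel. (\<lambda>n. F\<^sub>0 (x (r n) - t (r n) *\<^sub>R v) v) \<longlonglongrightarrow> F\<^sub>0 (x' - t' *\<^sub>R v) v)"
proof -
  note [measurable] = transport_measurable[OF meas tc]
  define d where "d n v = F\<^sub>0 (x n - t n *\<^sub>R v) v - F\<^sub>0 (x' - t' *\<^sub>R v) v" for n v
  have dm [measurable]: "d n \<in> borel_measurable lebesgue" for n
    unfolding d_def using t by measurable
  have dA: "\<bar>d n v\<bar> \<le> 2 * A" for n v
    using A[of "x n - t n *\<^sub>R v" v] A[of "x' - t' *\<^sub>R v" v] unfolding d_def by linarith
  have "\<exists>r::nat\<Rightarrow>nat. strict_mono r \<and> (AE v in lborel. (\<lambda>n. d (r n) v) \<longlonglongrightarrow> 0)"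
  proof (rule bounded_L1_loc_AE_subseq[OF dm dA])
    fix R :: real
    have Rm [measurable]: "ball (0::R3) R \<in> sets lebesgue" by simp
    define \<Phi> where "\<Phi> = (\<lambda>(\<sigma>, \<delta>). LINT v:ball 0 R|lebesgue. \<bar>F\<^sub>0 (x' + \<delta> - (t' + \<sigma>) *\<^sub>R v) v - F\<^sub>0 (x' - t' *\<^sub>R v) v\<bar>)"
    have "(\<Phi> \<longlongrightarrow> 0) (at (0, 0))"
      using tc t(2) unfolding transport_L1_continuous_def \<Phi>_def by auto
    moreover have "\<Phi> (0, 0) = 0" by (simp add: \<Phi>_def)
    ultimately have "isCont \<Phi> (0, 0)" by (simp add: isCont_def)
    moreover have "(\<lambda>n. (t n - t', x n - x')) \<longlonglongrightarrow> (0, 0)"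
      using LIM_zero[OF t(3)] LIM_zero[OF x] by (rule tendsto_Pair)
    ultimately have "(\<lambda>n. \<Phi> (t n - t', x n - x')) \<longlonglongrightarrow> \<Phi> (0, 0)" by (rule isCont_tendsto_compose)
    then have lim: "(\<lambda>n. LINT v:ball 0 R|lebesgue. \<bar>d n v\<bar>) \<longlonglongrightarrow> 0"
      by (simp add: \<Phi>_def d_def)
    have "(\<integral>\<^sup>+v. ennreal \<bar>d n v\<bar> * indicator (ball 0 R) v \<partial>lborel) = ennreal (LINT v:ball 0 R|lebesgue. \<bar>d n v\<bar>)" for n
    proof -
      have "emeasure lebesgue (ball (0::R3) R) < \<infinity>"
        using emeasure_ball_finite[of "0::R3" R] by simp
      then have "integrable lebesgue (\<lambda>v. indicator (ball 0 R) v *\<^sub>R \<bar>d n v\<bar>)"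
        by (intro integrableI_bounded_set_indicator[where B = "2 * A"]) (auto simp: dA)
      then have "(\<integral>\<^sup>+v. ennreal (indicator (ball 0 R) v *\<^sub>R \<bar>d n v\<bar>) \<partial>lebesgue) = ennreal (LINT v:ball 0 R|lebesgue. \<bar>d n v\<bar>)"
        unfolding set_lebesgue_integral_def by (rule nn_integral_eq_integral) simp
      moreover have "(\<integral>\<^sup>+v. ennreal (indicator (ball 0 R) v *\<^sub>R \<bar>d n v\<bar>) \<partial>lebesgue) = (\<integral>\<^sup>+v. ennreal \<bar>d n v\<bar> * indicator (ball 0 R) v \<partial>lborel)"
        unfolding nn_integral_completion by (intro nn_integral_cong) (simp add: indicator_def)
      ultimately show ?thesis by simp
    qed
    then show "(\<lambda>n. \<integral>\<^sup>+v. ennreal \<bar>d n v\<bar> * indicator (ball 0 R) v \<partial>lborel) \<longlonglongrightarrow> 0"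
      using tendsto_ennrealI[OF lim] by simp
  qed
  then show ?thesis unfolding d_def
    by (auto intro: LIM_zero_cancel elim!: eventually_mono)
qed

section \<open>Borel representatives and the Duhamel formula\<close>

lemma ereal_integral_enn2ereal:
  assumes "AE x in M. g x = enn2ereal (k x)"
  shows "ereal_integral M g = enn2ereal (\<integral>\<^sup>+x. k x \<partial>M)"
proof -
  have "(\<integral>\<^sup>+x. e2ennreal (g x) \<partial>M) = (\<integral>\<^sup>+x. k x \<partial>M)"
    using assms by (intro nn_integral_cong_AE) (auto elim!: eventually_mono)
  moreover have "(\<integral>\<^sup>+x. e2ennreal (- g x) \<partial>M) = (\<integral>\<^sup>+x. 0 \<partial>M)"
    using assms by (intro nn_integral_cong_AE) (auto elim!: eventually_mono simp: e2ennreal_neg)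
  ultimately show ?thesis by (simp add: ereal_integral_def zero_ennreal.rep_eq)
qed

lemma exp_ereal_minus: "a < \<infinity> \<Longrightarrow> exp_ereal (- enn2ereal a) = ereal (exp (- enn2real a))"
  by (cases a) (auto simp: exp_ereal_def)

lemma angular_representative:
  fixes h :: "real \<Rightarrow> real"
  assumes nonneg: "\<forall>\<theta>\<in>{0..pi/2}. 0 \<le> h \<theta>" and int: "set_integrable lebesgue {0..pi/2} h"
  obtains h' where "h' \<in> borel_measurable borel" "\<And>\<theta>. 0 \<le> h' \<theta>"
    "(\<integral>\<^sup>+\<theta>. ennreal (h' \<theta>) * indicator {0..pi/2} \<theta> \<partial>lborel) < \<infinity>"
    "AE \<theta> in lborel. \<theta> \<in> {0..pi/2} \<longrightarrow> h \<theta> = h' \<theta>"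
proof -
  have I: "integrable lebesgue (\<lambda>\<theta>. indicator {0..pi/2} \<theta> *\<^sub>R h \<theta>)"
    using int by (simp add: set_integrable_def)
  obtain B where B: "B \<in> borel_measurable lborel" "AE \<theta> in lborel. indicator {0..pi/2} \<theta> *\<^sub>R h \<theta> = B \<theta>"
    using completion_ex_borel_measurable_real[OF borel_measurable_integrable[OF I]] by blast
  have [measurable]: "B \<in> borel_measurable borel" using B(1) by simp
  have eq: "AE \<theta> in lborel. \<theta> \<in> {0..pi/2} \<longrightarrow> h \<theta> = max 0 (B \<theta>)"
    using B(2)
  proof (rule eventually_mono, intro impI)
    fix \<theta> assume "indicator {0..pi/2} \<theta> *\<^sub>R h \<theta> = B \<theta>" and \<theta>: "\<theta> \<in> {0..pi/2}"
    then have "B \<theta> = h \<theta>" by simp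
    then show "h \<theta> = max 0 (B \<theta>)" using nonneg \<theta> by (simp only: max_absorb2)
  qed
  have "(\<integral>\<^sup>+\<theta>. ennreal (max 0 (B \<theta>)) * indicator {0..pi/2} \<theta> \<partial>lborel)
      = (\<integral>\<^sup>+\<theta>. ennreal (norm (indicator {0..pi/2} \<theta> *\<^sub>R h \<theta>)) \<partial>lebesgue)"
    unfolding nn_integral_completion using eq
    by (intro nn_integral_cong_AE) (auto elim!: eventually_mono simp: indicator_def nonneg)
  also have "\<dots> < \<infinity>" using I by (simp add: integrable_iff_bounded)
  finally show ?thesis using that[of "\<lambda>\<theta>. max 0 (B \<theta>)"] eq by simp
qed

text \<open>
  The essential supremum exceeds \<open>a\<close> exactly when the superlevel set of the section has positive
  measure, and the measure of sections is a Borel function by Fubini.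
\<close>
lemma esssup_section_measurable:
  fixes g :: "'a::euclidean_space \<times> 'b::euclidean_space \<Rightarrow> ennreal"
  assumes [measurable]: "g \<in> borel_measurable borel"
  shows "(\<lambda>t. esssup lebesgue (\<lambda>p. g (t, p))) \<in> borel_measurable borel"
proof (rule borel_measurableI_greater)
  fix a :: ennreal
  have m: "(\<lambda>p. g (t, p)) \<in> borel_measurable lebesgue" for t
  proof -
    have "(\<lambda>p. g (t, p)) \<in> borel_measurable lborel" by measurable
    then show ?thesis by (rule measurable_completion)
  qed
  have "a < esssup lebesgue (\<lambda>p. g (t, p)) \<longleftrightarrow> (\<integral>\<^sup>+p. indicator {z. a < g z} (t, p) \<partial>lborel) \<noteq> 0" for t
  proof -
    have [measurable]: "{p. a < g (t, p)} \<in> sets borel" by measurable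
    have "(\<integral>\<^sup>+p. indicator {z. a < g z} (t, p) \<partial>lborel) = emeasure lborel {p. a < g (t, p)}"
    proof -
      have "(\<integral>\<^sup>+p. indicator {z. a < g z} (t, p) \<partial>lborel) = (\<integral>\<^sup>+p. indicator {p. a < g (t, p)} p \<partial>lborel)"
        by (intro nn_integral_cong) (simp add: indicator_def)
      also have "\<dots> = emeasure lborel {p. a < g (t, p)}" by (rule nn_integral_indicator) simp
      finally show ?thesis .
    qed
    also have "\<dots> = emeasure lebesgue {p \<in> space lebesgue. a < g (t, p)}" by simp
    finally have eq: "(\<integral>\<^sup>+p. indicator {z. a < g z} (t, p) \<partial>lborel) = emeasure lebesgue {p \<in> space lebesgue. a < g (t, p)}" .
    show ?thesis
    proof
      assume "a < esssup lebesgue (\<lambda>p. g (t, p))"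
      from esssup_pos_measure[OF m this] show "(\<integral>\<^sup>+p. indicator {z. a < g z} (t, p) \<partial>lborel) \<noteq> 0"
        unfolding eq by simp
    next
      assume nz: "(\<integral>\<^sup>+p. indicator {z. a < g z} (t, p) \<partial>lborel) \<noteq> 0"
      show "a < esssup lebesgue (\<lambda>p. g (t, p))"
      proof (rule ccontr)
        assume "\<not> a < esssup lebesgue (\<lambda>p. g (t, p))"
        then have "esssup lebesgue (\<lambda>p. g (t, p)) \<le> a" by simp
        then have "AE p in lebesgue. g (t, p) \<le> a"
          using esssup_AE[where M = lebesgue and f = "\<lambda>p. g (t, p)"] by (auto elim!: eventually_mono)
        then have "AE p in lborel. indicator {z. a < g z} (t, p) = (0::ennreal)"
          unfolding AE_completion_iff by (rule eventually_mono) (auto simp: indicator_def)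
        then have "(\<integral>\<^sup>+p. indicator {z. a < g z} (t, p) \<partial>lborel) = (\<integral>\<^sup>+p. 0 \<partial>(lborel :: 'b measure))"
          by (rule nn_integral_cong_AE)
        with nz show False by simp
      qed
    qed
  qed
  then have "{t. a < esssup lebesgue (\<lambda>p. g (t, p))} = {t. (\<integral>\<^sup>+p. indicator {z. a < g z} (t, p) \<partial>lborel) \<noteq> 0}"
    by blast
  also have "\<dots> \<in> sets borel" by measurable
  finally show "{t \<in> space borel. a < esssup lebesgue (\<lambda>p. g (t, p))} \<in> sets borel" by simp
qed

text \<open>
  In both cases of the definition of \<open>space_X\<close> the function \<open>w F\<close> lies in \<open>L\<^sup>b\<close> in time with values in
  \<open>L\<^sup>\<infinity>\<close>, \<open>b > 2\<close>. The function \<open>W\<close> is the essential supremum of a Borel version of \<open>w F\<close> at each time,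
  so \<open>W\<^sup>2 \<le> 1 + W\<^sup>b\<close> is locally integrable; a truncation makes the bound by \<open>W\<close> valid everywhere.
\<close>
lemma space_X_representative:
  fixes F :: "real \<Rightarrow> R3 \<Rightarrow> R3 \<Rightarrow> real"
  assumes F: "F \<in> space_X (\<lambda>v. japanese v powr \<beta>)"
  obtains f W where "(\<lambda>(\<tau>, y, u). f \<tau> y u) \<in> borel_measurable borel" "\<And>\<tau> y u. 0 \<le> (f \<tau> y u :: real)"
    "\<And>\<tau> y u. f \<tau> y u \<le> W \<tau> * japanese u powr - \<beta>" "W \<in> borel_measurable borel" "\<And>\<tau>. 0 \<le> W \<tau>"
    "\<And>T. (\<integral>\<^sup>+\<tau>. ennreal ((W \<tau>)\<^sup>2) * indicator {0..T} \<tau> \<partial>lborel) < \<infinity>"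
    "AE (t, x, v) in lborel. 0 < t \<longrightarrow> F t x v = f t x v"
proof -
  define w where "w v = japanese v powr \<beta>" for v
  have w_pos: "0 < w v" for v by (simp add: w_def)
  have [measurable]: "w \<in> borel_measurable borel" unfolding w_def by measurable
  obtain b where b: "b > 2" and L: "\<And>T. T > 0 \<Longrightarrow> in_Lp_time Linf_norm_xv b T (\<lambda>t x v. w v * F t x v)"
    using F unfolding space_X_def w_def by blast
  have pos: "AE (t, x, v) in lborel. t > 0 \<longrightarrow> F t x v \<ge> 0"
    using F unfolding space_X_def AE_completion_iff by simp
  define P where "P z = (case z of (t, x, v) \<Rightarrow> indicator {0<..} t * (w v * F t x v))" for z :: "real \<times> R3 \<times> R3"
  have "P \<in> borel_measurable lebesgue"
  proof (rule borel_measurable_LIMSEQ_real)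
    fix z :: "real \<times> R3 \<times> R3"
    obtain N :: nat where N: "fst z < real N" using reals_Archimedean2 by blast
    then have "\<forall>n\<ge>N. indicator ({0<..<real (Suc n)} \<times> UNIV) z *\<^sub>R (case z of (t, x, v) \<Rightarrow> w v * F t x v) = P z"
      by (auto simp: P_def indicator_def case_prod_unfold mem_Times_iff)
    then show "(\<lambda>n. indicator ({0<..<real (Suc n)} \<times> UNIV) z *\<^sub>R (case z of (t, x, v) \<Rightarrow> w v * F t x v)) \<longlonglongrightarrow> P z"
      by (intro tendsto_eventually) (auto simp: eventually_sequentially)
  next
    show "(\<lambda>z. indicator ({0<..<real (Suc n)} \<times> UNIV) z *\<^sub>R (case z of (t, x, v) \<Rightarrow> w v * F t x v)) \<in> borel_measurable lebesgue" for n
      using L[of "real (Suc n)"] unfolding in_Lp_time_def set_borel_measurable_def by simp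
  qed
  then obtain B where B: "B \<in> borel_measurable lborel" "AE z in lborel. P z = B z"
    using completion_ex_borel_measurable_real by blast
  have [measurable]: "B \<in> borel_measurable borel" using B(1) by simp
  define S where "S t = esssup lebesgue (\<lambda>p. ennreal \<bar>B (t, p)\<bar>)" for t
  have [measurable]: "S \<in> borel_measurable borel"
    unfolding S_def by (rule esssup_section_measurable) measurable
  have S_eq: "AE t in lborel. 0 < t \<longrightarrow> Linf_norm_xv (\<lambda>x v. w v * F t x v) = S t"
    using AE_lborel_pair[OF B(2)]
  proof (rule eventually_mono, intro impI)
    fix t :: real assume t: "0 < t" and ae: "AE p in lborel. P (t, p) = B (t, p)"
    have eq: "AE p in lebesgue. ennreal \<bar>B (t, p)\<bar> = (case p of (x, v) \<Rightarrow> ennreal \<bar>w v * F t x v\<bar>)"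
      unfolding AE_completion_iff using ae by (rule eventually_mono) (use t in \<open>auto simp: P_def\<close>)
    have Bm: "(\<lambda>p. B (t, p)) \<in> borel_measurable lebesgue"
    proof -
      have "(\<lambda>p. B (t, p)) \<in> borel_measurable lborel" by measurable
      then show ?thesis by (rule measurable_completion)
    qed
    have "(\<lambda>p. case p of (x, v) \<Rightarrow> w v * F t x v) \<in> borel_measurable lebesgue"
      by (rule borel_measurable_AE[OF Bm])
         (unfold AE_completion_iff, use ae t in \<open>auto simp: P_def elim!: eventually_mono\<close>)
    then have "(\<lambda>p. ennreal \<bar>case p of (x, v) \<Rightarrow> w v * F t x v\<bar>) \<in> borel_measurable lebesgue" by measurable
    moreover have "(\<lambda>p. ennreal \<bar>case p of (x, v) \<Rightarrow> w v * F t x v\<bar>) = (\<lambda>p. case p of (x, v) \<Rightarrow> ennreal \<bar>w v * F t x v\<bar>)"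
      by auto
    ultimately have Fm: "(\<lambda>p. case p of (x, v) \<Rightarrow> ennreal \<bar>w v * F t x v\<bar>) \<in> borel_measurable lebesgue" by simp
    have "(\<lambda>p. ennreal \<bar>B (t, p)\<bar>) \<in> borel_measurable lebesgue" using Bm by measurable
    from esssup_AE_cong[OF this Fm eq] show "Linf_norm_xv (\<lambda>x v. w v * F t x v) = S t"
      unfolding Linf_norm_xv_def S_def by simp
  qed
  have [measurable]: "(\<lambda>t. ennreal_powr (S t) b) \<in> borel_measurable borel"
    unfolding ennreal_powr_def by measurable
  have S_int: "(\<integral>\<^sup>+t. ennreal_powr (S t) b * indicator {0<..<T} t \<partial>lborel) < \<infinity>" if "T > 0" for T
  proof -
    have "(\<integral>\<^sup>+t. ennreal_powr (S t) b * indicator {0<..<T} t \<partial>lborel)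
       = (\<integral>\<^sup>+t. ennreal_powr (Linf_norm_xv (\<lambda>x v. w v * F t x v)) b * indicator {0<..<T} t \<partial>lborel)"
      using S_eq by (intro nn_integral_cong_AE) (auto elim!: eventually_mono simp: indicator_def)
    also have "\<dots> < \<infinity>"
      using L[OF that] unfolding in_Lp_time_def nn_integral_completion by blast
    finally show ?thesis .
  qed
  have S_fin: "AE t in lborel. 0 < t \<longrightarrow> S t \<noteq> \<infinity>"
  proof -
    have "AE t in lborel. ennreal_powr (S t) b * indicator {0<..<real (Suc n)} t \<noteq> \<infinity>" for n
      using S_int[of "real (Suc n)"] by (intro nn_integral_PInf_AE) auto
    then have "AE t in lborel. \<forall>n. ennreal_powr (S t) b * indicator {0<..<real (Suc n)} t \<noteq> \<infinity>"
      by (simp add: AE_all_countable)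
    then show ?thesis
    proof (rule eventually_mono, intro impI)
      fix t :: real assume t: "0 < t" and *: "\<forall>n. ennreal_powr (S t) b * indicator {0<..<real (Suc n)} t \<noteq> \<infinity>"
      obtain N :: nat where "t < real N" using reals_Archimedean2 by blast
      then have "t \<in> {0<..<real (Suc N)}" using t by simp
      then show "S t \<noteq> \<infinity>" using *[rule_format, of N] by (auto simp: ennreal_powr_def)
    qed
  qed
  define W where "W t = enn2real (S t)" for t
  have W0: "0 \<le> W t" for t by (simp add: W_def)
  have [measurable]: "W \<in> borel_measurable borel" unfolding W_def by measurable
  \<comment> \<open>The factor \<open>w\<close> is divided out again, and the two truncations enforce the bounds at every point.\<close>
  define f where "f t x v = (if 0 < t then min (max 0 (B (t, x, v) / w v)) (W t * japanese v powr - \<beta>) else 0)" for t x v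
  have fm: "(\<lambda>(\<tau>, y, u). f \<tau> y u) \<in> borel_measurable borel"
    unfolding f_def case_prod_unfold by measurable
  have f0: "0 \<le> f \<tau> y u" for \<tau> y u using W0[of \<tau>] by (simp add: f_def)
  have fW: "f \<tau> y u \<le> W \<tau> * japanese u powr - \<beta>" for \<tau> y u using W0[of \<tau>] by (simp add: f_def)
  have W2: "(\<integral>\<^sup>+\<tau>. ennreal ((W \<tau>)\<^sup>2) * indicator {0..T} \<tau> \<partial>lborel) < \<infinity>" for T
  proof -
    define T' where "T' = max T 0 + 1"
    have T': "T' > 0" "T < T'" by (auto simp: T'_def)
    have "(\<integral>\<^sup>+\<tau>. ennreal ((W \<tau>)\<^sup>2) * indicator {0..T} \<tau> \<partial>lborel)
      \<le> (\<integral>\<^sup>+\<tau>. indicator {0..T} \<tau> + ennreal_powr (S \<tau>) b * indicator {0<..<T'} \<tau> \<partial>lborel)"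
    proof (rule nn_integral_mono_AE)
      show "AE \<tau> in lborel. ennreal ((W \<tau>)\<^sup>2) * indicator {0..T} \<tau> \<le> indicator {0..T} \<tau> + ennreal_powr (S \<tau>) b * indicator {0<..<T'} \<tau>"
        using S_fin AE_lborel_singleton[of "0::real"]
      proof eventually_elim
        case (elim \<tau>)
        show ?case
        proof (cases "\<tau> \<in> {0..T}")
          case True
          then have \<tau>: "0 < \<tau>" "\<tau> < T'" using elim T' by auto
          have "(W \<tau>)\<^sup>2 \<le> 1 + W \<tau> powr b"
          proof (cases "W \<tau> \<le> 1")
            case True
            then have "(W \<tau>)\<^sup>2 \<le> 1" using W0[of \<tau>] by (simp add: power_le_one)
            then show ?thesis by (smt (verit) powr_ge_zero)
          next
            case False
            then have "W \<tau> powr 2 \<le> W \<tau> powr b" using b by (intro powr_mono) auto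
            then show ?thesis using W0[of \<tau>] by simp
          qed
          then have "ennreal ((W \<tau>)\<^sup>2) \<le> 1 + ennreal (W \<tau> powr b)"
            by (simp add: ennreal_leI flip: ennreal_1 ennreal_plus)
          also have "ennreal (W \<tau> powr b) = ennreal_powr (S \<tau>) b"
            using elim \<tau> by (simp add: ennreal_powr_def W_def)
          finally show ?thesis using True \<tau> by simp
        qed simp
      qed
    qed
    also have "\<dots> = emeasure lborel {0..T} + (\<integral>\<^sup>+\<tau>. ennreal_powr (S \<tau>) b * indicator {0<..<T'} \<tau> \<partial>lborel)"
      by (subst nn_integral_add) auto
    also have "\<dots> < \<infinity>" using S_int[OF T'(1)] by (cases "0 \<le> T") auto
    finally show ?thesis .
  qed
  have B_le: "AE z in lborel. 0 < fst z \<longrightarrow> \<bar>B (fst z, snd z)\<bar> \<le> W (fst z)"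
  proof (rule AE_lborel_pairI)
    show "AE t in lborel. AE p in lborel. 0 < t \<longrightarrow> \<bar>B (t, p)\<bar> \<le> W t"
      using S_fin
    proof (rule eventually_mono)
      fix t assume fin: "0 < t \<longrightarrow> S t \<noteq> \<infinity>"
      have "AE p in lborel. ennreal \<bar>B (t, p)\<bar> \<le> S t"
        using esssup_AE[where M = lebesgue and f = "\<lambda>p. ennreal \<bar>B (t, p)\<bar>"] unfolding S_def AE_completion_iff .
      then show "AE p in lborel. 0 < t \<longrightarrow> \<bar>B (t, p)\<bar> \<le> W t"
      proof (rule eventually_mono, intro impI)
        fix p assume "ennreal \<bar>B (t, p)\<bar> \<le> S t" "0 < t"
        then have "ennreal \<bar>B (t, p)\<bar> \<le> ennreal (W t)" using fin by (simp add: W_def less_top[symmetric])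
        then show "\<bar>B (t, p)\<bar> \<le> W t" using W0[of t] by simp
      qed
    qed
  qed measurable
  have "AE (t, x, v) in lborel. 0 < t \<longrightarrow> F t x v = f t x v"
    using B(2) B_le pos
  proof eventually_elim
    case (elim z)
    obtain t x v where z: "z = (t, x, v)" by (cases z)
    have "F t x v = f t x v" if t: "0 < t"
    proof -
      have 1: "B (t, x, v) = w v * F t x v" "0 \<le> F t x v" "\<bar>B (t, x, v)\<bar> \<le> W t"
        using elim t by (auto simp: z P_def)
      then have 2: "B (t, x, v) / w v = F t x v" using w_pos[of v] by simp
      have "w v * F t x v \<le> W t" using 1 by simp
      then have "F t x v \<le> W t * japanese v powr - \<beta>"
        using w_pos[of v] by (simp add: w_def powr_minus field_simps)
      then show ?thesis using 1 2 t by (simp add: f_def)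
    qed
    then show ?case by (simp add: z)
  qed
  with that[of f W] fm f0 fW W0 W2 show ?thesis by simp
qed

context collision_kernel begin

lemma kernel_eq_AE:
  assumes q: "AE \<theta> in lborel. \<theta> \<in> {0..pi/2} \<longrightarrow> h\<^sub>0 \<theta> = h \<theta>" and vu: "v \<noteq> u"
  shows "AE \<omega> in sphere_measure. norm (v - u) powr \<gamma> * h\<^sub>0 (collision_angle (v - u) \<omega>) = kernel v u \<omega>"
proof -
  obtain N where N: "{\<theta>. \<not> (\<theta> \<in> {0..pi/2} \<longrightarrow> h\<^sub>0 \<theta> = h \<theta>)} \<subseteq> N" "N \<in> null_sets lborel"
    using q by (auto simp: eventually_ae_filter)
  have [measurable]: "N \<in> sets borel" using N(2) by auto
  have "(\<integral>\<^sup>+\<theta>. indicator N \<theta> * indicator {0..pi/2} \<theta> \<partial>lborel) \<le> (\<integral>\<^sup>+\<theta>. indicator N \<theta> \<partial>lborel)"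
    by (intro nn_integral_mono) (auto simp: indicator_def)
  also have "\<dots> = 0" using N(2) by auto
  finally have 0: "(\<integral>\<^sup>+\<theta>. indicator N \<theta> * indicator {0..pi/2} \<theta> \<partial>lborel) = 0" by simp
  have "(\<integral>\<^sup>+\<omega>. indicator N (collision_angle (v - u) \<omega>) \<partial>sphere_measure) = 0"
    using nn_integral_collision_angle_le[of "indicator N" "v - u"] vu by (simp add: 0)
  then have "AE \<omega> in sphere_measure. indicator N (collision_angle (v - u) \<omega>) = (0::ennreal)"
    by (subst (asm) nn_integral_0_iff_AE) auto
  then show ?thesis
    using AE_sphere_measure
  proof eventually_elim
    case (elim \<omega>)
    have "\<bar>(v - u) \<bullet> \<omega>\<bar> \<le> norm (v - u)"
      using Cauchy_Schwarz_ineq2[of "v - u" \<omega>] elim by simp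
    then have "\<bar>(v - u) \<bullet> \<omega>\<bar> / norm (v - u) \<le> 1" "0 \<le> \<bar>(v - u) \<bullet> \<omega>\<bar> / norm (v - u)"
      using vu by simp_all
    then have "collision_angle (v - u) \<omega> \<in> {0..pi/2}"
      unfolding collision_angle_def atLeastAtMost_iff by (intro conjI arccos_lbound arccos_le_pi2) linarith+
    moreover have "collision_angle (v - u) \<omega> \<notin> N" using elim by (auto simp: indicator_def split: if_splits)
    ultimately show ?case using N(1) by (auto simp: kernel_def)
  qed
qed

lemma collision_freq_eq:
  assumes q: "AE \<theta> in lborel. \<theta> \<in> {0..pi/2} \<longrightarrow> h\<^sub>0 \<theta> = h \<theta>" 
    and g: "\<And>u. 0 \<le> g u" "AE u in lborel. F \<tau> (x - (t - \<tau>) *\<^sub>R v) u = g u"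
  shows "collision_freq (\<lambda>\<theta> z. norm z powr \<gamma> * h\<^sub>0 \<theta>) F \<tau> t x v = enn2ereal (freq g v)"
  unfolding collision_freq_def freq_def nn_integral_completion[of lborel, symmetric]
proof (rule ereal_integral_enn2ereal)
  show "AE u in lebesgue. ereal_integral sphere_measure (\<lambda>\<omega>. ereal (norm (v - u) powr \<gamma> * h\<^sub>0 (collision_angle (v - u) \<omega>)
      * F \<tau> (x - (t - \<tau>) *\<^sub>R v) u)) = enn2ereal (\<integral>\<^sup>+\<omega>. ennreal (kernel v u \<omega> * g u) \<partial>sphere_measure)"
    unfolding AE_completion_iff using g(2) AE_lborel_singleton[of v]
  proof eventually_elim
    case (elim u)
    show ?case
    proof (rule ereal_integral_enn2ereal)
      have "v \<noteq> u" using elim by simp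
      from kernel_eq_AE[OF q this]
      show "AE \<omega> in sphere_measure. ereal (norm (v - u) powr \<gamma> * h\<^sub>0 (collision_angle (v - u) \<omega>)
        * F \<tau> (x - (t - \<tau>) *\<^sub>R v) u) = enn2ereal (ennreal (kernel v u \<omega> * g u))"
        by (rule eventually_mono) (simp add: elim kernel_nonneg g enn2ereal_ennreal)
    qed
  qed
qed

text \<open>
  The gain term of \<open>F\<close> depends only on the almost everywhere class of \<open>F\<close>, because the
  post-collisional velocities avoid null sets.
\<close>
lemma Q_plus_eq:
  assumes q: "AE \<theta> in lborel. \<theta> \<in> {0..pi/2} \<longrightarrow> h\<^sub>0 \<theta> = h \<theta>" 
    and g: "\<And>u. 0 \<le> g u" "AE u in lborel. F u = g u"
  shows "Q_plus (\<lambda>\<theta> z. norm z powr \<gamma> * h\<^sub>0 \<theta>) F F v = enn2ereal (gain g v)"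
  unfolding Q_plus_def gain_def nn_integral_completion[of lborel, symmetric]
proof (rule ereal_integral_enn2ereal)
  obtain N where N: "{u. \<not> F u = g u} \<subseteq> N" "N \<in> null_sets lborel"
    using g(2) by (auto simp: eventually_ae_filter)
  have "AE u in lborel. u \<notin> N" using N(2) by (rule AE_not_in)
  then have "AE u in lborel. AE \<omega> in sphere_measure. post_u v u \<omega> \<notin> N \<and> post_v v u \<omega> \<notin> N"
    using N(2) by (intro AE_post_notin) auto
  then show "AE u in lebesgue. ereal_integral sphere_measure (\<lambda>\<omega>. ereal (norm (v - u) powr \<gamma> * h\<^sub>0 (collision_angle (v - u) \<omega>)
      * F (post_u v u \<omega>) * F (post_v v u \<omega>))) = enn2ereal (\<integral>\<^sup>+\<omega>. ennreal (kernel v u \<omega> * g (post_u v u \<omega>) * g (post_v v u \<omega>)) \<partial>sphere_measure)"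
    unfolding AE_completion_iff using AE_lborel_singleton[of v]
  proof eventually_elim
    case (elim u)
    show ?case
    proof (rule ereal_integral_enn2ereal)
      have "v \<noteq> u" using elim by simp
      from kernel_eq_AE[OF q this] elim(1)
      show "AE \<omega> in sphere_measure. ereal (norm (v - u) powr \<gamma> * h\<^sub>0 (collision_angle (v - u) \<omega>)
        * F (post_u v u \<omega>) * F (post_v v u \<omega>)) = enn2ereal (ennreal (kernel v u \<omega> * g (post_u v u \<omega>) * g (post_v v u \<omega>)))"
      proof eventually_elim
        case (elim \<omega>)
        then have "F (post_u v u \<omega>) = g (post_u v u \<omega>)" "F (post_v v u \<omega>) = g (post_v v u \<omega>)" using N(1) by auto
        then show ?case by (simp add: elim kernel_nonneg g enn2ereal_ennreal)
      qed
    qed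
  qed
qed

end

lemma ereal_integral_lebesgue_on:
  assumes "AE \<tau> in lborel. \<tau> \<in> {a..b} \<longrightarrow> g \<tau> = enn2ereal (k \<tau>)"
  shows "ereal_integral (lebesgue_on {a..b}) g = enn2ereal (\<integral>\<^sup>+\<tau>. k \<tau> * indicator {a..b} \<tau> \<partial>(lborel :: real measure))"
proof -
  have "AE \<tau> in lebesgue_on {a..b}. g \<tau> = enn2ereal (k \<tau>)"
    using assms by (subst AE_restrict_space_iff) (auto simp: AE_completion_iff)
  then have "ereal_integral (lebesgue_on {a..b}) g = enn2ereal (\<integral>\<^sup>+\<tau>. k \<tau> \<partial>lebesgue_on {a..b})"
    by (rule ereal_integral_enn2ereal)
  also have "(\<integral>\<^sup>+\<tau>. k \<tau> \<partial>lebesgue_on {a..b}) = (\<integral>\<^sup>+\<tau>. k \<tau> * indicator {a..b} \<tau> \<partial>lebesgue)"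
    by (rule nn_integral_restrict_space) simp
  finally show ?thesis by (simp add: nn_integral_completion)
qed

context dominated_density begin

text \<open>
  The map \<open>(v, \<tau>, u) \<mapsto> (\<tau>, x - (t - \<tau>) v, u)\<close> has a differentiable left inverse on \<open>\<tau> < t\<close>. Therefore,
  for almost every \<open>v\<close> and almost every \<open>\<tau>\<close>, the densities \<open>F\<close> and \<open>f\<close> agree almost everywhere in \<open>u\<close> at
  the point of the characteristic, and the extended real integrals of the formula take the finite
  values computed with \<open>f\<close>.
\<close>
lemma duhamel_AE:
  assumes h0: "AE \<theta> in lborel. \<theta> \<in> {0..pi/2} \<longrightarrow> h\<^sub>0 \<theta> = h \<theta>"
    and Ff: "AE (t, x, v) in lborel. 0 < t \<longrightarrow> F t x v = f t x v"
    and sol: "duhamel_solution (\<lambda>\<theta> z. norm z powr \<gamma> * h\<^sub>0 \<theta>) F\<^sub>0 F" and t: "0 < t"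
  shows "AE v in lborel. F t x v = F\<^sub>0 (x - t *\<^sub>R v) v * exp (- enn2real (absorption 0 t x v)) + enn2real (source t x v)"
proof -
  let ?q = "\<lambda>\<theta> z. norm (z :: R3) powr \<gamma> * h\<^sub>0 \<theta>"
  have "AE z :: R3 \<times> real \<times> R3 in lborel. fst (snd z) < t \<longrightarrow>
     (case (fst (snd z), x - (t - fst (snd z)) *\<^sub>R fst z, snd (snd z)) of (t, x, v) \<Rightarrow> 0 < t \<longrightarrow> F t x v = f t x v)"
  proof (rule AE_lborel_preimage[OF Ff, where S = "{w. fst w < t}"
      and f = "\<lambda>z. (fst (snd z), x - (t - fst (snd z)) *\<^sub>R fst z, snd (snd z))"
      and g = "\<lambda>w. ((1 / (t - fst w)) *\<^sub>R (x - fst (snd w)), fst w, snd (snd w))"])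
    fix w :: "real \<times> R3 \<times> R3" assume "w \<in> {w. fst w < t}"
    then show "(\<lambda>w. ((1 / (t - fst w)) *\<^sub>R (x - fst (snd w)), fst w, snd (snd w))) differentiable (at w)"
      by (intro derivative_intros differentiable_divide) auto
  qed auto
  then have "AE v in lborel. AE p in lborel. fst p < t \<longrightarrow> 0 < fst p \<longrightarrow>
      F (fst p) (x - (t - fst p) *\<^sub>R v) (snd p) = f (fst p) (x - (t - fst p) *\<^sub>R v) (snd p)"
    using AE_lborel_pair by fastforce
  then show ?thesis
  proof (rule eventually_mono)
    fix v
    assume "AE p in lborel. fst p < t \<longrightarrow> 0 < fst p \<longrightarrow>
      F (fst p) (x - (t - fst p) *\<^sub>R v) (snd p) = f (fst p) (x - (t - fst p) *\<^sub>R v) (snd p)"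
    from AE_lborel_pair[OF this]
    have ae: "AE \<tau> in lborel. \<tau> < t \<longrightarrow> 0 < \<tau> \<longrightarrow>
        (AE u in lborel. F \<tau> (x - (t - \<tau>) *\<^sub>R v) u = f \<tau> (x - (t - \<tau>) *\<^sub>R v) u)"
      by (rule eventually_mono) auto
    have good: "AE \<tau> in lborel. \<tau> \<in> {0..t} \<longrightarrow>
        collision_freq ?q F \<tau> t x v = enn2ereal (freq (f \<tau> (x - (t - \<tau>) *\<^sub>R v)) v) \<and>
        Q_plus ?q (F \<tau> (x - (t - \<tau>) *\<^sub>R v)) (F \<tau> (x - (t - \<tau>) *\<^sub>R v)) v = enn2ereal (gain (f \<tau> (x - (t - \<tau>) *\<^sub>R v)) v)"
      using ae AE_lborel_singleton[of t] AE_lborel_singleton[of "0::real"]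
    proof eventually_elim
      case (elim \<tau>)
      show ?case
      proof
        assume "\<tau> \<in> {0..t}"
        then have ae': "AE u in lborel. F \<tau> (x - (t - \<tau>) *\<^sub>R v) u = f \<tau> (x - (t - \<tau>) *\<^sub>R v) u"
          using elim by auto
        show "collision_freq ?q F \<tau> t x v = enn2ereal (freq (f \<tau> (x - (t - \<tau>) *\<^sub>R v)) v) \<and>
          Q_plus ?q (F \<tau> (x - (t - \<tau>) *\<^sub>R v)) (F \<tau> (x - (t - \<tau>) *\<^sub>R v)) v = enn2ereal (gain (f \<tau> (x - (t - \<tau>) *\<^sub>R v)) v)"
          by (intro conjI collision_freq_eq[OF h0] Q_plus_eq[OF h0] f_nonneg ae')
      qed
    qed
    have abs_eq: "ereal_integral (lebesgue_on {s..t}) (\<lambda>\<tau>. collision_freq ?q F \<tau> t x v) = enn2ereal (absorption s t x v)"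
      if s: "0 \<le> s" for s
      unfolding absorption_def
      by (rule ereal_integral_lebesgue_on) (use good s in \<open>auto elim!: eventually_mono\<close>)
    have exp_eq: "exp_ereal (- ereal_integral (lebesgue_on {s..t}) (\<lambda>\<tau>. collision_freq ?q F \<tau> t x v))
        = ereal (exp (- enn2real (absorption s t x v)))" if s: "0 \<le> s" for s
      unfolding abs_eq[OF s] by (rule exp_ereal_minus[OF absorption_finite[OF s]])
    have src_eq: "ereal_integral (lebesgue_on {0..t}) (\<lambda>s.
            exp_ereal (- ereal_integral (lebesgue_on {s..t}) (\<lambda>\<tau>. collision_freq ?q F \<tau> t x v))
            * Q_plus ?q (F s (x - (t - s) *\<^sub>R v)) (F s (x - (t - s) *\<^sub>R v)) v) = enn2ereal (source t x v)"
      unfolding source_def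
    proof (rule ereal_integral_lebesgue_on)
      show "AE s in lborel. s \<in> {0..t} \<longrightarrow>
         exp_ereal (- ereal_integral (lebesgue_on {s..t}) (\<lambda>\<tau>. collision_freq ?q F \<tau> t x v))
            * Q_plus ?q (F s (x - (t - s) *\<^sub>R v)) (F s (x - (t - s) *\<^sub>R v)) v
         = enn2ereal (ennreal (exp (- enn2real (absorption s t x v))) * gain (f s (x - (t - s) *\<^sub>R v)) v)"
        using good by (rule eventually_mono) (auto simp: exp_eq times_ennreal.rep_eq enn2ereal_ennreal)
    qed
    obtain C where "source t x v \<le> ennreal (C * japanese v powr - decay)"
      by (rule source_le[of t]) blast
    then have src_fin: "source t x v < \<infinity>" by (rule le_less_trans) simp
    have "ereal (F t x v) = ereal (F\<^sub>0 (x - t *\<^sub>R v) v) * ereal (exp (- enn2real (absorption 0 t x v))) + enn2ereal (source t x v)"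
      using sol[unfolded duhamel_solution_def, rule_format, OF t, of x v] by (simp only: src_eq exp_eq[OF order_refl])
    also have "enn2ereal (source t x v) = ereal (enn2real (source t x v))"
      using src_fin by (cases "source t x v") auto
    finally show "F t x v = F\<^sub>0 (x - t *\<^sub>R v) v * exp (- enn2real (absorption 0 t x v)) + enn2real (source t x v)"
      by simp
  qed
qed

end

section \<open>Continuity of the macroscopic quantities\<close>

theorem theorem1p1:
  fixes \<gamma> \<beta> :: real
    and h :: "real \<Rightarrow> real"
    and q :: "real \<Rightarrow> real^3 \<Rightarrow> real"
    and w :: "real^3 \<Rightarrow> real"
    and F\<^sub>0 :: "real^3 \<Rightarrow> real^3 \<Rightarrow> real"
    and F :: "real \<Rightarrow> real^3 \<Rightarrow> real^3 \<Rightarrow> real"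
  assumes "-3 < \<gamma>" and "\<gamma> \<le> 1"
    and "\<forall>\<theta>\<in>{0..pi/2}. 0 \<le> h \<theta>"
    and "set_integrable lebesgue {0..pi/2} h"
    and "q = (\<lambda>\<theta> z. norm z powr \<gamma> * h \<theta>)"
    and "\<beta> > 8 + 2 * max 0 \<gamma>"
    and "w = (\<lambda>v. (1 + (norm v)\<^sup>2) powr (\<beta> / 2))"
    and "(\<lambda>(x, v). F\<^sub>0 x v) \<in> borel_measurable lebesgue"
    and "\<forall>x v. 0 \<le> F\<^sub>0 x v"
    and "bdd_above (range (\<lambda>(x, v). w v * \<bar>F\<^sub>0 x v\<bar>))"
    and "transport_L1_continuous F\<^sub>0"
    and "duhamel_solution q F\<^sub>0 F"
    and "F \<in> space_X w"
  shows "(\<forall>x. \<forall>t>0. integrable lebesgue (\<lambda>v. F t x v) \<and>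
                   integrable lebesgue (\<lambda>v. F t x v *\<^sub>R v) \<and>
                   integrable lebesgue (\<lambda>v. (norm v)\<^sup>2 * F t x v)) \<and>
         continuous_on (UNIV \<times> {0<..}) (\<lambda>(x, t). LINT v|lebesgue. F t x v) \<and>
         continuous_on (UNIV \<times> {0<..}) (\<lambda>(x, t). LINT v|lebesgue. F t x v *\<^sub>R v) \<and>
         continuous_on (UNIV \<times> {0<..}) (\<lambda>(x, t). LINT v|lebesgue. (norm v)\<^sup>2 * F t x v)"
proof -
  have w: "w = (\<lambda>v. japanese v powr \<beta>)" by (simp add: assms(7) japanese_powr_eq)
  obtain h' where h': "h' \<in> borel_measurable borel" "\<And>\<theta>. 0 \<le> h' \<theta>"
    "(\<integral>\<^sup>+\<theta>. ennreal (h' \<theta>) * indicator {0..pi/2} \<theta> \<partial>lborel) < \<infinity>"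
    "AE \<theta> in lborel. \<theta> \<in> {0..pi/2} \<longrightarrow> h \<theta> = h' \<theta>"
    using angular_representative[OF assms(3,4)] by blast
  obtain f W where f: "(\<lambda>(\<tau>, y, u). f \<tau> y u) \<in> borel_measurable borel" "\<And>\<tau> y u. 0 \<le> (f \<tau> y u :: real)"
    "\<And>\<tau> y u. f \<tau> y u \<le> W \<tau> * japanese u powr - \<beta>" "W \<in> borel_measurable borel" "\<And>\<tau>. 0 \<le> W \<tau>"
    "\<And>T. (\<integral>\<^sup>+\<tau>. ennreal ((W \<tau>)\<^sup>2) * indicator {0..T} \<tau> \<partial>lborel) < \<infinity>"
    and Ff: "AE (t, x, v) in lborel. 0 < t \<longrightarrow> F t x v = f t x v"
    using space_X_representative[OF assms(13)[unfolded w]] by blast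
  interpret dominated_density \<gamma> \<beta> h' f W
    by unfold_locales (use assms h' f in auto)
  obtain A where A: "\<And>x v. w v * \<bar>F\<^sub>0 x v\<bar> \<le> A"
    using assms(10) by (fastforce simp: bdd_above_def)
  have F0_le: "\<bar>F\<^sub>0 x v\<bar> \<le> A * japanese v powr - \<beta>" for x v
    using A[of v x] by (simp add: w powr_minus field_simps)
  have A0: "0 \<le> A" using A[of 0 0] by (smt (verit) w mult_nonneg_nonneg abs_ge_zero powr_ge_zero)
  have decay_le: "japanese v powr - \<beta> \<le> japanese v powr - decay" for v
    using decay_pos japanese_ge_1 by (intro powr_mono) auto
  have F0_le_A: "\<bar>F\<^sub>0 x v\<bar> \<le> A" for x v
  proof -
    have "japanese v powr - \<beta> \<le> japanese v powr 0" using beta japanese_ge_1[of v] by (intro powr_mono) auto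
    then have "A * japanese v powr - \<beta> \<le> A * 1" using A0 by (intro mult_left_mono) auto
    then show ?thesis using F0_le[of x v] by simp
  qed
  let ?D = "\<lambda>t x v. F\<^sub>0 (x - t *\<^sub>R v) v * exp (- enn2real (absorption 0 t x v)) + enn2real (source t x v)"
  have duhamel: "AE v in lborel. F t x v = ?D t x v"
    if "0 < t" for t x
    by (rule duhamel_AE[OF h'(4) Ff _ that]) (use assms(5,12) in simp)
  \<comment> \<open>Measurability at a fixed \<open>(t, x)\<close> can only come from the Duhamel formula.\<close>
  have F_meas: "F t x \<in> borel_measurable lebesgue" if t: "0 < t" for t x
  proof (rule borel_measurable_AE)
    have [measurable]: "(\<lambda>v. F\<^sub>0 (x - t *\<^sub>R v) v) \<in> borel_measurable lebesgue"
      by (rule transport_measurable[OF assms(8,11) t])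
    have "(\<lambda>v. exp (- enn2real (absorption 0 t x v))) \<in> borel_measurable lborel"
      "(\<lambda>v. enn2real (source t x v)) \<in> borel_measurable lborel" by measurable
    then have [measurable]: "(\<lambda>v. exp (- enn2real (absorption 0 t x v))) \<in> borel_measurable lebesgue"
      "(\<lambda>v. enn2real (source t x v)) \<in> borel_measurable lebesgue" by (auto intro: measurable_completion)
    show "(\<lambda>v. ?D t x v) \<in> borel_measurable lebesgue"
      by measurable
    show "AE v in lebesgue. ?D t x v = F t x v"
      unfolding AE_completion_iff using duhamel[OF t, of x] by (auto elim!: eventually_mono)
  qed
  have F_bound: "\<exists>C. \<forall>t x. 0 < t \<longrightarrow> t \<le> T \<longrightarrow> (AE v in lborel. \<bar>F t x v\<bar> \<le> C * japanese v powr - decay)" for T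
  proof -
    obtain C where C: "0 \<le> C" "\<And>t x v. t \<le> T \<Longrightarrow> source t x v \<le> ennreal (C * japanese v powr - decay)"
      by (rule source_le[of T]) blast
    have "AE v in lborel. \<bar>F t x v\<bar> \<le> (A + C) * japanese v powr - decay" if t: "0 < t" "t \<le> T" for t x
      using duhamel[OF t(1), of x]
    proof (rule eventually_mono)
      fix v assume eq: "F t x v = ?D t x v"
      have "\<bar>F\<^sub>0 (x - t *\<^sub>R v) v * exp (- enn2real (absorption 0 t x v))\<bar> \<le> (A * japanese v powr - \<beta>) * 1"
        unfolding abs_mult using F0_le[of "x - t *\<^sub>R v" v] by (intro mult_mono) (auto intro: order_trans[OF abs_ge_zero])
      also have "\<dots> \<le> A * japanese v powr - decay" using decay_le[of v] A0 by (simp add: mult_left_mono)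
      finally have 1: "\<bar>F\<^sub>0 (x - t *\<^sub>R v) v * exp (- enn2real (absorption 0 t x v))\<bar> \<le> A * japanese v powr - decay" .
      have 2: "enn2real (source t x v) \<le> C * japanese v powr - decay"
        using enn2real_mono[OF C(2)[OF t(2), of x v]] C(1) by simp
      have "\<bar>F t x v\<bar> \<le> \<bar>F\<^sub>0 (x - t *\<^sub>R v) v * exp (- enn2real (absorption 0 t x v))\<bar> + \<bar>enn2real (source t x v)\<bar>"
        unfolding eq by (rule abs_triangle_ineq)
      then show "\<bar>F t x v\<bar> \<le> (A + C) * japanese v powr - decay" using 1 2 by (simp add: distrib_right)
    qed
    then show ?thesis by blast
  qed
  have F_subseq: "\<exists>r::nat\<Rightarrow>nat. strict_mono r \<and> (AE v in lborel. (\<lambda>n. F (t (r n)) (x (r n)) v) \<longlonglongrightarrow> F t' x' v)"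
    if t: "\<And>n. 0 < t n" "0 < t'" "t \<longlonglongrightarrow> t'" and x: "x \<longlonglongrightarrow> x'" for t :: "nat \<Rightarrow> real" and t' and x :: "nat \<Rightarrow> R3" and x'
  proof -
    obtain r1 :: "nat \<Rightarrow> nat" where r1: "strict_mono r1"
      "AE v in lborel. (\<lambda>n. F\<^sub>0 (x (r1 n) - t (r1 n) *\<^sub>R v) v) \<longlonglongrightarrow> F\<^sub>0 (x' - t' *\<^sub>R v) v"
      using transport_AE_subseq[OF assms(8,11) F0_le_A t x] by blast
    have t1: "(\<lambda>n. t (r1 n)) \<longlonglongrightarrow> t'" and x1: "(\<lambda>n. x (r1 n)) \<longlonglongrightarrow> x'"
      using LIMSEQ_subseq_LIMSEQ[OF t(3) r1(1)] LIMSEQ_subseq_LIMSEQ[OF x r1(1)] by (simp_all add: o_def)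
    obtain r2 :: "nat \<Rightarrow> nat" where r2: "strict_mono r2" "AE v in lborel.
       (\<lambda>n. absorption 0 (t (r1 (r2 n))) (x (r1 (r2 n))) v) \<longlonglongrightarrow> absorption 0 t' x' v \<and>
       (\<lambda>n. source (t (r1 (r2 n))) (x (r1 (r2 n))) v) \<longlonglongrightarrow> source t' x' v"
      using absorption_source_subseq[OF t1 x1] by blast
    obtain C where C: "\<And>x v. source t' x v \<le> ennreal (C * japanese v powr - decay)"
      by (rule source_le[of t']) blast
    have src_fin: "source t' x' v \<noteq> \<infinity>" for v using C[of x' v] by (auto simp: top_unique)
    have "AE v in lborel. \<forall>n. F (t (r1 (r2 n))) (x (r1 (r2 n))) v = F\<^sub>0 (x (r1 (r2 n)) - t (r1 (r2 n)) *\<^sub>R v) v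
        * exp (- enn2real (absorption 0 (t (r1 (r2 n))) (x (r1 (r2 n))) v)) + enn2real (source (t (r1 (r2 n))) (x (r1 (r2 n))) v)"
      using duhamel[OF t(1)] by (simp add: AE_all_countable)
    then have "AE v in lborel. (\<lambda>n. F (t (r1 (r2 n))) (x (r1 (r2 n))) v) \<longlonglongrightarrow> F t' x' v"
      using r1(2) r2(2) duhamel[OF t(2), of x']
    proof eventually_elim
      case (elim v)
      have "(\<lambda>n. F\<^sub>0 (x (r1 (r2 n)) - t (r1 (r2 n)) *\<^sub>R v) v) \<longlonglongrightarrow> F\<^sub>0 (x' - t' *\<^sub>R v) v"
        using LIMSEQ_subseq_LIMSEQ[OF elim(2) r2(1)] by (simp add: o_def)
      moreover have "(\<lambda>n. enn2real (absorption 0 (t (r1 (r2 n))) (x (r1 (r2 n))) v)) \<longlonglongrightarrow> enn2real (absorption 0 t' x' v)"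
        using elim(3) absorption_finite[of 0 t' x' v] by (intro tendsto_enn2real) (auto simp: less_top[symmetric])
      moreover have "(\<lambda>n. enn2real (source (t (r1 (r2 n))) (x (r1 (r2 n))) v)) \<longlonglongrightarrow> enn2real (source t' x' v)"
        using elim(3) src_fin[of v] by (intro tendsto_enn2real) (auto simp: less_top[symmetric])
      ultimately show ?case unfolding elim(1)[rule_format] elim(4)
        by (intro tendsto_add tendsto_mult tendsto_exp tendsto_minus)
    qed
    moreover have "strict_mono (\<lambda>n. r1 (r2 n))"
      using strict_mono_o[OF r1(1) r2(1)] by (simp add: o_def)
    ultimately show ?thesis by blast
  qed
  have phi: "norm (1::real) \<le> (japanese v)\<^sup>2" "norm v \<le> (japanese v)\<^sup>2" "norm ((norm v)\<^sup>2) \<le> (japanese v)\<^sup>2" for v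
  proof -
    show "norm (1::real) \<le> (japanese v)\<^sup>2" "norm ((norm v)\<^sup>2) \<le> (japanese v)\<^sup>2" by (auto simp: japanese_power2)
    have "norm v \<le> japanese v * 1" using norm_le_japanese by simp
    also have "\<dots> \<le> japanese v * japanese v" using japanese_ge_1 by (intro mult_left_mono) (auto simp: less_imp_le)
    finally show "norm v \<le> (japanese v)\<^sup>2" by (simp add: power2_eq_square)
  qed
  have m0: "(\<lambda>v::R3. 1::real) \<in> borel_measurable borel" and m1: "(\<lambda>v::R3. v) \<in> borel_measurable borel"
    and m2: "(\<lambda>v::R3. (norm v)\<^sup>2) \<in> borel_measurable borel" by measurable
  have i0: "integrable lebesgue (\<lambda>v. F t x v *\<^sub>R (1::real))" if "0 < t" for t x
    by (rule moments_continuous(1)[OF F_meas F_bound decay_gt_5 F_subseq m0 phi(1)]) (use that in blast)+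
  have i1: "integrable lebesgue (\<lambda>v. F t x v *\<^sub>R v)" if "0 < t" for t x
    by (rule moments_continuous(1)[OF F_meas F_bound decay_gt_5 F_subseq m1 phi(2)]) (use that in blast)+
  have i2: "integrable lebesgue (\<lambda>v. F t x v *\<^sub>R (norm v)\<^sup>2)" if "0 < t" for t x
    by (rule moments_continuous(1)[OF F_meas F_bound decay_gt_5 F_subseq m2 phi(3)]) (use that in blast)+
  have c0: "continuous_on (UNIV \<times> {0<..}) (\<lambda>(x, t). LINT v|lebesgue. F t x v *\<^sub>R (1::real))"
    by (rule moments_continuous(2)[OF F_meas F_bound decay_gt_5 F_subseq m0 phi(1)]) blast+
  have c1: "continuous_on (UNIV \<times> {0<..}) (\<lambda>(x, t). LINT v|lebesgue. F t x v *\<^sub>R v)"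
    by (rule moments_continuous(2)[OF F_meas F_bound decay_gt_5 F_subseq m1 phi(2)]) blast+
  have c2: "continuous_on (UNIV \<times> {0<..}) (\<lambda>(x, t). LINT v|lebesgue. F t x v *\<^sub>R (norm v)\<^sup>2)"
    by (rule moments_continuous(2)[OF F_meas F_bound decay_gt_5 F_subseq m2 phi(3)]) blast+
  show ?thesis
    using i0 i1 i2 c0 c1 c2 by (simp add: mult.commute)
qed

end
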